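(* Let $\Delta$ be a constant integer, let $0<\beta<1$ and $\lambda>0$ be constants, and suppose $\beta\ge 1-\frac{2}{2e^{-1/2}\Delta+3}$. Then there is an FPTAS that computes the partition function of the anti-ferromagnetic Ising model with interaction parameter $\beta$ and external field $\lambda$ for hypergraphs of maximum degree $\Delta$.
   Context: A hypergraph $G=(V,\mathcal{E})$ has a finite vertex set $V$ and a set of hyperedges $\mathcal{E}\subseteq 2^V$ of arbitrary sizes; the degree of a vertex is the number of hyperedges containing it. A configuration is a map $\sigma:V\to\{0,1\}$. Its weight is $w(\sigma)=\prod_{e\in\mathcal{E}}w(e,\sigma)\prod_{v\in V}w(v,\sigma)$, where $w(e,\sigma)=\beta$ if all vertices of $e$ receive the same value under $\sigma$ (all $0$ or all $1$) and $w(e,\sigma)=1$ otherwise, and $w(v,\sigma)=\lambda$ if $\sigma(v)=1$ and $1$ otherwise. The partition function is $Z(G)=\sum_{\sigma\in\{0,1\}^V}w(\sigma)$. An FPTAS is a deterministic algorithm that, given $G$ with $n$ vertices and $0<\varepsilon<1$, outputs $\hat Z$ with $e^{-\varepsilon}\le Z(G)/\hat Z\le e^{\varepsilon}$ in time polynomial in $n$ and $1/\varepsilon$. *)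

theory Defs
  imports Complex_Main "HOL-Library.FuncSet" "HOL-Library.Log_Nat"
begin

section \<open>Hypergraphs and the Ising partition function\<close>

type_synonym 'a hypergraph = "'a set \<times> 'a set set"

definition hypergraph :: "'a hypergraph \<Rightarrow> bool" where
  "hypergraph G \<longleftrightarrow> finite (fst G) \<and> snd G \<subseteq> Pow (fst G)"

definition vertex_degree :: "'a hypergraph \<Rightarrow> 'a \<Rightarrow> nat" where
  "vertex_degree G v = card {e \<in> snd G. v \<in> e}"

definition bounded_degree_hypergraphs :: "nat \<Rightarrow> 'a hypergraph set" where
  "bounded_degree_hypergraphs \<Delta> = {G. hypergraph G \<and> (\<forall>v\<in>fst G. vertex_degree G v \<le> \<Delta>)}"

definition configs :: "'a hypergraph \<Rightarrow> ('a \<Rightarrow> nat) set" where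
  "configs G = fst G \<rightarrow>\<^sub>E {0, 1}"

definition edge_weight :: "real \<Rightarrow> 'a set \<Rightarrow> ('a \<Rightarrow> nat) \<Rightarrow> real" where
  "edge_weight \<beta> e \<sigma> = (if (\<forall>v\<in>e. \<sigma> v = 0) \<or> (\<forall>v\<in>e. \<sigma> v = 1) then \<beta> else 1)"

definition vertex_weight :: "real \<Rightarrow> 'a \<Rightarrow> ('a \<Rightarrow> nat) \<Rightarrow> real" where
  "vertex_weight lam v \<sigma> = (if \<sigma> v = 1 then lam else 1)"

definition config_weight :: "real \<Rightarrow> real \<Rightarrow> 'a hypergraph \<Rightarrow> ('a \<Rightarrow> nat) \<Rightarrow> real" where
  "config_weight \<beta> lam G \<sigma> =
     (\<Prod>e\<in>snd G. edge_weight \<beta> e \<sigma>) * (\<Prod>v\<in>fst G. vertex_weight lam v \<sigma>)"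

definition partition_function :: "real \<Rightarrow> real \<Rightarrow> 'a hypergraph \<Rightarrow> real" where
  "partition_function \<beta> lam G = (\<Sum>\<sigma>\<in>configs G. config_weight \<beta> lam G \<sigma>)"


section \<open>A machine model with bit-cost time\<close>

text \<open>
  Algorithms are programs of a first-order call-by-value language whose data are rational numbers
  and pairs. Every step on numbers is charged the bit length of its operands (logarithmic cost
  criterion); pairs are references, so building or inspecting one takes unit time. Each primitive
  is computable by a Turing machine in time polynomial in its charge, and creates only linearly
  many new bits in terms of its charge. Hence polynomial time here is the usual polynomial time.

  Real numbers (the parameters of the problem and the accuracy) need not be rational or even
  computable, so a program sees them as in computable analysis: \<open>Approx i e\<close> with \<open>e\<close>
  evaluating to \<open>k\<close> asks for a dyadic number within \<open>2 ^ (- k)\<close> of the \<open>i\<close>-th real, for a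
  charge of \<open>k\<close>.
\<close>

datatype val = NumV rat | PairV val val

datatype binop = Plus | Minus | Times | Divide

fun apply_binop :: "binop \<Rightarrow> rat \<Rightarrow> rat \<Rightarrow> rat" where
  "apply_binop Plus p q = p + q"
| "apply_binop Minus p q = p - q"
| "apply_binop Times p q = p * q"
| "apply_binop Divide p q = p / q"

datatype expr =
    Var nat
  | Lit rat
  | Op binop expr expr
  | Floor expr
  | Approx nat expr
  | MkPair expr expr
  | Fst expr
  | Snd expr
  | LetIn expr expr
  | IfLess expr expr expr expr
  | IfPair expr expr expr
  | Call nat "expr list"

text \<open>
  A program is a list of function bodies. Variables are de Bruijn indices into the environment,
  which at a call consists of the arguments. Execution starts with the first body.
\<close>

type_synonym prog = "expr list"

definition rat_size :: "rat \<Rightarrow> nat" where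
  "rat_size q = (case quotient_of q of (a, b) \<Rightarrow> floorlog 2 (nat \<bar>a\<bar>) + floorlog 2 (nat b))"

text \<open>
  \<open>eval a P env e v t\<close>: with access to the approximations \<open>a\<close>, the expression \<open>e\<close>
  evaluates to \<open>v\<close> in time \<open>t\<close>. Ill-formed operations have no derivation, and neither do
  diverging computations.
\<close>

inductive eval :: "(nat \<Rightarrow> nat \<Rightarrow> int) \<Rightarrow> prog \<Rightarrow> val list \<Rightarrow> expr \<Rightarrow> val \<Rightarrow> nat \<Rightarrow> bool"
  and evals :: "(nat \<Rightarrow> nat \<Rightarrow> int) \<Rightarrow> prog \<Rightarrow> val list \<Rightarrow> expr list \<Rightarrow> val list \<Rightarrow> nat \<Rightarrow> bool"
  for a :: "nat \<Rightarrow> nat \<Rightarrow> int" and P :: prog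
where
  eval_Var: "i < length env \<Longrightarrow> eval a P env (Var i) (env ! i) 1"
| eval_Lit: "eval a P env (Lit q) (NumV q) (1 + rat_size q)"
| eval_Op: "eval a P env e1 (NumV p) t1 \<Longrightarrow> eval a P env e2 (NumV q) t2 \<Longrightarrow>
    eval a P env (Op f e1 e2) (NumV (apply_binop f p q)) (t1 + t2 + 1 + rat_size p + rat_size q)"
| eval_Floor: "eval a P env e (NumV q) t \<Longrightarrow>
    eval a P env (Floor e) (NumV (of_int \<lfloor>q\<rfloor>)) (t + 1 + rat_size q)"
| eval_Approx: "eval a P env e (NumV (of_nat k)) t \<Longrightarrow>
    eval a P env (Approx i e) (NumV (of_int (a i k) / 2 ^ k)) (t + 1 + k)"
| eval_MkPair: "eval a P env e1 v1 t1 \<Longrightarrow> eval a P env e2 v2 t2 \<Longrightarrow>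
    eval a P env (MkPair e1 e2) (PairV v1 v2) (t1 + t2 + 1)"
| eval_Fst: "eval a P env e (PairV v1 v2) t \<Longrightarrow> eval a P env (Fst e) v1 (t + 1)"
| eval_Snd: "eval a P env e (PairV v1 v2) t \<Longrightarrow> eval a P env (Snd e) v2 (t + 1)"
| eval_LetIn: "eval a P env e1 v1 t1 \<Longrightarrow> eval a P (v1 # env) e2 v2 t2 \<Longrightarrow>
    eval a P env (LetIn e1 e2) v2 (t1 + t2 + 1)"
| eval_IfLess: "eval a P env e1 (NumV p) t1 \<Longrightarrow> eval a P env e2 (NumV q) t2 \<Longrightarrow>
    eval a P env (if p < q then e3 else e4) v t3 \<Longrightarrow>
    eval a P env (IfLess e1 e2 e3 e4) v (t1 + t2 + t3 + 1 + rat_size p + rat_size q)"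
| eval_IfPair: "eval a P env e1 u t1 \<Longrightarrow>
    eval a P env (case u of PairV _ _ \<Rightarrow> e2 | NumV _ \<Rightarrow> e3) v t2 \<Longrightarrow>
    eval a P env (IfPair e1 e2 e3) v (t1 + t2 + 1)"
| eval_Call: "evals a P env es vs t1 \<Longrightarrow> i < length P \<Longrightarrow> eval a P vs (P ! i) v t2 \<Longrightarrow>
    eval a P env (Call i es) v (t1 + t2 + 1)"
| evals_Nil: "evals a P env [] [] 0"
| evals_Cons: "eval a P env e v t1 \<Longrightarrow> evals a P env es vs t2 \<Longrightarrow>
    evals a P env (e # es) (v # vs) (t1 + t2 + 1)"

inductive_cases eval_VarE: "eval a P env (Var i) v t"
inductive_cases eval_LitE: "eval a P env (Lit q) v t"
inductive_cases eval_OpE: "eval a P env (Op f e1 e2) v t"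
inductive_cases eval_FloorE: "eval a P env (Floor e) v t"
inductive_cases eval_ApproxE: "eval a P env (Approx i e) v t"
inductive_cases eval_MkPairE: "eval a P env (MkPair e1 e2) v t"
inductive_cases eval_FstE: "eval a P env (Fst e) v t"
inductive_cases eval_SndE: "eval a P env (Snd e) v t"
inductive_cases eval_LetInE: "eval a P env (LetIn e1 e2) v t"
inductive_cases eval_IfLessE: "eval a P env (IfLess e1 e2 e3 e4) v t"
inductive_cases eval_IfPairE: "eval a P env (IfPair e1 e2 e3) v t"
inductive_cases eval_CallE: "eval a P env (Call i es) v t"
inductive_cases evals_NilE: "evals a P env [] vs t"
inductive_cases evals_ConsE: "evals a P env (e # es) vs t"

lemma eval_deterministic:
  "eval a P env e v t \<Longrightarrow> eval a P env e v' t' \<Longrightarrow> v' = v \<and> t' = t"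
  "evals a P env es vs t \<Longrightarrow> evals a P env es vs' t' \<Longrightarrow> vs' = vs \<and> t' = t"
proof (induction arbitrary: v' t' and vs' t' rule: eval_evals.inducts)
  case eval_Var then show ?case by (auto elim: eval_VarE)
next
  case eval_Lit then show ?case by (auto elim: eval_LitE)
next
  case eval_Op from eval_Op.prems show ?case
    by (rule eval_OpE) (auto dest!: eval_Op.IH(2,4))
next
  case eval_Floor from eval_Floor.prems show ?case
    by (rule eval_FloorE) (auto dest!: eval_Floor.IH(2))
next
  case eval_Approx from eval_Approx.prems show ?case
    by (rule eval_ApproxE) (auto dest!: eval_Approx.IH(2))
next
  case eval_MkPair from eval_MkPair.prems show ?case
    by (rule eval_MkPairE) (auto dest!: eval_MkPair.IH(2,4))
next
  case eval_Fst from eval_Fst.prems show ?case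
    by (rule eval_FstE) (auto dest!: eval_Fst.IH(2))
next
  case eval_Snd from eval_Snd.prems show ?case
    by (rule eval_SndE) (auto dest!: eval_Snd.IH(2))
next
  case eval_LetIn from eval_LetIn.prems show ?case
    by (rule eval_LetInE) (auto dest!: eval_LetIn.IH(2,4))
next
  case eval_IfLess from eval_IfLess.prems show ?case
    by (rule eval_IfLessE) (auto dest!: eval_IfLess.IH(2,4,6))
next
  case eval_IfPair from eval_IfPair.prems show ?case
    by (rule eval_IfPairE) (auto dest!: eval_IfPair.IH(2,4))
next
  case eval_Call from eval_Call.prems show ?case
    by (rule eval_CallE) (auto dest!: eval_Call.IH(2,5))
next
  case evals_Nil then show ?case by (auto elim: evals_NilE)
next
  case evals_Cons from evals_Cons.prems show ?case
    by (rule evals_ConsE) (auto dest!: evals_Cons.IH(2,4))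
qed

definition runs :: "(nat \<Rightarrow> nat \<Rightarrow> int) \<Rightarrow> prog \<Rightarrow> val \<Rightarrow> val \<Rightarrow> nat \<Rightarrow> bool" where
  "runs a P x y t \<longleftrightarrow> eval a P [x] (Call 0 [Var 0]) y t"


section \<open>Fully polynomial-time approximation schemes\<close>

definition approximates :: "(nat \<Rightarrow> nat \<Rightarrow> int) \<Rightarrow> real list \<Rightarrow> bool" where
  "approximates a rs \<longleftrightarrow> (\<forall>i<length rs. \<forall>k. \<bar>of_int (a i k) / 2 ^ k - rs ! i\<bar> \<le> 1 / 2 ^ k)"

text \<open>
  \<open>P\<close> approximates \<open>Z\<close> on the instances \<open>I\<close>; \<open>enc G x\<close> says that \<open>x\<close> is a legal input
  describing \<open>G\<close>, and \<open>sz\<close> measures instances. The reals accessible to \<open>P\<close> are the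
  accuracy \<open>\<epsilon>\<close> (number 0) and the fixed parameters \<open>ps\<close> of the problem. As
  \<open>sz G + 1 / \<epsilon> \<ge> 1\<close>, a bound that is polynomial in \<open>sz G\<close> and \<open>1 / \<epsilon>\<close> is the same as one
  of the form \<open>C * (sz G + 1 / \<epsilon>) ^ d\<close>.
\<close>

definition is_FPTAS ::
    "prog \<Rightarrow> real list \<Rightarrow> 'i set \<Rightarrow> ('i \<Rightarrow> val \<Rightarrow> bool) \<Rightarrow> ('i \<Rightarrow> nat) \<Rightarrow> ('i \<Rightarrow> real) \<Rightarrow> bool" where
  "is_FPTAS P ps I enc sz Z \<longleftrightarrow>
     (\<exists>(C::real) (d::nat). \<forall>G\<in>I. \<forall>x. enc G x \<longrightarrow>
        (\<forall>\<epsilon>::real. 0 < \<epsilon> \<and> \<epsilon> < 1 \<longrightarrow>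
          (\<forall>a. approximates a (\<epsilon> # ps) \<longrightarrow>
            (\<exists>z t. runs a P x (NumV z) t \<and>
                   exp (- \<epsilon>) \<le> Z G / real_of_rat z \<and> Z G / real_of_rat z \<le> exp \<epsilon> \<and>
                   real t \<le> C * (real (sz G) + 1 / \<epsilon>) ^ d))))"


section \<open>Hypergraphs as inputs\<close>

fun list_val :: "val list \<Rightarrow> val" where
  "list_val [] = NumV 0"
| "list_val (v # vs) = PairV v (list_val vs)"

definition nat_val :: "nat \<Rightarrow> val" where
  "nat_val n = NumV (of_nat n)"

text \<open>
  The input consists of the number \<open>n\<close> of vertices and a list of the hyperedges, each of which is
  a list of vertex numbers below \<open>n\<close>. The numbering \<open>vs\<close> of the vertices, the order of the
  hyperedges and the order within each hyperedge are arbitrary, but nothing is listed twice.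
\<close>

definition encodes_hypergraph :: "'a hypergraph \<Rightarrow> val \<Rightarrow> bool" where
  "encodes_hypergraph G x \<longleftrightarrow>
     (\<exists>vs es. distinct vs \<and> set vs = fst G \<and>
        (\<forall>e\<in>set es. distinct e \<and> set e \<subseteq> {..<length vs}) \<and>
        distinct (map set es) \<and>
        snd G = (\<lambda>e. (!) vs ` set e) ` set es \<and>
        x = PairV (nat_val (length vs)) (list_val (map (\<lambda>e. list_val (map nat_val e)) es)))"

definition num_vertices :: "'a hypergraph \<Rightarrow> nat" where
  "num_vertices G = card (fst G)"

lemma hypergraph_has_encoding:
  assumes "hypergraph G"
  shows "\<exists>x. encodes_hypergraph G x"
proof -
  have fin: "finite (fst G)" and sub: "snd G \<subseteq> Pow (fst G)"
    using assms by (auto simp: hypergraph_def)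
  obtain vs where vs: "set vs = fst G" "distinct vs"
    using finite_distinct_list[OF fin] by blast
  obtain Es where Es: "set Es = snd G" "distinct Es"
    using finite_distinct_list[of "snd G"] finite_subset[OF sub] fin by auto
  define ix where "ix A = filter (\<lambda>i. vs ! i \<in> A) [0..<length vs]" for A
  have im: "(!) vs ` set (ix A) = A" if "A \<in> snd G" for A
  proof -
    have "A \<subseteq> set vs" using that sub vs by blast
    then show ?thesis unfolding ix_def by (force simp: in_set_conv_nth)
  qed
  have "inj_on (set \<circ> ix) (set Es)"
    by (rule inj_on_inverseI[where g = "\<lambda>A. (!) vs ` A"]) (simp add: im Es)
  then have d: "distinct (map set (map ix Es))"
    using Es by (simp add: distinct_map)
  have e: "snd G = (\<lambda>e. (!) vs ` set e) ` set (map ix Es)"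
    using Es im by (force simp: image_image)
  have w: "\<forall>e\<in>set (map ix Es). distinct e \<and> set e \<subseteq> {..<length vs}"
    by (auto simp: ix_def)
  show ?thesis
    unfolding encodes_hypergraph_def
    by (rule exI, rule exI[of _ vs], rule exI[of _ "map ix Es"]) (use vs d e w in simp)
qed

end

theory Submission
  imports Defs
begin

text \<open>
  The odds of a vertex being 1 satisfy a recursion over its hyperedges: detaching \<open>v\<close> from its
  edges one after the other (earlier edges see \<open>v = 0\<close>, later ones \<open>v = 1\<close>) contributes for each
  edge a factor \<open>(1 - b p) / (1 - b q)\<close>, where \<open>b = 1 - \<beta>\<close> and \<open>p\<close>, \<open>q\<close> are the
  probabilities that the remaining vertices of the edge are all 1, respectively all 0, in one and
  the same smaller graph. Both probabilities are products of conditional marginals along the edge.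

  On the log-odds the recursion is a contraction in the supremum norm. Since the first marginal of
  both products belongs to the same vertex of the same graph, the derivative contributed by one edge
  is at most \<open>b / (1 - b)\<close> times \<open>x e\<^sup>-\<^sup>x + (1 - x) e\<^sup>-\<^sup>(\<^sup>1\<^sup>-\<^sup>x\<^sup>) \<le> e\<^sup>-\<^sup>1\<^sup>/\<^sup>2\<close>, which the
  hypothesis on \<open>\<beta>\<close> makes smaller than \<open>1 / \<Delta>\<close>. An edge with \<open>k\<close> further vertices contributes
  also at most \<open>2 k q\<^sup>k\<close> for some \<open>q < 1\<close>. Therefore the recursion may lower its depth budget by \<open>k\<close>
  at such an edge and still lose only a factor \<open>\<rho>\<^sup>k\<close> in the error, while the call tree has
  size exponential in the budget, no matter how large the edges are. A budget logarithmic in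
  \<open>n / \<epsilon>\<close> gives the FPTAS, and no rounding is necessary: the bit length of all intermediate
  rationals is bounded by the size of the call tree.
\<close>

section \<open>Contraction of the log-odds\<close>

text \<open>The condition on \<beta> says
  \<open>b / (1 - b) \<le> 1 / (exp (- 1 / 2) * \<Delta> + 1 / 2)\<close>, so the contraction
  inequality holds with room to spare. The room is needed: \<beta> and \<open>lam\<close> are reals
  seen only through dyadic approximations, the recursion runs on nearby rationals, and the
  approximate \<open>b\<close> may exceed \<open>1 - \<beta>\<close>. All constants are therefore
  chosen for a slightly larger \<open>b1\<close>, uniformly over the approximations. The obstacle is
  that edges have unbounded size. The derivative of a product of \<open>k\<close> marginals
  \<open>p\<close> is governed by their product times the sum \<open>S\<close> of the
  \<open>1 - p\<close>. Bounding \<open>S\<close> by \<open>exp (S - 1)\<close> eliminates every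
  marginal but the first and leaves \<open>p e^(-p)\<close>. Bounding the all-ones and the all-zeros
  product separately would give \<open>2 / e\<close>, which is larger than \<open>e^(-1/2)\<close>;
  the improvement comes from the two first marginals being \<open>x\<close> and
  \<open>1 - x\<close>.\<close>

definition logistic :: "real \<Rightarrow> real" where
  "logistic x = 1 / (1 + exp (- x))"

lemma logistic_pos: "0 < logistic x" and logistic_less_1: "logistic x < 1"
  by (auto simp: logistic_def add_pos_pos)

lemma logistic_mono: "x \<le> y \<Longrightarrow> logistic x \<le> logistic y"
  by (auto simp: logistic_def intro!: divide_left_mono mult_pos_pos add_pos_pos)

lemma logistic_minus: "logistic (- x) = 1 - logistic x"
proof -
  have "1 + exp x > 0" "1 + exp (-x) > 0" by (simp_all add: add_pos_pos)
  then show ?thesis by (simp add: logistic_def field_simps exp_minus)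
qed

lemma logistic_ln: "0 < r \<Longrightarrow> logistic (ln r) = r / (1 + r)"
  by (simp add: logistic_def exp_minus field_simps)

lemma logistic_minus_ln: "0 < r \<Longrightarrow> logistic (- ln r) = 1 / (1 + r)"
  by (simp add: logistic_def)

lemma DERIV_logistic: "(logistic has_real_derivative logistic x * (1 - logistic x)) (at x)"
proof -
  have "1 + exp (-x) > 0" by (simp add: add_pos_pos)
  then show ?thesis unfolding logistic_def
    by (auto intro!: derivative_eq_intros simp: field_simps power2_eq_square)
qed

text \<open>The logarithmic derivative of \<open>logistic\<close> is \<open>1 - logistic\<close>, so
  the product rule collapses to the product times one weighted sum.\<close>

lemma DERIV_prod_logistic:
  fixes X :: "nat \<Rightarrow> real \<Rightarrow> real"
  assumes "\<And>j. j < k \<Longrightarrow> (X j has_real_derivative d j) (at t)"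
  shows "((\<lambda>t. \<Prod>j<k. logistic (X j t)) has_real_derivative
           (\<Prod>j<k. logistic (X j t)) * (\<Sum>j<k. (1 - logistic (X j t)) * d j)) (at t)"
  using assms
proof (induct k)
  case (Suc k)
  have "((\<lambda>t. logistic (X k t)) has_real_derivative (logistic (X k t) * (1 - logistic (X k t))) * d k) (at t)"
    using DERIV_chain2[OF DERIV_logistic Suc.prems[of k]] by simp
  from DERIV_mult[OF Suc.hyps this] Suc.prems show ?case
    by (simp add: algebra_simps)
qed simp

text \<open>All factors but the first are relaxed by \<open>p \<le> exp (p - 1)\<close>; the first
  stays exact because it is the marginal that both products of an edge share.\<close>

lemma prod_le_exp:
  fixes p :: "nat \<Rightarrow> real"
  assumes "\<And>j. j < Suc k \<Longrightarrow> 0 < p j"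
  shows "(\<Prod>j<Suc k. p j) \<le> p 0 * exp (1 - p 0 - (\<Sum>j<Suc k. 1 - p j))"
  using assms
proof (induction k)
  case (Suc k)
  let ?S = "\<Sum>j<Suc k. 1 - p j"
  have "p (Suc k) \<le> exp (p (Suc k) - 1)"
    using exp_ge_add_one_self[of "p (Suc k) - 1"] by simp
  moreover have "(\<Prod>j<Suc k. p j) \<le> p 0 * exp (1 - p 0 - ?S)"
    by (rule Suc.IH) (simp add: Suc.prems)
  ultimately have "(\<Prod>j<Suc k. p j) * p (Suc k) \<le> (p 0 * exp (1 - p 0 - ?S)) * exp (p (Suc k) - 1)"
    using Suc.prems by (intro mult_mono) (auto intro!: prod_nonneg simp: less_imp_le)
  also have "\<dots> = p 0 * exp (1 - p 0 - (?S + (1 - p (Suc k))))"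
    by (simp add: mult.assoc exp_add[symmetric])
  finally show ?case
    by (simp only: prod.lessThan_Suc[of _ "Suc k"] sum.lessThan_Suc[of _ "Suc k"])
qed simp

text \<open>With \<open>?S\<close> the sum, \<open>?S \<le> exp (?S - 1)\<close> cancels the
  \<open>exp (1 - ?S)\<close> of the previous bound. What remains depends neither on
  \<open>k\<close> nor on the later marginals, so the edge size drops out.\<close>

lemma prod_times_sum_le:
  fixes p :: "nat \<Rightarrow> real"
  assumes "0 < k" "\<And>j. j < k \<Longrightarrow> 0 < p j" "\<And>j. j < k \<Longrightarrow> p j < 1"
  shows "(\<Prod>j<k. p j) * (\<Sum>j<k. 1 - p j) \<le> p 0 * exp (- p 0)"
proof -
  let ?S = "\<Sum>j<k. 1 - p j"
  obtain k' where k: "k = Suc k'" using assms(1) by (cases k) auto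
  have "?S \<ge> 0" using assms by (intro sum_nonneg) (auto simp: less_imp_le)
  have "(\<Prod>j<k. p j) * ?S \<le> (p 0 * exp (1 - p 0 - ?S)) * ?S"
    using prod_le_exp[of k' p] assms \<open>?S \<ge> 0\<close> unfolding k by (intro mult_right_mono) auto
  also have "?S \<le> exp (?S - 1)" using exp_ge_add_one_self[of "?S - 1"] by simp
  then have "(p 0 * exp (1 - p 0 - ?S)) * ?S \<le> (p 0 * exp (1 - p 0 - ?S)) * exp (?S - 1)"
    using assms by (intro mult_left_mono) (auto simp: less_imp_le)
  also have "\<dots> = p 0 * exp (- p 0)" by (simp add: mult.assoc exp_add[symmetric])
  finally show ?thesis .
qed

text \<open>
  The right-hand sides at \<open>p\<close> and at \<open>1 - p\<close> sum up to \<open>exp (- 1 / 2)\<close>.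
\<close>

lemma mult_exp_neg_le_tangent:
  fixes p :: real
  assumes "0 \<le> p"
  shows "p * exp (- p) \<le> exp (- 1 / 2) * (p / 2 + 1 / 4)"
proof -
  let ?y = "p - 1 / 2"
  \<comment> \<open>The right-hand side of the lemma is the tangent of \<open>p * exp (- p)\<close>
    at \<open>1 / 2\<close>, and \<open>?y\<close> is the distance from that point;
    \<open>2 * p\<close> is \<open>1 + 2 * ?y\<close>.\<close>
  have "1 + 2 * ?y \<le> (1 + ?y) * (1 + ?y)"
    using zero_le_square[of ?y] by (simp add: algebra_simps)
  also have "\<dots> \<le> (1 + ?y) * exp ?y"
    using assms exp_ge_add_one_self[of ?y] by (intro mult_left_mono) auto
  finally have "2 * p * exp (- p) \<le> (p + 1 / 2) * exp ?y * exp (- p)"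
    by (simp add: add.commute)
  also have "\<dots> = (p + 1 / 2) * exp (- 1 / 2)"
    by (simp add: mult.assoc exp_add[symmetric])
  finally show ?thesis by (simp add: algebra_simps)
qed

text \<open>The later marginals are conditioned on different values and unrelated in the two
  products. The only coupling is \<open>p 0 + r 0 = 1\<close>, and it suffices because the tangent
  bounds are linear.\<close>

lemma two_prods_le:
  fixes p r :: "nat \<Rightarrow> real"
  assumes "0 < k" "\<And>j. j < k \<Longrightarrow> 0 < p j \<and> p j < 1" "\<And>j. j < k \<Longrightarrow> 0 < r j \<and> r j < 1"
    and "p 0 + r 0 = 1"
  shows "(\<Prod>j<k. p j) * (\<Sum>j<k. 1 - p j) + (\<Prod>j<k. r j) * (\<Sum>j<k. 1 - r j) \<le> exp (- 1 / 2)"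
proof -
  have "(\<Prod>j<k. p j) * (\<Sum>j<k. 1 - p j) \<le> exp (- 1 / 2) * (p 0 / 2 + 1 / 4)"
    using prod_times_sum_le[of k p] mult_exp_neg_le_tangent[of "p 0"] assms by force
  moreover have "(\<Prod>j<k. r j) * (\<Sum>j<k. 1 - r j) \<le> exp (- 1 / 2) * (r 0 / 2 + 1 / 4)"
    using prod_times_sum_le[of k r] mult_exp_neg_le_tangent[of "r 0"] assms by force
  moreover have "exp (- 1 / 2) * (p 0 / 2 + 1 / 4) + exp (- 1 / 2) * (r 0 / 2 + 1 / 4) = exp (- 1 / 2)"
  proof -
    have r: "r 0 = 1 - p 0" using assms by linarith
    show ?thesis unfolding r by (simp add: field_simps)
  qed
  ultimately show ?thesis by linarith
qed

text \<open>Crude, but unlike the uniform bound \<open>two_prods_le\<close> it decays with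
  \<open>k\<close>; this is what pays for long edges.\<close>

lemma prod_times_sum_le_power:
  fixes p :: "nat \<Rightarrow> real"
  assumes "\<And>j. j < k \<Longrightarrow> 0 < p j \<and> p j \<le> q" "q < 1"
  shows "(\<Prod>j<k. p j) * (\<Sum>j<k. 1 - p j) \<le> real k * q ^ k"
proof -
  have "(\<Prod>j<k. p j) \<le> (\<Prod>j<k. q)" by (intro prod_mono) (use assms in force)
  moreover have "(\<Sum>j<k. 1 - p j) \<le> (\<Sum>j<k. 1)" by (intro sum_mono) (use assms in force)
  moreover have "0 \<le> (\<Sum>j<k. 1 - p j)" by (intro sum_nonneg) (use assms in force)
  moreover have "0 \<le> (\<Prod>j<k. q)" by (intro prod_nonneg) (use assms in force)
  ultimately have "(\<Prod>j<k. p j) * (\<Sum>j<k. 1 - p j) \<le> (\<Prod>j<k. q) * (\<Sum>j<k. 1)"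
    by (intro mult_mono) auto
  then show ?thesis by (simp add: mult.commute)
qed

text \<open>
  \<open>x\<close> and \<open>z\<close> are the log-odds of the marginals along an edge, conditioned on ones and on zeros;
  the index 0 is the vertex that the two products share.
\<close>

lemma log_factor_lipschitz:
  fixes x x' z z' :: "nat \<Rightarrow> real"
  assumes b: "0 \<le> b0" "b0 \<le> b" "0 \<le> b1" "b1 \<le> b" "b < 1"
    and d: "\<And>j. j < k \<Longrightarrow> \<bar>x' j - x j\<bar> \<le> d" "\<And>j. j < k \<Longrightarrow> \<bar>z' j - z j\<bar> \<le> d" "0 \<le> d"
    and B: "\<And>j. j < k \<Longrightarrow> \<bar>x j\<bar> \<le> B \<and> \<bar>x' j\<bar> \<le> B \<and> \<bar>z j\<bar> \<le> B \<and> \<bar>z' j\<bar> \<le> B"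
    and shared: "x 0 = z 0" "x' 0 = z' 0"
  shows "\<exists>g. 0 \<le> g \<and> g \<le> exp (- 1 / 2) \<and> g \<le> 2 * real k * logistic B ^ k \<and>
      \<bar>(ln (1 - b1 * (\<Prod>j<k. logistic (x' j))) - ln (1 - b0 * (\<Prod>j<k. logistic (- z' j))))
       - (ln (1 - b1 * (\<Prod>j<k. logistic (x j))) - ln (1 - b0 * (\<Prod>j<k. logistic (- z j))))\<bar>
      \<le> b / (1 - b) * g * d"
proof -
  \<comment> \<open>Linear interpolation between the two sequences of log-odds. The sign in
    \<open>Z\<close> makes \<open>r\<close> the probability of all zeros.\<close>
  define X Z where "X j t = x j + t * (x' j - x j)" and "Z j t = - (z j + t * (z' j - z j))" for j and t :: real
  define p r where "p t = (\<Prod>j<k. logistic (X j t))" and "r t = (\<Prod>j<k. logistic (Z j t))" for t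
  define dp dr where "dp t = p t * (\<Sum>j<k. (1 - logistic (X j t)) * (x' j - x j))"
    and "dr t = r t * (\<Sum>j<k. (1 - logistic (Z j t)) * (- (z' j - z j)))" for t
  have p: "(p has_real_derivative dp t) (at t)" for t
    unfolding p_def dp_def X_def
    by (rule DERIV_prod_logistic) (auto intro!: derivative_eq_intros)
  have r: "(r has_real_derivative dr t) (at t)" for t
    unfolding r_def dr_def Z_def
    by (rule DERIV_prod_logistic) (auto intro!: derivative_eq_intros)
  have p01: "0 \<le> p t" "p t \<le> 1" and r01: "0 \<le> r t" "r t \<le> 1" for t
    unfolding p_def r_def using logistic_pos logistic_less_1
    by (auto intro!: prod_nonneg prod_le_1 simp: less_imp_le)
  have den: "c * y \<le> b" if "0 \<le> c" "c \<le> b" "0 \<le> y" "y \<le> 1" for c y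
    using mult_mono[of c b y 1] that b by simp
  have ip: "1 - b \<le> 1 - b1 * p t" and ir: "1 - b \<le> 1 - b0 * r t" for t
    using den[of b1 "p t"] den[of b0 "r t"] b p01 r01 by auto
  define f f' where "f t = ln (1 - b1 * p t) - ln (1 - b0 * r t)"
    and "f' t = - (b1 * dp t) / (1 - b1 * p t) + (b0 * dr t) / (1 - b0 * r t)" for t
  have "(f has_real_derivative f' t) (at t)" for t
  proof -
    have "0 < 1 - b1 * p t" "0 < 1 - b0 * r t" using ip[of t] ir[of t] b by linarith+
    then show ?thesis unfolding f_def f'_def
      by (auto intro!: derivative_eq_intros p r simp: field_simps)
  qed
  then obtain t where t: "0 < t" "t < 1" "f 1 - f 0 = f' t"
    using MVT2[of 0 1 f f'] by auto
  let ?P = "p t * (\<Sum>j<k. 1 - logistic (X j t))" and ?R = "r t * (\<Sum>j<k. 1 - logistic (Z j t))"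
  have conv: "\<bar>u + t * (u' - u)\<bar> \<le> B" if "\<bar>u\<bar> \<le> B" "\<bar>u'\<bar> \<le> B" for u u' :: real
  proof -
    have "u + t * (u' - u) = (1 - t) * u + t * u'" by (simp add: algebra_simps)
    also have "\<bar>\<dots>\<bar> \<le> (1 - t) * \<bar>u\<bar> + t * \<bar>u'\<bar>"
      using abs_triangle_ineq[of "(1-t)*u" "t*u'"] t by (simp add: abs_mult)
    also have "\<dots> \<le> (1 - t) * B + t * B"
      using that t by (intro add_mono mult_left_mono) auto
    finally show ?thesis by (simp add: algebra_simps)
  qed
  have sB: "logistic (X j t) \<le> logistic B" "logistic (Z j t) \<le> logistic B" if "j < k" for j
    using conv[of "x j" "x' j"] conv[of "z j" "z' j"] B[OF that]
    by (auto intro!: logistic_mono simp: X_def Z_def)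
  have dp_le: "\<bar>dp t\<bar> \<le> ?P * d"
  proof -
    have "\<bar>\<Sum>j<k. (1 - logistic (X j t)) * (x' j - x j)\<bar> \<le> (\<Sum>j<k. (1 - logistic (X j t)) * d)"
      by (rule order_trans[OF sum_abs sum_mono])
         (use d logistic_less_1 in \<open>auto simp: abs_mult less_imp_le intro!: mult_mono\<close>)
    then show ?thesis using p01[of t]
      by (simp add: dp_def abs_mult mult.assoc sum_distrib_right mult_left_mono)
  qed
  have dr_le: "\<bar>dr t\<bar> \<le> ?R * d"
  proof -
    have "\<bar>\<Sum>j<k. (1 - logistic (Z j t)) * (- (z' j - z j))\<bar> \<le> (\<Sum>j<k. (1 - logistic (Z j t)) * d)"
      by (rule order_trans[OF sum_abs sum_mono])
         (use d logistic_less_1 in \<open>auto simp: abs_mult less_imp_le abs_minus_commute intro!: mult_mono\<close>)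
    then show ?thesis using r01[of t]
      by (simp add: dr_def abs_mult mult.assoc sum_distrib_right mult_left_mono)
  qed
  have P0: "0 \<le> ?P" "0 \<le> ?R"
    using p01 r01 logistic_less_1 by (auto intro!: mult_nonneg_nonneg sum_nonneg simp: less_imp_le)
  have frac: "\<bar>c * y / w\<bar> \<le> b / (1 - b) * (g * d)"
    if "0 \<le> c" "c \<le> b" "\<bar>y\<bar> \<le> g * d" "1 - b \<le> w" "0 \<le> g" for c y w g
  proof -
    have "\<bar>c * y\<bar> / w \<le> b * (g * d) / (1 - b)"
      using that b d(3) unfolding abs_mult by (intro frac_le mult_mono) auto
    then show ?thesis using that b by (simp add: abs_mult)
  qed
  have "\<bar>f' t\<bar> \<le> b / (1 - b) * (?P * d) + b / (1 - b) * (?R * d)"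
  proof -
    have "\<bar>f' t\<bar> \<le> \<bar>b1 * dp t / (1 - b1 * p t)\<bar> + \<bar>b0 * dr t / (1 - b0 * r t)\<bar>"
      using abs_triangle_ineq[of "- (b1 * dp t / (1 - b1 * p t))" "b0 * dr t / (1 - b0 * r t)"]
      unfolding f'_def by (simp only: minus_divide_left[symmetric] abs_minus_cancel)
    also have "\<dots> \<le> b / (1 - b) * (?P * d) + b / (1 - b) * (?R * d)"
      using b dp_le dr_le ip ir P0 by (intro add_mono frac) auto
    finally show ?thesis .
  qed
  then have "\<bar>f 1 - f 0\<bar> \<le> b / (1 - b) * (?P + ?R) * d"
    using t by (simp add: algebra_simps)
  moreover have "?P + ?R \<le> exp (- 1 / 2)"
  proof (cases "k = 0")
    case False
    \<comment> \<open>Index 0 is shared, so \<open>X 0\<close> and \<open>Z 0\<close> are opposite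
      along the whole segment.\<close>
    have "logistic (X 0 t) + logistic (Z 0 t) = 1"
      using shared by (simp add: X_def Z_def logistic_minus del: minus_add_distrib)
    then show ?thesis
      unfolding p_def r_def using False logistic_pos logistic_less_1 by (intro two_prods_le) auto
  qed simp
  moreover have "?P + ?R \<le> 2 * real k * logistic B ^ k"
  proof -
    have "?P \<le> real k * logistic B ^ k" "?R \<le> real k * logistic B ^ k"
      unfolding p_def r_def using logistic_pos sB logistic_less_1 by (auto intro!: prod_times_sum_le_power)
    then show ?thesis by simp
  qed
  moreover have "f 1 = ln (1 - b1 * (\<Prod>j<k. logistic (x' j))) - ln (1 - b0 * (\<Prod>j<k. logistic (- z' j)))"
    "f 0 = ln (1 - b1 * (\<Prod>j<k. logistic (x j))) - ln (1 - b0 * (\<Prod>j<k. logistic (- z j)))"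
    by (simp_all add: f_def p_def r_def X_def Z_def)
  ultimately show ?thesis using P0 by (intro exI[of _ "?P + ?R"]) auto
qed

text \<open>Two regimes. For large \<open>k\<close>, half of the decay, \<open>sqrt q ^ k\<close>,
  absorbs the factor \<open>k\<close>. For the finitely many smaller \<open>k\<close>, the constant
  \<open>C * exp (- 1 / 2) < 1\<close> is spread over \<open>K\<close> steps.\<close>

lemma exists_decay_rate:
  fixes C q :: real
  assumes "0 \<le> C" "C * exp (- 1 / 2) < 1" "0 < q" "q < 1"
  shows "\<exists>\<rho>. 0 < \<rho> \<and> \<rho> < 1 \<and> q \<le> \<rho> \<and>
    (\<forall>k g. g \<le> exp (- 1 / 2) \<longrightarrow> g \<le> 2 * real k * q ^ k \<longrightarrow> C * g \<le> \<rho> ^ k)"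
proof -
  let ?s = "sqrt q"
  have s: "0 < ?s" "?s < 1" using assms by auto
  have "(\<lambda>k. 2 * C * (real k * ?s ^ k)) \<longlonglongrightarrow> 2 * C * 0"
    using s by (intro tendsto_mult_left powser_times_n_limit_0) auto
  then have "eventually (\<lambda>k. 2 * C * (real k * ?s ^ k) < 1) sequentially"
    by (rule order_tendstoD) simp
  then obtain K0 where K0: "\<And>k. K0 \<le> k \<Longrightarrow> 2 * C * (real k * ?s ^ k) < 1"
    by (auto simp: eventually_sequentially)
  define K where "K = Suc K0"
  define \<kappa> where "\<kappa> = C * exp (- 1 / 2)"
  have \<kappa>: "0 \<le> \<kappa>" "\<kappa> < 1" using assms by (auto simp: \<kappa>_def)
  \<comment> \<open>A substitute for the \<open>K\<close>-th root of \<open>\<kappa>\<close>: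
    Bernoulli's inequality yields \<open>\<kappa> \<le> r ^ K\<close>.\<close>
  define r where "r = 1 - (1 - \<kappa>) / real K"
  have K1: "1 \<le> real K" by (simp add: K_def)
  have r: "0 \<le> r" "r < 1" using \<kappa> K1 by (auto simp: r_def field_simps)
  have "1 + real K * (- ((1 - \<kappa>) / real K)) \<le> (1 + - ((1 - \<kappa>) / real K)) ^ K"
    using \<kappa> K1 by (intro Bernoulli_inequality) (auto simp: field_simps)
  then have rK: "\<kappa> \<le> r ^ K" using K1 by (simp add: r_def)
  define \<rho> where "\<rho> = max ?s r"
  have \<rho>: "0 < \<rho>" "\<rho> < 1" "?s \<le> \<rho>" "r \<le> \<rho>" using s r by (auto simp: \<rho>_def less_max_iff_disj simp del: real_sqrt_gt_0_iff)
  have "q \<le> ?s" using assms s by (metis less_imp_le mult_left_le real_sqrt_mult_self abs_of_pos)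
  have "C * g \<le> \<rho> ^ k" if g: "g \<le> exp (- 1 / 2)" "g \<le> 2 * real k * q ^ k" for k g
  proof (cases "K \<le> k")
    case True
    have "C * g \<le> C * (2 * real k * q ^ k)" using g assms by (intro mult_left_mono) auto
    also have "q ^ k = ?s ^ k * ?s ^ k" using assms by (simp flip: power_mult_distrib)
    then have "C * (2 * real k * q ^ k) = (2 * C * (real k * ?s ^ k)) * ?s ^ k" by simp
    also have "\<dots> \<le> 1 * ?s ^ k" using K0[of k] True s
      by (intro mult_right_mono) (auto simp: K_def)
    also have "\<dots> \<le> \<rho> ^ k" using \<rho> s by (simp add: power_mono)
    finally show ?thesis .
  next
    case False
    have "C * g \<le> \<kappa>" using g assms by (auto simp: \<kappa>_def intro!: mult_left_mono)
    also have "\<dots> \<le> r ^ K" by fact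
    also have "\<dots> \<le> \<rho> ^ K" using \<rho> r by (simp add: power_mono)
    also have "\<dots> \<le> \<rho> ^ k" using \<rho> False by (intro power_decreasing) auto
    finally show ?thesis .
  qed
  then show ?thesis using \<rho> \<open>q \<le> ?s\<close> by (intro exI[of _ \<rho>]) auto
qed

section \<open>The odds recursion\<close>

text \<open>
  An edge \<open>(f0, f1, us)\<close> all of whose pinned vertices have been removed. The flags tell whether it
  can still become monochromatic with value 0, respectively 1.
\<close>

type_synonym edge = "bool \<times> bool \<times> nat list"

definition pin1 :: "nat \<Rightarrow> bool \<Rightarrow> edge \<Rightarrow> edge" where
  "pin1 v c e = (case e of (f0, f1, us) \<Rightarrow>
     if v \<in> set us then (f0 \<and> \<not> c, f1 \<and> c, removeAll v us) else e)"

fun pin :: "nat \<Rightarrow> bool \<Rightarrow> edge list \<Rightarrow> edge list \<Rightarrow> edge list" where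
  "pin v c [] acc = acc"
| "pin v c (e # es) acc = pin v c es (pin1 v c e # acc)"

text \<open>
  \<open>ratio b lam v L dn todo\<close> is the approximation, with budget \<open>L\<close>, of the odds of \<open>v\<close> when \<open>v\<close>
  has already been detached from the edges \<open>dn\<close> but not from \<open>todo\<close>; \<open>fac\<close> is the factor of one
  edge and \<open>allp\<close> the probability that all of \<open>us\<close> get the value \<open>c\<close>.
\<close>

function (sequential) ratio ::
    "'a::linordered_field \<Rightarrow> 'a \<Rightarrow> nat \<Rightarrow> nat \<Rightarrow> edge list \<Rightarrow> edge list \<Rightarrow> 'a"
  and fac :: "'a \<Rightarrow> 'a \<Rightarrow> nat \<Rightarrow> bool \<Rightarrow> bool \<Rightarrow> nat list \<Rightarrow> edge list \<Rightarrow> 'a"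
  and allp :: "'a \<Rightarrow> 'a \<Rightarrow> bool \<Rightarrow> nat list \<Rightarrow> nat \<Rightarrow> edge list \<Rightarrow> 'a" where
  "ratio b lam v L dn [] = lam"
| "ratio b lam v L dn ((f0, f1, us) # es) =
    (if v \<in> set us
     then fac b lam L f0 f1 (removeAll v us) (pin v True es dn)
          * ratio b lam v L ((f0, False, removeAll v us) # dn) es
     else ratio b lam v L ((f0, f1, us) # dn) es)"
| "fac b lam L f0 f1 us g =
    (if L < length us then 1
     else (1 - b * of_bool f1 * allp b lam True us (L - length us) g)
        / (1 - b * of_bool f0 * allp b lam False us (L - length us) g))"
| "allp b lam c [] L g = 1"
| "allp b lam c (u # us) L g =
    (if c then ratio b lam u L [] g else 1) / (1 + ratio b lam u L [] g)
    * allp b lam c us L (pin u c g [])"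
  by pat_completeness auto
termination
  by (relation "inv_image (less_than <*lex*> less_than)
        (\<lambda>x. case x of Inl (b, lam, v, L, dn, todo) \<Rightarrow> (L, length todo + 2)
          | Inr (Inl (b, lam, L, f0, f1, us, g)) \<Rightarrow> (L, 1)
          | Inr (Inr (b, lam, c, us, L, g)) \<Rightarrow> (L + length us, 0))") auto

declare ratio.simps [simp del] fac.simps [simp del] allp.simps [simp del]

text \<open>The program computes on rationals while the analysis is over the reals. The control flow
  compares only budgets and list lengths, never field elements, so the recursion commutes with the
  embedding.\<close>

lemma of_rat_ratio:
  "real_of_rat (ratio b lam v L dn todo) = ratio (of_rat b) (of_rat lam) v L dn todo"
  "real_of_rat (fac b lam L f0 f1 us g) = fac (of_rat b) (of_rat lam) L f0 f1 us g"
  "real_of_rat (allp b lam c us L g) = allp (of_rat b) (of_rat lam) c us L g"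
proof (induction b lam v L dn todo and b lam L f0 f1 us g and b lam c us L g rule: ratio_fac_allp.induct)
  case (1 b lam v L dn)
  show ?case by (simp only: ratio.simps)
next
  case (2 b lam v L dn f0 f1 us es)
  then show ?case by (simp add: ratio.simps(2) of_rat_mult)
next
  case (3 b lam L f0 f1 us g)
  have "real_of_rat (of_bool f) = of_bool f" for f by (cases f) simp_all
  with 3 show ?case
    by (simp add: fac.simps[of _ _ L f0 f1 us g] of_rat_mult of_rat_divide of_rat_diff)
next
  case (4 b lam c L g)
  show ?case by (simp add: allp.simps)
next
  case (5 b lam c u us L g)
  then show ?case by (simp add: allp.simps(2) of_rat_mult of_rat_divide of_rat_add)
qed

section \<open>Exact weights, odds and edge factors of pinned edge lists\<close>

definition edge_factor :: "real \<Rightarrow> edge \<Rightarrow> nat set \<Rightarrow> real" where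
  "edge_factor b e S = (case e of (f0, f1, us) \<Rightarrow>
     if f0 \<and> set us \<inter> S = {} \<or> f1 \<and> set us \<subseteq> S then 1 - b else 1)"

definition edges_weight :: "real \<Rightarrow> edge list \<Rightarrow> nat set \<Rightarrow> real" where
  "edges_weight b g S = prod_list (map (\<lambda>e. edge_factor b e S) g)"

definition upd :: "bool \<Rightarrow> nat \<Rightarrow> nat set \<Rightarrow> nat set" where
  "upd c v S = (if c then insert v S else S - {v})"

text \<open>
  Configurations are represented by the set \<open>S\<close> of vertices with value 1. The vertex set stays \<open>V\<close>
  under pinning, so a pinned vertex contributes a spurious factor \<open>1 + lam\<close>.
\<close>

definition Zc :: "real \<Rightarrow> real \<Rightarrow> nat set \<Rightarrow> bool \<Rightarrow> nat list \<Rightarrow> edge list \<Rightarrow> real" where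
  "Zc b lam V c us g =
     (\<Sum>S\<in>Pow V. if \<forall>u\<in>set us. (u \<in> S) = c then lam ^ card S * edges_weight b g S else 0)"

abbreviation Zg :: "real \<Rightarrow> real \<Rightarrow> nat set \<Rightarrow> edge list \<Rightarrow> real" where
  "Zg b lam V g \<equiv> Zc b lam V True [] g"

lemma Zc_Nil: "Zc b lam V c [] g = Zg b lam V g"
  by (simp add: Zc_def)

definition true_ratio :: "real \<Rightarrow> real \<Rightarrow> nat set \<Rightarrow> nat \<Rightarrow> edge list \<Rightarrow> edge list \<Rightarrow> real" where
  "true_ratio b lam V v dn todo =
     lam * Zg b lam V (pin v True todo dn) / Zg b lam V (pin v False todo dn)"

lemma edges_weight_simps [simp]:
  "edges_weight b [] S = 1"
  "edges_weight b (e # g) S = edge_factor b e S * edges_weight b g S"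
  by (simp_all add: edges_weight_def)

lemma edge_factor_pin1: "edge_factor b (pin1 v c e) S = edge_factor b e (upd c v S)"
  by (cases e) (auto simp: edge_factor_def pin1_def upd_def)

lemma edges_weight_pin:
  "edges_weight b (pin v c es acc) S = edges_weight b es (upd c v S) * edges_weight b acc S"
  by (induction es arbitrary: acc) (simp_all add: edge_factor_pin1)

lemma Zc_cong:
  assumes "\<And>S. edges_weight b g S = edges_weight b g' S"
  shows "Zc b lam V c us g = Zc b lam V c us g'"
  by (simp add: Zc_def assms cong: if_cong)

lemma sum_Pow_insert:
  fixes g :: "nat set \<Rightarrow> real"
  assumes "finite W" "u \<notin> W"
  shows "(\<Sum>S\<in>Pow (insert u W). g S) = (\<Sum>S\<in>Pow W. g S + g (insert u S))"
proof -
  have "inj_on (insert u) (Pow W)" using assms by (auto simp: inj_on_def)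
  then show ?thesis unfolding Pow_insert
    using assms by (subst sum.union_disjoint) (auto simp: sum.reindex sum.distrib)
qed

text \<open>Pair \<open>S\<close> with \<open>insert u S\<close>. On the right \<open>f\<close> no
  longer sees whether \<open>u\<close> belongs to the set, so summing over both cases yields the
  factor \<open>1 + lam\<close> that stands on the left.\<close>

lemma sum_Pow_fix:
  fixes f :: "nat set \<Rightarrow> real"
  assumes "finite V" "u \<in> V"
  shows "(1 + lam) * (\<Sum>S\<in>Pow V. if (u \<in> S) = c then lam ^ card S * f S else 0)
       = (if c then lam else 1) * (\<Sum>S\<in>Pow V. lam ^ card S * f (upd c u S))"
proof -
  define W where "W = V - {u}"
  have W: "finite W" "u \<notin> W" "V = insert u W" using assms by (auto simp: W_def)
  note split = sum_Pow_insert[OF W(1,2), folded W(3)]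
  have fin: "finite S" "u \<notin> S" if "S \<in> Pow W" for S
    using that W by (auto intro: finite_subset)
  show ?thesis
    unfolding split sum_distrib_left
  proof (rule sum.cong[OF refl], goal_cases)
    case (1 S)
    have "insert u S - {u} = S" "S - {u} = S" using fin[OF 1] by auto
    then show ?case using fin[OF 1] by (auto simp: upd_def algebra_simps)
  qed
qed

lemma Zc_Cons:
  assumes "finite V" "u \<in> V" "u \<notin> set us"
  shows "(1 + lam) * Zc b lam V c (u # us) g
       = (if c then lam else 1) * Zc b lam V c us (pin u c g [])"
proof -
  let ?f = "\<lambda>S. if \<forall>w\<in>set us. (w \<in> S) = c then edges_weight b g S else 0"
  have "Zc b lam V c (u # us) g =
      (\<Sum>S\<in>Pow V. if (u \<in> S) = c then lam ^ card S * ?f S else 0)"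
    unfolding Zc_def by (intro sum.cong) auto
  moreover have "Zc b lam V c us (pin u c g []) = (\<Sum>S\<in>Pow V. lam ^ card S * ?f (upd c u S))"
    unfolding Zc_def using assms(3)
    by (intro sum.cong) (auto simp: edges_weight_pin upd_def)
  ultimately show ?thesis using sum_Pow_fix[OF assms(1,2)] by presburger
qed

lemma Zg_split:
  assumes "finite V" "u \<in> V"
  shows "(1 + lam) * Zg b lam V g = Zg b lam V (pin u False g []) + lam * Zg b lam V (pin u True g [])"
proof -
  have "Zg b lam V g = Zc b lam V True [u] g + Zc b lam V False [u] g"
    unfolding Zc_def by (subst sum.distrib[symmetric], rule sum.cong) simp_all
  then show ?thesis
    using Zc_Cons[OF assms, of "[]" lam b True g] Zc_Cons[OF assms, of "[]" lam b False g]
    by (simp add: algebra_simps Zc_Nil[of _ _ _ False])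
qed

lemma edge_factor_pos: "b < 1 \<Longrightarrow> 0 < edge_factor b e S"
  by (simp add: edge_factor_def split: prod.splits)

lemma edges_weight_pos: "b < 1 \<Longrightarrow> 0 < edges_weight b g S"
  by (induction g) (auto simp: edge_factor_pos)

lemma Zg_pos:
  assumes "finite V" "b < 1" "0 < lam"
  shows "0 < Zg b lam V g"
  unfolding Zc_def using assms edges_weight_pos[OF assms(2)] by (auto intro!: sum_pos)

lemma Zc_nonneg:
  assumes "b < 1" "0 < lam"
  shows "0 \<le> Zc b lam V c us g"
  unfolding Zc_def using assms edges_weight_pos[OF assms(1)] by (auto intro!: sum_nonneg simp: less_imp_le)

lemma Zc_le_Zg:
  assumes "b < 1" "0 < lam"
  shows "Zc b lam V c us g \<le> Zg b lam V g"
  unfolding Zc_def using assms edges_weight_pos[OF assms(1)] by (auto intro!: sum_mono simp: less_imp_le)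

text \<open>An edge with one live flag costs the factor \<open>1 - b\<close> exactly where it is
  monochromatic with that value, so it removes the share \<open>b\<close> of the weight of those
  configurations.\<close>

lemma Zg_add_edge1: "Zg b lam V ((False, f, us) # g) = Zg b lam V g - b * of_bool f * Zc b lam V True us g"
  unfolding Zc_def sum_distrib_left sum_subtractf[symmetric]
  by (intro sum.cong) (auto simp: edge_factor_def algebra_simps)

lemma Zg_add_edge0: "Zg b lam V ((f, False, us) # g) = Zg b lam V g - b * of_bool f * Zc b lam V False us g"
  unfolding Zc_def sum_distrib_left sum_subtractf[symmetric]
  by (intro sum.cong) (auto simp: edge_factor_def algebra_simps)

definition true_fac :: "real \<Rightarrow> real \<Rightarrow> nat set \<Rightarrow> bool \<Rightarrow> bool \<Rightarrow> nat list \<Rightarrow> edge list \<Rightarrow> real" where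
  "true_fac b lam V f0 f1 us g =
     (1 - b * of_bool f1 * (Zc b lam V True us g / Zg b lam V g))
     / (1 - b * of_bool f0 * (Zc b lam V False us g / Zg b lam V g))"

lemma true_ratio_Nil: 
  assumes "finite V" "b < 1" "0 < lam"
  shows "true_ratio b lam V v dn [] = lam"
  using Zg_pos[OF assms] by (simp add: true_ratio_def less_imp_neq[symmetric])

lemma true_ratio_skip:
  "v \<notin> set us \<Longrightarrow> true_ratio b lam V v dn ((f0, f1, us) # es)
      = true_ratio b lam V v ((f0, f1, us) # dn) es"
  by (simp add: true_ratio_def pin1_def)

text \<open>Telescoping through the graph in which this edge sees \<open>v = 0\<close> while the
  later ones see \<open>v = 1\<close>. It differs from the numerator graph only in which flag of the
  edge on \<open>?ws\<close> survives over the common \<open>?g\<close>, which gives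
  \<open>true_fac\<close>; its quotient with the denominator is again an odds, with the edge moved
  to \<open>dn\<close>.\<close>

lemma true_ratio_Cons:
  assumes "finite V" "b < 1" "0 < lam" and v: "v \<in> set us"
  shows "true_ratio b lam V v dn ((f0, f1, us) # es)
      = true_fac b lam V f0 f1 (removeAll v us) (pin v True es dn)
        * true_ratio b lam V v ((f0, False, removeAll v us) # dn) es"
proof -
  let ?ws = "removeAll v us" and ?g = "pin v True es dn"
  have pos: "0 < Zg b lam V g" for g by (rule Zg_pos) fact+
  have n: "Zg b lam V (pin v True ((f0, f1, us) # es) dn) = Zg b lam V ((False, f1, ?ws) # ?g)"
    by (rule Zc_cong) (use v in \<open>simp add: edges_weight_pin pin1_def\<close>)
  have m: "Zg b lam V (pin v True es ((f0, False, ?ws) # dn)) = Zg b lam V ((f0, False, ?ws) # ?g)"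
    by (rule Zc_cong) (simp add: edges_weight_pin)
  have d: "pin v False ((f0, f1, us) # es) dn = pin v False es ((f0, False, ?ws) # dn)"
    using v by (simp add: pin1_def)
  have f: "true_fac b lam V f0 f1 ?ws ?g
      = Zg b lam V ((False, f1, ?ws) # ?g) / Zg b lam V ((f0, False, ?ws) # ?g)"
    using pos[of ?g] pos[of "(f0, False, ?ws) # ?g"]
    unfolding true_fac_def Zg_add_edge1 Zg_add_edge0 by (simp add: field_simps)
  show ?thesis
    unfolding true_ratio_def n m d f using pos[of "(f0, False, ?ws) # ?g"] by simp
qed

text \<open>The chain rule for conditional probabilities. The spurious factors
  \<open>1 + lam\<close> of the pinned vertex cancel between numerator and denominator.\<close>

lemma prob_Cons:
  assumes "finite V" "b < 1" "0 < lam" "u \<in> V" "u \<notin> set us"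
  shows "Zc b lam V c (u # us) g / Zg b lam V g =
     logistic (if c then ln (true_ratio b lam V u [] g) else - ln (true_ratio b lam V u [] g))
     * (Zc b lam V c us (pin u c g []) / Zg b lam V (pin u c g []))"
proof -
  have pos: "0 < Zg b lam V g" for g by (rule Zg_pos) fact+
  let ?Z0 = "Zg b lam V (pin u False g [])" and ?Z1 = "Zg b lam V (pin u True g [])"
  have r: "true_ratio b lam V u [] g = lam * ?Z1 / ?Z0" by (simp add: true_ratio_def)
  have rp: "0 < lam * ?Z1 / ?Z0" using pos assms by simp
  have s: "Zg b lam V g = (?Z0 + lam * ?Z1) / (1 + lam)"
    using Zg_split[OF assms(1,4), of lam b g] assms(3) by (simp add: field_simps)
  have z: "Zc b lam V c (u # us) g = (if c then lam else 1) * Zc b lam V c us (pin u c g []) / (1 + lam)"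
    using Zc_Cons[OF assms(1,4,5), of lam b c g] assms(3) by (simp add: field_simps)
  have l: "Zc b lam V c (u # us) g / Zg b lam V g
      = (if c then lam else 1) * Zc b lam V c us (pin u c g []) / (?Z0 + lam * ?Z1)"
    using assms(3) unfolding s z by simp
  have "1 + lam * ?Z1 / ?Z0 = (?Z0 + lam * ?Z1) / ?Z0"
    using pos[of "pin u False g []"] by (simp add: field_simps)
  then show ?thesis
    using pos[of "pin u False g []"] pos[of "pin u True g []"]
    unfolding l r by (cases c) (simp_all add: logistic_ln[OF rp] logistic_minus_ln[OF rp])
qed

section \<open>Degrees and well-formedness under pinning\<close>

definition deg :: "nat \<Rightarrow> edge list \<Rightarrow> nat" where
  "deg u g = length (filter (\<lambda>(f0, f1, us). u \<in> set us) g)"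

definition wf_edges :: "nat set \<Rightarrow> edge list \<Rightarrow> bool" where
  "wf_edges V g \<longleftrightarrow> (\<forall>(f0, f1, us)\<in>set g. distinct us \<and> set us \<subseteq> V)"

lemma deg_simps [simp]:
  "deg u [] = 0"
  "deg u ((f0, f1, us) # g) = (if u \<in> set us then Suc (deg u g) else deg u g)"
  by (simp_all add: deg_def)

lemma wf_edges_simps [simp]:
  "wf_edges V []"
  "wf_edges V ((f0, f1, us) # g) \<longleftrightarrow> distinct us \<and> set us \<subseteq> V \<and> wf_edges V g"
  by (auto simp: wf_edges_def)

lemma deg_pin: "deg u (pin v c es acc) \<le> deg u es + deg u acc"
proof (induction es arbitrary: acc)
  case (Cons e es)
  from Cons[of "pin1 v c e # acc"] show ?case by (cases e) (auto simp: pin1_def split: if_splits)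
qed simp

lemma wf_edges_pin: "wf_edges V es \<Longrightarrow> wf_edges V acc \<Longrightarrow> wf_edges V (pin v c es acc)"
proof (induction es arbitrary: acc)
  case (Cons e es)
  have "wf_edges V (pin1 v c e # acc)"
    using Cons.prems by (cases e) (auto simp: pin1_def distinct_removeAll)
  then show ?case using Cons by (cases e) auto
qed simp

definition wf_graph :: "nat set \<Rightarrow> nat \<Rightarrow> edge list \<Rightarrow> bool" where
  "wf_graph V D g \<longleftrightarrow> wf_edges V g \<and> (\<forall>u. deg u g \<le> D)"

lemma wf_graph_pin: "wf_graph V D g \<Longrightarrow> wf_graph V D (pin v c g [])"
  using deg_pin[of _ v c g "[]"] by (auto simp: wf_graph_def wf_edges_pin intro: order_trans)

lemma abs_ln_frac_le:
  fixes b :: real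
  assumes "0 \<le> b" "b < 1" "1 - b \<le> x" "x \<le> 1" "1 - b \<le> y" "y \<le> 1"
  shows "\<bar>ln (x / y)\<bar> \<le> - ln (1 - b)"
proof -
  have "ln (1 - b) \<le> ln x" "ln x \<le> 0" "ln (1 - b) \<le> ln y" "ln y \<le> 0"
    using assms by auto
  moreover have "ln (x / y) = ln x - ln y" using assms by (simp add: ln_div)
  ultimately show ?thesis by linarith
qed

lemma one_minus_mult_bounds:
  fixes b p :: real
  assumes "0 \<le> b" "0 \<le> p" "p \<le> 1"
  shows "1 - b \<le> 1 - b * of_bool f * p" "1 - b * of_bool f * p \<le> 1"
  using assms mult_left_mono[of p 1 b] by (cases f; simp)+

section \<open>Error decay of the truncated recursion\<close>

definition signed :: "bool \<Rightarrow> real \<Rightarrow> real" where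
  "signed c x = (if c then x else - x)"

text \<open>\<open>B\<close> bounds all log-odds that occur, true or approximate: the base value is
  \<open>lam\<close>, and each of at most \<open>D\<close> factors moves the logarithm by at most
  \<open>- ln (1 - b)\<close>. \<open>C\<close>, \<open>B\<close> and \<open>\<rho>\<close> are tied
  to \<open>b\<close> and \<open>lam\<close> by inequalities only, so that one choice serves all
  sufficiently good approximations of the parameters.\<close>

locale decay =
  fixes b lam :: real and V :: "nat set" and D :: nat and B C \<rho> :: real
  assumes b: "0 < b" "b < 1" and lam: "0 < lam" and V: "finite V"
    and C: "b / (1 - b) \<le> C"
    and B: "\<bar>ln lam\<bar> + real D * (- ln (1 - b)) \<le> B"
    and \<rho>: "0 < \<rho>" "\<rho> < 1" "logistic B \<le> \<rho>"
    and rate: "g \<le> exp (- 1 / 2) \<Longrightarrow> g \<le> 2 * real k * logistic B ^ k \<Longrightarrow> real D * C * g \<le> \<rho> ^ k"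
begin

abbreviation "Pr c us g \<equiv> Zc b lam V c us g / Zg b lam V g"
abbreviation "R \<equiv> true_ratio b lam V"
abbreviation "F \<equiv> true_fac b lam V"

lemma C_nonneg: "0 \<le> C"
  using b C by (meson divide_nonneg_pos less_imp_le order_trans diff_gt_0_iff_gt)

lemma Zg_pos': "0 < Zg b lam V g"
  by (rule Zg_pos) (use b lam V in auto)

lemma Pr_bounds: "0 \<le> Pr c us g" "Pr c us g \<le> 1"
  using Zg_pos' Zc_nonneg[of b lam] Zc_le_Zg[of b lam] b lam by (auto simp: divide_le_eq_1)

lemma F_bounds: "0 < F f0 f1 us g" "\<bar>ln (F f0 f1 us g)\<bar> \<le> - ln (1 - b)"
proof -
  show "\<bar>ln (F f0 f1 us g)\<bar> \<le> - ln (1 - b)"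
    unfolding true_fac_def
    by (intro abs_ln_frac_le one_minus_mult_bounds Pr_bounds) (use b in auto)
  have "0 < 1 - b * of_bool f * Pr c us g" for f c
    using one_minus_mult_bounds(1)[of b "Pr c us g" f] Pr_bounds b by (smt (verit))
  then show "0 < F f0 f1 us g" unfolding true_fac_def by (metis divide_pos_pos)
qed

lemma R_bounds: "0 < R v dn todo \<and> \<bar>ln (R v dn todo)\<bar> \<le> \<bar>ln lam\<bar> + deg v todo * (- ln (1 - b))"
proof (induction todo arbitrary: dn)
  case Nil
  then show ?case using lam b V by (simp add: true_ratio_Nil)
next
  case (Cons e es)
  obtain f0 f1 us where e: "e = (f0, f1, us)" by (cases e)
  show ?case
  proof (cases "v \<in> set us")
    case False
    then show ?thesis using Cons[of "e # dn"] by (simp add: e true_ratio_skip)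
  next
    case True
    let ?f = "F f0 f1 (removeAll v us) (pin v True es dn)"
    let ?r = "R v ((f0, False, removeAll v us) # dn) es"
    have "R v dn (e # es) = ?f * ?r"
      unfolding e by (rule true_ratio_Cons) (use b lam V True in auto)
    moreover have "0 < ?f" "0 < ?r" "\<bar>ln ?f\<bar> \<le> - ln (1 - b)"
      "\<bar>ln ?r\<bar> \<le> \<bar>ln lam\<bar> + deg v es * (- ln (1 - b))"
      using F_bounds Cons by auto
    ultimately show ?thesis using True by (simp add: e ln_mult algebra_simps)
  qed
qed

definition ratio_ok :: "nat \<Rightarrow> bool" where
  "ratio_ok L \<longleftrightarrow> (\<forall>v dn todo. v \<in> V \<longrightarrow> wf_edges V dn \<longrightarrow> wf_edges V todo \<longrightarrow>
     (\<forall>u. deg u dn + deg u todo \<le> D) \<longrightarrow>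
     0 < ratio b lam v L dn todo \<and>
     \<bar>ln (ratio b lam v L dn todo)\<bar> \<le> \<bar>ln lam\<bar> + deg v todo * (- ln (1 - b)) \<and>
     \<bar>ln (ratio b lam v L dn todo) - ln (R v dn todo)\<bar> \<le> deg v todo * (2 * C * \<rho> ^ L))"

lemma deg_le_B:
  assumes "n \<le> D" "x \<le> \<bar>ln lam\<bar> + real n * (- ln (1 - b))"
  shows "x \<le> B"
proof -
  have "real n * (- ln (1 - b)) \<le> real D * (- ln (1 - b))"
    using assms b by (intro mult_right_mono) auto
  then show ?thesis using B assms by linarith
qed

lemma ratio_ok_graph:
  assumes "ratio_ok L" "v \<in> V" "wf_graph V D g"
  shows "0 < ratio b lam v L [] g" "\<bar>ln (ratio b lam v L [] g)\<bar> \<le> B" "\<bar>ln (R v [] g)\<bar> \<le> B"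
    "\<bar>ln (ratio b lam v L [] g) - ln (R v [] g)\<bar> \<le> real D * (2 * C * \<rho> ^ L)"
proof -
  have d: "deg v g \<le> D" using assms by (simp add: wf_graph_def)
  have *: "0 < ratio b lam v L [] g \<and>
     \<bar>ln (ratio b lam v L [] g)\<bar> \<le> \<bar>ln lam\<bar> + deg v g * (- ln (1 - b)) \<and>
     \<bar>ln (ratio b lam v L [] g) - ln (R v [] g)\<bar> \<le> deg v g * (2 * C * \<rho> ^ L)"
    using assms unfolding ratio_ok_def wf_graph_def by auto
  show "0 < ratio b lam v L [] g" using * by blast
  show "\<bar>ln (ratio b lam v L [] g)\<bar> \<le> B" using * deg_le_B[OF d] by blast
  show "\<bar>ln (R v [] g)\<bar> \<le> B" using R_bounds[of v "[]" g] deg_le_B[OF d] by blast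
  have "deg v g * (2 * C * \<rho> ^ L) \<le> real D * (2 * C * \<rho> ^ L)"
    using d C_nonneg \<rho> by (intro mult_right_mono) auto
  then show "\<bar>ln (ratio b lam v L [] g) - ln (R v [] g)\<bar> \<le> real D * (2 * C * \<rho> ^ L)"
    using * by linarith
qed

text \<open>Recording the entries at index 0 lets the instances for \<open>c = True\<close> and
  \<open>c = False\<close> share their first log-odds, the coupling that
  \<open>log_factor_lipschitz\<close> requires.\<close>

lemma allp_logits:
  assumes "ratio_ok L" "distinct us" "set us \<subseteq> V" "wf_graph V D g"
  shows "\<exists>x y. (\<forall>j<length us. \<bar>x j - y j\<bar> \<le> real D * (2 * C * \<rho> ^ L) \<and> \<bar>x j\<bar> \<le> B \<and> \<bar>y j\<bar> \<le> B) \<and>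
     allp b lam c us L g = (\<Prod>j<length us. logistic (signed c (x j))) \<and>
     Pr c us g = (\<Prod>j<length us. logistic (signed c (y j))) \<and>
     x 0 = ln (ratio b lam (hd us) L [] g) \<and> y 0 = ln (R (hd us) [] g)"
  using assms(2-)
proof (induction us arbitrary: g)
  case Nil
  show ?case
    \<comment> \<open>The constraint at index 0 persists for the empty list, where
      \<open>hd []\<close> is unspecified; constant sequences satisfy it.\<close>
    by (rule exI[of _ "\<lambda>_. ln (ratio b lam (hd []) L [] g)"], rule exI[of _ "\<lambda>_. ln (R (hd []) [] g)"])
       (use Zg_pos'[of g] in \<open>simp add: allp.simps Zc_Nil[of _ _ _ c]\<close>)
next
  case (Cons u us)
  have us: "distinct us" "set us \<subseteq> V" "wf_graph V D (pin u c g [])"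
    using Cons.prems wf_graph_pin by auto
  obtain x y where xy:
     "\<And>j. j < length us \<Longrightarrow> \<bar>x j - y j\<bar> \<le> real D * (2 * C * \<rho> ^ L) \<and> \<bar>x j\<bar> \<le> B \<and> \<bar>y j\<bar> \<le> B"
     "allp b lam c us L (pin u c g []) = (\<Prod>j<length us. logistic (signed c (x j)))"
     "Pr c us (pin u c g []) = (\<Prod>j<length us. logistic (signed c (y j)))"
    using Cons.IH[OF us] by blast
  let ?r = "ratio b lam u L [] g" and ?R = "R u [] g"
  have u: "u \<in> V" "wf_graph V D g" using Cons.prems by auto
  note r = ratio_ok_graph[OF assms(1) u]
  let ?x = "case_nat (ln ?r) x" and ?y = "case_nat (ln ?R) y"
  have "allp b lam c (u # us) L g = logistic (signed c (ln ?r)) * allp b lam c us L (pin u c g [])"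
    using r(1) by (simp add: allp.simps signed_def logistic_ln logistic_minus_ln)
  moreover have "Pr c (u # us) g = logistic (signed c (ln ?R)) * Pr c us (pin u c g [])"
    unfolding signed_def by (rule prob_Cons) (use b lam V Cons.prems in auto)
  moreover have "(\<Prod>j<length (u # us). logistic (signed c (case_nat z0 z j)))
      = logistic (signed c z0) * (\<Prod>j<length us. logistic (signed c (z j)))" for z0 z
    by (simp add: prod.lessThan_Suc_shift del: prod.lessThan_Suc)
  moreover have "\<bar>?x j - ?y j\<bar> \<le> real D * (2 * C * \<rho> ^ L) \<and> \<bar>?x j\<bar> \<le> B \<and> \<bar>?y j\<bar> \<le> B"
    if "j < length (u # us)" for j
    using that r xy(1) by (cases j) auto
  ultimately show ?case
    using xy(2,3) by (intro exI[of _ ?x] exI[of _ ?y]) simp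
qed

lemma prod_logistic_le:
  assumes "\<And>j. j < k \<Longrightarrow> \<bar>y j\<bar> \<le> B"
  shows "0 \<le> (\<Prod>j<k. logistic (signed c (y j)))" "(\<Prod>j<k. logistic (signed c (y j))) \<le> logistic B ^ k"
    "(\<Prod>j<k. logistic (signed c (y j))) \<le> 1"
proof -
  have "logistic (signed c (y j)) \<le> logistic B" if "j < k" for j
    using assms[OF that] by (intro logistic_mono) (auto simp: signed_def)
  then have "(\<Prod>j<k. logistic (signed c (y j))) \<le> (\<Prod>j<k. logistic B)"
    using logistic_pos by (intro prod_mono) (auto simp: less_imp_le)
  then show "(\<Prod>j<k. logistic (signed c (y j))) \<le> logistic B ^ k" by simp
  show "0 \<le> (\<Prod>j<k. logistic (signed c (y j)))" using logistic_pos by (auto intro!: prod_nonneg simp: less_imp_le)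
  show "(\<Prod>j<k. logistic (signed c (y j))) \<le> 1"
    using logistic_pos logistic_less_1 by (auto intro!: prod_le_1 simp: less_imp_le)
qed

text \<open>By \<open>- ln (1 - y) \<le> y / (1 - y)\<close> the smallness of a probability carries
  over to its log factor. Two such terms make up the \<open>2 * C\<close> of the error
  bound.\<close>

lemma neg_ln_one_minus_le:
  assumes "0 \<le> p" "p \<le> s" "s \<le> 1"
  shows "\<bar>ln (1 - b * of_bool f * p)\<bar> \<le> C * s"
proof -
  have p: "p \<le> 1" using assms by simp
  define y where "y = b * of_bool f * p"
  have y: "0 \<le> y" "y \<le> b" "y \<le> b * p"
    using one_minus_mult_bounds[of b p f] assms p b by (auto simp: y_def)
  have "ln (1 / (1 - y)) \<le> 1 / (1 - y) - 1"
    using y b by (intro ln_le_minus_one) simp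
  also have "\<dots> = y / (1 - y)" using y b by (simp add: field_simps)
  also have "\<dots> \<le> (b * p) / (1 - b)" using y b by (intro frac_le) auto
  also have "\<dots> = b / (1 - b) * p" by simp
  also have "\<dots> \<le> C * s" using C C_nonneg assms by (intro mult_mono) auto
  finally have "- ln (1 - y) \<le> C * s" using y b by (simp add: ln_div)
  moreover have "ln (1 - y) \<le> 0" using y b by simp
  ultimately show ?thesis unfolding y_def by linarith
qed

text \<open>If the edge exceeds the budget, it is replaced by 1, and its true factor is that close
  to 1. Otherwise the marginals are only as good as budget \<open>L - k\<close> permits, and the
  Lipschitz constant of an edge of length \<open>k\<close> makes up for the loss of
  \<open>\<rho> ^ k\<close>. An empty remainder is exact and keeps the budget, so smaller budgets
  suffice as hypotheses.\<close>

lemma fac_ok: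
  assumes IH: "\<And>L'. L' < L \<Longrightarrow> ratio_ok L'"
    and us: "distinct us" "set us \<subseteq> V" "wf_graph V D g"
  shows "0 < fac b lam L f0 f1 us g \<and> \<bar>ln (fac b lam L f0 f1 us g)\<bar> \<le> - ln (1 - b) \<and>
    \<bar>ln (fac b lam L f0 f1 us g) - ln (F f0 f1 us g)\<bar> \<le> 2 * C * \<rho> ^ L"
proof (cases "us = []")
  case True
  then have "fac b lam L f0 f1 us g = F f0 f1 us g"
    using Zg_pos'[of g] by (simp add: fac.simps allp.simps true_fac_def Zc_Nil[of _ _ _ False])
  then show ?thesis using F_bounds[of f0 f1 us g] C_nonneg \<rho> by simp
next
  case False
  let ?k = "length us"
  have pos: "0 < 1 - b * of_bool f * p" if "0 \<le> p" "p \<le> 1" for f p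
    using one_minus_mult_bounds(1)[of b p f] b that by linarith
  show ?thesis
  proof (cases "L < ?k")
    case True
    have "logistic B \<le> 1" "0 \<le> logistic B" using logistic_pos logistic_less_1 by (auto simp: less_imp_le)
    \<comment> \<open>Every conditional marginal along the edge is at most
      \<open>logistic B\<close>; as \<open>L < ?k\<close>, the product is within
      \<open>\<rho> ^ L\<close>.\<close>
    have Pr_le: "Pr c us g \<le> logistic B ^ ?k" for c
      using us
    proof (induction us arbitrary: g)
      case (Cons u us)
      have "Pr c (u # us) g = logistic (signed c (ln (R u [] g))) * Pr c us (pin u c g [])"
        unfolding signed_def by (rule prob_Cons) (use b lam V Cons.prems in auto)
      moreover have "\<bar>ln (R u [] g)\<bar> \<le> B"
        using R_bounds[of u "[]" g] deg_le_B[of "deg u g"] Cons.prems by (auto simp: wf_graph_def)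
      then have "logistic (signed c (ln (R u [] g))) \<le> logistic B"
        by (intro logistic_mono) (auto simp: signed_def)
      moreover have "Pr c us (pin u c g []) \<le> logistic B ^ length us"
        using Cons wf_graph_pin by auto
      ultimately show ?case using Pr_bounds logistic_pos
        by (auto intro!: mult_mono simp: less_imp_le simp del: times_divide_eq_right)
    qed (simp add: Pr_bounds)
    have sB: "logistic B ^ ?k \<le> \<rho> ^ L"
    proof -
      have "logistic B ^ ?k \<le> logistic B ^ L"
        using True \<open>logistic B \<le> 1\<close> \<open>0 \<le> logistic B\<close> by (intro power_decreasing) auto
      also have "\<dots> \<le> \<rho> ^ L" using \<rho> \<open>0 \<le> logistic B\<close> by (intro power_mono) auto
      finally show ?thesis .
    qed
    have "\<bar>ln (1 - b * of_bool f * Pr c us g)\<bar> \<le> C * logistic B ^ ?k" for f c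
      by (rule neg_ln_one_minus_le) (use Pr_bounds Pr_le \<open>0 \<le> logistic B\<close> \<open>logistic B \<le> 1\<close> in \<open>auto intro: power_le_one\<close>)
    then have "\<bar>ln (1 - b * of_bool f * Pr c us g)\<bar> \<le> C * \<rho> ^ L" for f c
      using mult_left_mono[OF sB C_nonneg] by (meson order_trans)
    from this[of f1 True] this[of f0 False]
    have "\<bar>ln (F f0 f1 us g)\<bar> \<le> 2 * C * \<rho> ^ L"
      unfolding true_fac_def by (subst ln_divide_pos[OF pos[OF Pr_bounds] pos[OF Pr_bounds]]) linarith
    then show ?thesis using True b by (simp add: fac.simps)
  next
    case nlt: False
    have k: "0 < ?k" "?k \<le> L" using False nlt by auto
    let ?L = "L - ?k" and ?d = "real D * (2 * C * \<rho> ^ (L - ?k))"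
    have ok: "ratio_ok ?L" by (rule IH) (use k in linarith)
    obtain x y where xy:
      "\<And>j. j < ?k \<Longrightarrow> \<bar>x j - y j\<bar> \<le> ?d \<and> \<bar>x j\<bar> \<le> B \<and> \<bar>y j\<bar> \<le> B"
      "allp b lam True us ?L g = (\<Prod>j<?k. logistic (signed True (x j)))"
      "Pr True us g = (\<Prod>j<?k. logistic (signed True (y j)))"
      "x 0 = ln (ratio b lam (hd us) ?L [] g)" "y 0 = ln (R (hd us) [] g)"
      using allp_logits[OF ok us, of True] by blast
    obtain z w where zw:
      "\<And>j. j < ?k \<Longrightarrow> \<bar>z j - w j\<bar> \<le> ?d \<and> \<bar>z j\<bar> \<le> B \<and> \<bar>w j\<bar> \<le> B"
      "allp b lam False us ?L g = (\<Prod>j<?k. logistic (signed False (z j)))"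
      "Pr False us g = (\<Prod>j<?k. logistic (signed False (w j)))"
      "z 0 = ln (ratio b lam (hd us) ?L [] g)" "w 0 = ln (R (hd us) [] g)"
      using allp_logits[OF ok us, of False] by blast
    let ?P1 = "allp b lam True us ?L g" and ?P0 = "allp b lam False us ?L g"
    have P: "0 \<le> ?P1" "?P1 \<le> 1" "0 \<le> ?P0" "?P0 \<le> 1"
      unfolding xy(2) zw(2) using prod_logistic_le xy(1) zw(1) by blast+
    have fac: "fac b lam L f0 f1 us g = (1 - b * of_bool f1 * ?P1) / (1 - b * of_bool f0 * ?P0)"
      using nlt by (simp add: fac.simps)
    have d0: "0 \<le> ?d" using C_nonneg \<rho> by simp
    have "\<exists>h. 0 \<le> h \<and> h \<le> exp (- 1 / 2) \<and> h \<le> 2 * real ?k * logistic B ^ ?k \<and>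
      \<bar>(ln (1 - b * of_bool f1 * (\<Prod>j<?k. logistic (x j))) - ln (1 - b * of_bool f0 * (\<Prod>j<?k. logistic (- z j))))
       - (ln (1 - b * of_bool f1 * (\<Prod>j<?k. logistic (y j))) - ln (1 - b * of_bool f0 * (\<Prod>j<?k. logistic (- w j))))\<bar>
      \<le> b / (1 - b) * h * ?d"
      by (rule log_factor_lipschitz) (use b d0 xy zw in auto)
    then obtain h where h: "0 \<le> h" "h \<le> exp (- 1 / 2)" "h \<le> 2 * real ?k * logistic B ^ ?k" and
      "\<bar>(ln (1 - b * of_bool f1 * ?P1) - ln (1 - b * of_bool f0 * ?P0))
       - (ln (1 - b * of_bool f1 * Pr True us g) - ln (1 - b * of_bool f0 * Pr False us g))\<bar>
      \<le> b / (1 - b) * h * ?d"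
      unfolding xy(2,3) zw(2,3) signed_def if_True if_False by blast
    then have "\<bar>ln (fac b lam L f0 f1 us g) - ln (F f0 f1 us g)\<bar> \<le> b / (1 - b) * h * ?d"
      unfolding fac true_fac_def ln_divide_pos[OF pos[OF Pr_bounds] pos[OF Pr_bounds]]
        ln_divide_pos[OF pos[OF P(1,2)] pos[OF P(3,4)]] by - assumption
    also have "\<dots> \<le> C * h * ?d"
      using C h d0 by (intro mult_right_mono) auto
    \<comment> \<open>The \<open>D\<close> inside \<open>?d\<close> counts the factors of each
      marginal; joined with \<open>C * h\<close> it forms the quantity that \<open>rate\<close>
      bounds by \<open>\<rho> ^ ?k\<close>.\<close>
    also have "\<dots> = 2 * C * (real D * C * h * \<rho> ^ (L - ?k))" by simp
    also have "\<dots> \<le> 2 * C * (\<rho> ^ ?k * \<rho> ^ (L - ?k))"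
      using rate[OF h(2,3)] \<rho> C_nonneg by (intro mult_left_mono mult_right_mono) auto
    also have "\<rho> ^ ?k * \<rho> ^ (L - ?k) = \<rho> ^ L" using k by (simp flip: power_add)
    finally have err: "\<bar>ln (fac b lam L f0 f1 us g) - ln (F f0 f1 us g)\<bar> \<le> 2 * C * \<rho> ^ L" .
    have "\<bar>ln (fac b lam L f0 f1 us g)\<bar> \<le> - ln (1 - b)"
      unfolding fac by (intro abs_ln_frac_le one_minus_mult_bounds P) (use b in auto)
    then show ?thesis using err pos P unfolding fac by (metis divide_pos_pos)
  qed
qed

lemma ratio_ok: "ratio_ok L"
proof (induction L rule: less_induct)
  case (less L)
  have "0 < ratio b lam v L dn todo \<and>
     \<bar>ln (ratio b lam v L dn todo)\<bar> \<le> \<bar>ln lam\<bar> + deg v todo * (- ln (1 - b)) \<and>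
     \<bar>ln (ratio b lam v L dn todo) - ln (R v dn todo)\<bar> \<le> deg v todo * (2 * C * \<rho> ^ L)"
    if "v \<in> V" "wf_edges V dn" "wf_edges V todo" "\<forall>u. deg u dn + deg u todo \<le> D" for v dn todo
    using that
  proof (induction todo arbitrary: dn)
    case Nil
    then show ?case using lam b V by (simp add: true_ratio_Nil ratio.simps)
  next
    case (Cons e es)
    obtain f0 f1 us where e: "e = (f0, f1, us)" by (cases e)
    show ?case
    proof (cases "v \<in> set us")
      case False
      have "\<forall>u. deg u (e # dn) + deg u es \<le> D"
        using Cons.prems(4) by (auto simp: e split: if_splits)
      then show ?thesis using Cons.IH[of "e # dn"] Cons.prems False
        by (simp add: e true_ratio_skip ratio.simps)
    next
      case True
      let ?ws = "removeAll v us"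
      let ?g = "pin v True es dn" and ?dn = "(f0, False, ?ws) # dn"
      let ?f = "fac b lam L f0 f1 ?ws ?g" and ?r = "ratio b lam v L ?dn es"
      let ?F = "F f0 f1 ?ws ?g" and ?R = "R v ?dn es"
      have dn: "deg u ?dn + deg u es \<le> D" for u
        using Cons.prems(4) by (auto simp: e dest!: spec[of _ u] split: if_splits)
      have "deg u ?g \<le> D" for u
        using deg_pin[of u v True es dn] dn[of u] by (auto split: if_splits)
      then have g: "wf_graph V D ?g"
        using Cons.prems by (simp add: wf_graph_def e wf_edges_pin)
      have f0: "0 < ?f \<and> \<bar>ln ?f\<bar> \<le> - ln (1 - b) \<and> \<bar>ln ?f - ln ?F\<bar> \<le> 2 * C * \<rho> ^ L"
        by (rule fac_ok) (use less g Cons.prems in \<open>auto simp: e distinct_removeAll\<close>)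
      note f = conjunct1[OF f0] conjunct1[OF conjunct2[OF f0]] conjunct2[OF conjunct2[OF f0]]
      have r0: "0 < ?r \<and> \<bar>ln ?r\<bar> \<le> \<bar>ln lam\<bar> + deg v es * (- ln (1 - b)) \<and>
          \<bar>ln ?r - ln ?R\<bar> \<le> deg v es * (2 * C * \<rho> ^ L)"
        using Cons.prems dn by (intro Cons.IH) (auto simp: e distinct_removeAll)
      note r = conjunct1[OF r0] conjunct1[OF conjunct2[OF r0]] conjunct2[OF conjunct2[OF r0]]
      have "R v dn (e # es) = ?F * ?R"
        unfolding e by (rule true_ratio_Cons) (use b lam V True in auto)
      then have "ln (R v dn (e # es)) = ln ?F + ln ?R"
        using F_bounds R_bounds by (simp add: ln_mult_pos)
      moreover have "ratio b lam v L dn (e # es) = ?f * ?r" using True by (simp add: e ratio.simps)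
      moreover have "ln (?f * ?r) = ln ?f + ln ?r" using f r by (simp add: ln_mult_pos)
      moreover have "deg v (e # es) = Suc (deg v es)" using True by (simp add: e)
      moreover have "real (Suc (deg v es)) * x = x + real (deg v es) * x" for x
        by (simp add: algebra_simps)
      ultimately show ?thesis using f r by (simp only: mult_pos_pos) (intro conjI TrueI; linarith)
    qed
  qed
  then show ?case unfolding ratio_ok_def by blast
qed

end

section \<open>From marginals to the partition function\<close>

text \<open>
  Pinning the vertices to 0 in turn gives \<open>Z = \<beta>\<^sup>m (1 + R\<^sub>1) \<dots> (1 + R\<^sub>n)\<close> with the odds
  \<open>R\<^sub>i\<close> in the successive graphs.
\<close>

primrec zloop :: "'a::linordered_field \<Rightarrow> 'a \<Rightarrow> nat \<Rightarrow> nat \<Rightarrow> edge list \<Rightarrow> 'a" where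
  "zloop b lam L 0 g = (1 - b) ^ length g"
| "zloop b lam L (Suc i) g = (1 + ratio b lam i L [] g) * zloop b lam L i (pin i False g [])"

lemma of_rat_zloop: "real_of_rat (zloop b lam L i g) = zloop (of_rat b) (of_rat lam) L i g"
  by (induction i arbitrary: g)
     (simp_all add: of_rat_power of_rat_diff of_rat_mult of_rat_add of_rat_ratio)

lemma sum_Pow_power_card: "finite V \<Longrightarrow> (\<Sum>S\<in>Pow V. lam ^ card S) = (1 + lam :: real) ^ card V" for V :: "nat set"
proof (induction V rule: finite_induct)
  case (insert u W)
  have "card (insert u S) = Suc (card S)" if "S \<in> Pow W" for S
    using that insert.hyps by (subst card_insert_disjoint) (auto intro: finite_subset)
  then have "(\<Sum>S\<in>Pow (insert u W). lam ^ card S) = (\<Sum>S\<in>Pow W. (1 + lam) * lam ^ card S)"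
    using insert.hyps by (subst sum_Pow_insert) (auto simp: algebra_simps intro!: sum.cong)
  then show ?case using insert by (simp flip: sum_distrib_left)
qed simp

text \<open>Pinning to 0 never clears the first flag. Once all vertices are gone, every edge is
  therefore monochromatic and carries \<open>1 - b\<close>, the base case of
  \<open>zloop\<close>.\<close>

definition zero_flagged :: "edge list \<Rightarrow> bool" where
  "zero_flagged g \<longleftrightarrow> (\<forall>(f0, f1, us)\<in>set g. f0)"

lemma zero_flagged_pin:
  "zero_flagged es \<Longrightarrow> zero_flagged acc \<Longrightarrow> zero_flagged (pin v False es acc)"
proof (induction es arbitrary: acc)
  case (Cons e es)
  have "zero_flagged (pin1 v False e # acc)"
    using Cons.prems by (cases e) (auto simp: pin1_def zero_flagged_def)
  moreover have "zero_flagged es" using Cons.prems by (simp add: zero_flagged_def)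
  ultimately show ?case using Cons.IH by simp
qed simp

lemma wf_edges_pin_lessThan:
  "wf_edges {..<Suc i} es \<Longrightarrow> wf_edges {..<i} acc \<Longrightarrow> wf_edges {..<i} (pin i c es acc)"
proof (induction es arbitrary: acc)
  case (Cons e es)
  have "wf_edges {..<i} (pin1 i c e # acc)"
    using Cons.prems by (cases e) (auto simp: pin1_def distinct_removeAll less_Suc_eq)
  then show ?case using Cons by (cases e) auto
qed simp

lemma wf_edges_mono: "wf_edges V g \<Longrightarrow> V \<subseteq> W \<Longrightarrow> wf_edges W g"
  by (fastforce simp: wf_edges_def)

lemma wf_graph_pin_lessThan: "wf_graph {..<Suc i} D g \<Longrightarrow> wf_graph {..<i} D (pin i c g [])"
  using deg_pin[of _ i c g "[]"] by (auto simp: wf_graph_def wf_edges_pin_lessThan intro: order_trans)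

lemma edges_weight_empty:
  assumes "wf_edges {} g" "zero_flagged g"
  shows "edges_weight b g S = (1 - b) ^ length g"
  using assms by (induction g) (auto simp: edge_factor_def zero_flagged_def)

text \<open>The map from \<open>x\<close> to \<open>ln (1 + exp x)\<close> is 1-Lipschitz, so errors
  of log-odds enter the product for \<open>Z\<close> without amplification.\<close>

lemma abs_ln_one_plus_diff_le:
  fixes r s :: real
  assumes "0 < r" "0 < s"
  shows "\<bar>ln (1 + r) - ln (1 + s)\<bar> \<le> \<bar>ln r - ln s\<bar>"
proof -
  have *: "ln (1 + x) - ln (1 + y) \<le> \<bar>ln x - ln y\<bar>" if "0 < x" "0 < y" for x y :: real
  proof -
    let ?d = "\<bar>ln x - ln y\<bar>"
    have "x = exp (ln x - ln y) * y" using that by (simp add: exp_diff)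
    also have "\<dots> \<le> exp ?d * y" using that by (intro mult_right_mono) auto
    finally have "1 + x \<le> exp ?d * (1 + y)" by (simp add: distrib_left add_mono)
    then have "ln (1 + x) \<le> ln (exp ?d * (1 + y))" using that by simp
    then show ?thesis using that by (simp add: ln_mult_pos)
  qed
  show ?thesis using *[OF assms] *[OF assms(2,1)] by linarith
qed

text \<open>\<open>V\<close> keeps all \<open>n\<close> vertices, so each of the
  \<open>n - i\<close> vertices already pinned contributes a spurious \<open>1 + lam\<close> to
  \<open>Zg\<close>, which is divided out. At \<open>i = n\<close> nothing remains to be
  divided.\<close>

lemma (in decay) zloop_approx:
  assumes "V = {..<n}" "i \<le> n" "wf_graph {..<i} D g" "zero_flagged g"
  shows "0 < zloop b lam L i g \<and>
    \<bar>ln (zloop b lam L i g) - ln (Zg b lam V g / (1 + lam) ^ (n - i))\<bar> \<le> real i * (real D * (2 * C * \<rho> ^ L))"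
  using assms(2-)
proof (induction i arbitrary: g)
  case 0
  have "Zg b lam V g = (\<Sum>S\<in>Pow V. lam ^ card S) * (1 - b) ^ length g"
    unfolding Zc_def sum_distrib_right using 0
    by (intro sum.cong) (auto simp: wf_graph_def edges_weight_empty)
  also have "\<dots> = (1 + lam) ^ n * (1 - b) ^ length g"
    by (simp add: sum_Pow_power_card assms(1))
  finally show ?case using b lam by simp
next
  case (Suc i)
  let ?g = "pin i False g []" and ?\<delta> = "real D * (2 * C * \<rho> ^ L)"
  let ?r = "ratio b lam i L [] g" and ?R = "R i [] g"
  have g: "wf_graph V D g"
    using Suc.prems wf_edges_mono[of "{..<Suc i}" g V] by (auto simp: wf_graph_def assms(1))
  have i: "i \<in> V" using Suc.prems by (simp add: assms(1))
  note r = ratio_ok_graph[OF ratio_ok[of L] i g]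
  have R: "0 < ?R" using R_bounds by blast
  have IH: "0 < zloop b lam L i ?g"
    "\<bar>ln (zloop b lam L i ?g) - ln (Zg b lam V ?g / (1 + lam) ^ (n - i))\<bar> \<le> real i * ?\<delta>"
    using Suc.IH[of ?g] Suc.prems wf_graph_pin_lessThan zero_flagged_pin[of g "[]" i]
    by (auto simp: zero_flagged_def)
  have "(1 + lam) * Zg b lam V g = Zg b lam V ?g * (1 + ?R)"
    using Zg_split[OF V i, of lam b g] Zg_pos'[of ?g]
    by (simp add: true_ratio_def distrib_left)
  moreover have "n - i = Suc (n - Suc i)" using Suc.prems by simp
  moreover have "Zg b lam V g / (1 + lam) ^ (n - Suc i)
      = ((1 + lam) * Zg b lam V g) / ((1 + lam) * (1 + lam) ^ (n - Suc i))"
    using lam by (subst mult_divide_mult_cancel_left) auto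
  ultimately have "Zg b lam V g / (1 + lam) ^ (n - Suc i) = (1 + ?R) * (Zg b lam V ?g / (1 + lam) ^ (n - i))"
    by simp
  then have "ln (Zg b lam V g / (1 + lam) ^ (n - Suc i)) = ln (1 + ?R) + ln (Zg b lam V ?g / (1 + lam) ^ (n - i))"
    using R Zg_pos'[of ?g] lam by (simp only:) (intro ln_mult_pos; simp)
  moreover have "ln (zloop b lam L (Suc i) g) = ln (1 + ?r) + ln (zloop b lam L i ?g)"
    using r IH by (simp add: ln_mult_pos)
  moreover have "\<bar>ln (1 + ?r) - ln (1 + ?R)\<bar> \<le> ?\<delta>"
    using abs_ln_one_plus_diff_le[OF r(1) R] r(4) by linarith
  moreover have "real (Suc i) * ?\<delta> = ?\<delta> + real i * ?\<delta>" by (simp add: algebra_simps)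
  moreover have "0 < zloop b lam L (Suc i) g" using r IH by simp
  ultimately show ?case using IH by (simp only:) (intro conjI TrueI; linarith)
qed

section \<open>Sensitivity of the partition function to its parameters\<close>

lemma Zg_perturb_le:
  fixes \<eta> \<theta> :: real
  assumes "b < 1" "b' < 1" "0 < lam" "0 < lam'" "finite V" "0 \<le> \<eta>" "0 \<le> \<theta>"
    and "1 - b \<le> exp \<eta> * (1 - b')" "lam \<le> exp \<theta> * lam'"
  shows "Zg b lam V g \<le> exp (length g * \<eta> + card V * \<theta>) * Zg b' lam' V g"
proof -
  have ew: "edges_weight b g S \<le> exp (length g * \<eta>) * edges_weight b' g S" for S
  proof (induction g)
    case (Cons e g)
    have "edge_factor b e S \<le> exp \<eta> * edge_factor b' e S"
      using assms by (auto simp: edge_factor_def split: prod.splits)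
    from mult_mono[OF this Cons] show ?case
      using edge_factor_pos[OF assms(2), of e S] edges_weight_pos[OF assms(1), of g S]
      by (simp add: algebra_simps exp_add)
  qed simp
  have lc: "lam ^ card S \<le> exp (card V * \<theta>) * lam' ^ card S" if "S \<subseteq> V" for S
  proof -
    have "lam ^ card S \<le> (exp \<theta> * lam') ^ card S" using assms by (intro power_mono) auto
    also have "\<dots> = exp (card S * \<theta>) * lam' ^ card S"
      by (simp add: power_mult_distrib exp_of_nat_mult)
    also have "\<dots> \<le> exp (card V * \<theta>) * lam' ^ card S"
      using assms that by (auto intro!: mult_right_mono card_mono)
    finally show ?thesis .
  qed
  have "lam ^ card S * edges_weight b g S
      \<le> exp (length g * \<eta> + card V * \<theta>) * (lam' ^ card S * edges_weight b' g S)" if "S \<subseteq> V" for S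
    using mult_mono[OF lc[OF that] ew[of S]] assms edges_weight_pos[OF assms(1), of g S]
    by (simp add: exp_add algebra_simps)
  then show ?thesis
    unfolding Zc_def sum_distrib_left by (intro sum_mono) auto
qed

text \<open>Every weight is a monomial in \<open>1 - b\<close> and \<open>lam\<close> with exponents
  at most \<open>length g\<close> and \<open>card V\<close>; comparing term by term in both
  directions gives the bound.\<close>

lemma Zg_perturb:
  fixes \<eta> \<theta> :: real
  assumes "b < 1" "b' < 1" "0 < lam" "0 < lam'" "finite V"
    and "\<bar>ln (1 - b) - ln (1 - b')\<bar> \<le> \<eta>" "\<bar>ln lam - ln lam'\<bar> \<le> \<theta>"
  shows "\<bar>ln (Zg b lam V g) - ln (Zg b' lam' V g)\<bar> \<le> length g * \<eta> + card V * \<theta>"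
proof -
  have *: "x \<le> exp \<eta> * y" if "ln x - ln y \<le> \<eta>" "0 < x" "0 < y" for x y \<eta> :: real
  proof -
    have "x = exp (ln x - ln y) * y" using that by (simp add: exp_diff)
    also have "\<dots> \<le> exp \<eta> * y" using that by (intro mult_right_mono) auto
    finally show ?thesis .
  qed
  have pos: "0 < Zg b lam V g" "0 < Zg b' lam' V g" using assms by (auto intro!: Zg_pos)
  have ln_le: "ln x - ln y \<le> t" if "x \<le> exp t * y" "0 < x" "0 < y" for x y t :: real
  proof -
    have "ln x \<le> ln (exp t * y)" using that by simp
    then show ?thesis using that by (simp add: ln_mult_pos)
  qed
  have nn: "0 \<le> \<eta>" "0 \<le> \<theta>" using assms(6,7) by linarith+
  let ?t = "length g * \<eta> + card V * \<theta>"
  have "Zg b lam V g \<le> exp ?t * Zg b' lam' V g"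
    by (rule Zg_perturb_le[OF assms(1-5) nn]; rule *; use assms in linarith)
  moreover have "Zg b' lam' V g \<le> exp ?t * Zg b lam V g"
    by (rule Zg_perturb_le[OF assms(2,1,4,3,5) nn]; rule *; use assms in linarith)
  ultimately show ?thesis
    using ln_le[OF _ pos, of ?t] ln_le[OF _ pos(2,1), of ?t] by linarith
qed

section \<open>Encoded hypergraphs as edge lists\<close>

definition init_edges :: "nat list list \<Rightarrow> edge list" where
  "init_edges es = map (\<lambda>us. (True, True, us)) es"

text \<open>Configurations correspond to the sets of indices with value 1. As no edge is listed
  twice, the product over the set of edges becomes one over the list. The empty edge is
  monochromatic on both sides.\<close>

lemma partition_function_eq_Zg:
  fixes vs :: "'a list"
  assumes vs: "distinct vs" "set vs = fst G"
    and es: "\<forall>e\<in>set es. distinct e \<and> set e \<subseteq> {..<length vs}" "distinct (map set es)"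
    and G: "snd G = (\<lambda>e. (!) vs ` set e) ` set es"
  shows "partition_function \<beta> lam G = Zg (1 - \<beta>) lam {..<length vs} (init_edges es)"
proof -
  let ?n = "length vs"
  have des: "distinct es" using es(2) by (simp add: distinct_map)
  have inj: "inj_on ((!) vs) {..<?n}" using vs(1) by (simp add: inj_on_nth)
  have im: "(!) vs ` {..<?n} = fst G" using vs(2) by (auto simp: set_conv_nth)
  define conf where "conf S = (\<lambda>x\<in>fst G. if x \<in> (!) vs ` S then 1 else 0 :: nat)" for S
  have conf_nth: "conf S (vs ! i) = (if i \<in> S then 1 else 0)" if "i < ?n" "S \<subseteq> {..<?n}" for i S
  proof -
    have "vs ! i \<in> fst G" using that vs(2) by auto
    moreover have "vs ! i \<in> (!) vs ` S \<longleftrightarrow> i \<in> S"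
      using inj_on_image_mem_iff[OF inj] that by auto
    ultimately show ?thesis by (simp add: conf_def)
  qed
  have edge: "edge_weight \<beta> ((!) vs ` set e) (conf S) = edge_factor (1 - \<beta>) (True, True, e) S"
    if "e \<in> set es" "S \<subseteq> {..<?n}" for e S
  proof -
    have "conf S (vs ! i) = (if i \<in> S then 1 else 0)" if "i \<in> set e" for i
      using conf_nth \<open>e \<in> set es\<close> \<open>S \<subseteq> {..<?n}\<close> es(1) that by blast
    then have "(\<forall>v\<in>(!) vs ` set e. conf S v = 0) \<longleftrightarrow> set e \<inter> S = {}"
      "(\<forall>v\<in>(!) vs ` set e. conf S v = 1) \<longleftrightarrow> set e \<subseteq> S"
      by (auto split: if_splits)
    then show ?thesis by (simp add: edge_weight_def edge_factor_def)
  qed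
  have weight: "config_weight \<beta> lam G (conf S) = lam ^ card S * edges_weight (1 - \<beta>) (init_edges es) S"
    if S: "S \<in> Pow {..<?n}" for S
  proof -
    have "inj_on (image ((!) vs)) (set ` set es)"
      by (rule inj_on_subset[OF inj_on_image_Pow[OF inj]]) (use es(1) in auto)
    then have inj2: "inj_on (\<lambda>e. (!) vs ` set e) (set es)"
      using es(2) by (auto simp: distinct_map inj_on_def)
    have "(\<Prod>e\<in>snd G. edge_weight \<beta> e (conf S))
        = (\<Prod>e\<in>set es. edge_weight \<beta> ((!) vs ` set e) (conf S))"
      unfolding G by (simp add: prod.reindex[OF inj2])
    also have "\<dots> = (\<Prod>e\<in>set es. edge_factor (1 - \<beta>) (True, True, e) S)"
      using edge S by (intro prod.cong) auto
    also have "\<dots> = edges_weight (1 - \<beta>) (init_edges es) S"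
      using des
      by (simp add: edges_weight_def init_edges_def prod.distinct_set_conv_list comp_def)
    finally have 1: "(\<Prod>e\<in>snd G. edge_weight \<beta> e (conf S)) = edges_weight (1 - \<beta>) (init_edges es) S" .
    have "(\<Prod>v\<in>fst G. vertex_weight lam v (conf S)) = (\<Prod>i<?n. vertex_weight lam (vs ! i) (conf S))"
      unfolding im[symmetric] by (simp add: prod.reindex[OF inj])
    also have "\<dots> = (\<Prod>i<?n. if i \<in> S then lam else 1)"
      using conf_nth S by (intro prod.cong) (auto simp: vertex_weight_def)
    also have "\<dots> = lam ^ card S"
      using S by (simp add: prod.If_cases Int_absorb1)
    finally show ?thesis by (simp add: config_weight_def 1)
  qed
  have bij: "bij_betw conf (Pow {..<?n}) (configs G)"
  proof (rule bij_betw_byWitness[where f' = "\<lambda>\<sigma>. {i. i < ?n \<and> \<sigma> (vs ! i) = 1}"])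
    show "\<forall>S\<in>Pow {..<?n}. {i. i < ?n \<and> conf S (vs ! i) = 1} = S"
    proof (intro ballI set_eqI)
      fix S i assume "S \<in> Pow {..<?n}"
      then show "i \<in> {i. i < ?n \<and> conf S (vs ! i) = 1} \<longleftrightarrow> i \<in> S"
        using conf_nth[of i S] by (cases "i < ?n") auto
    qed
    show "\<forall>\<sigma>\<in>configs G. conf {i. i < ?n \<and> \<sigma> (vs ! i) = 1} = \<sigma>"
    proof
      fix \<sigma> assume "\<sigma> \<in> configs G"
      then have \<sigma>: "\<sigma> \<in> extensional (fst G)" "\<And>x. x \<in> fst G \<Longrightarrow> \<sigma> x = 0 \<or> \<sigma> x = 1"
        by (auto simp: configs_def PiE_def)
      show "conf {i. i < ?n \<and> \<sigma> (vs ! i) = 1} = \<sigma>"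
      proof
        fix x
        show "conf {i. i < ?n \<and> \<sigma> (vs ! i) = 1} x = \<sigma> x"
        proof (cases "x \<in> fst G")
          case True
          then obtain i where i: "i < ?n" "x = vs ! i" using im by auto
          have "conf {i. i < ?n \<and> \<sigma> (vs ! i) = 1} x = (if \<sigma> x = 1 then 1 else 0)"
            unfolding i(2) by (subst conf_nth) (use i in auto)
          then show ?thesis using \<sigma>(2)[OF True] by auto
        next
          case False
          then show ?thesis using \<sigma>(1) by (simp add: conf_def extensional_def)
        qed
      qed
    qed
    show "conf ` Pow {..<?n} \<subseteq> configs G" by (auto simp: configs_def conf_def split: if_splits)
  qed auto
  have "partition_function \<beta> lam G = (\<Sum>S\<in>Pow {..<?n}. config_weight \<beta> lam G (conf S))"
    unfolding partition_function_def by (rule sum.reindex_bij_betw[OF bij, symmetric])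
  also have "\<dots> = (\<Sum>S\<in>Pow {..<?n}. lam ^ card S * edges_weight (1 - \<beta>) (init_edges es) S)"
    using weight by (intro sum.cong) auto
  finally show ?thesis by (simp add: Zc_def)
qed

text \<open>Charge each nonempty edge to its first vertex.\<close>

lemma length_le_sum_deg:
  assumes "wf_edges {..<n} g"
  shows "length (filter (\<lambda>(f0, f1, us). us \<noteq> []) g) \<le> (\<Sum>u<n. deg u g)"
  using assms
proof (induction g)
  case (Cons e g)
  obtain f0 f1 us where e: "e = (f0, f1, us)" by (cases e)
  have IH: "length (filter (\<lambda>(f0, f1, us). us \<noteq> []) g) \<le> (\<Sum>u<n. deg u g)"
    using Cons by (simp add: e)
  show ?case
  proof (cases us)
    case Nil
    then show ?thesis using IH by (simp add: e)
  next
    case (Cons w ws)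
    have "(\<Sum>u<n. deg u g) + 1 = (\<Sum>u<n. deg u g + (if u = w then 1 else 0))"
      using \<open>wf_edges {..<n} (e # g)\<close> Cons by (simp add: sum.distrib e)
    also have "\<dots> \<le> (\<Sum>u<n. deg u (e # g))"
      using Cons by (intro sum_mono) (auto simp: e)
    finally show ?thesis using IH Cons by (simp add: e)
  qed
qed simp

text \<open>Degrees control only the nonempty edges. The empty edge contains no vertex but is listed
  at most once, hence the \<open>+ 1\<close>.\<close>

lemma encoded_graph:
  fixes vs :: "'a list"
  assumes vs: "distinct vs" "set vs = fst G"
    and es: "\<forall>e\<in>set es. distinct e \<and> set e \<subseteq> {..<length vs}" "distinct (map set es)"
    and G: "snd G = (\<lambda>e. (!) vs ` set e) ` set es"
    and D: "G \<in> bounded_degree_hypergraphs D"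
  shows "wf_graph {..<length vs} D (init_edges es)" "zero_flagged (init_edges es)"
    "length es \<le> D * length vs + 1"
proof -
  let ?n = "length vs"
  have des: "distinct es" using es(2) by (simp add: distinct_map)
  have inj: "inj_on ((!) vs) {..<?n}" using vs(1) by (simp add: inj_on_nth)
  have wf: "wf_edges {..<?n} (init_edges es)"
    using es(1) by (auto simp: wf_edges_def init_edges_def)
  have deg: "deg u (init_edges es) \<le> D" for u
  proof (cases "u < ?n")
    case True
    have "deg u (init_edges es) = card {e \<in> set es. u \<in> set e}"
      using des unfolding deg_def init_edges_def
      by (simp add: filter_map comp_def distinct_card[symmetric])
    also have "\<dots> = card ((\<lambda>e. (!) vs ` set e) ` {e \<in> set es. u \<in> set e})"
    proof (rule card_image[symmetric], rule inj_onI)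
      fix d e assume de: "d \<in> {e \<in> set es. u \<in> set e}" "e \<in> {e \<in> set es. u \<in> set e}"
        and "(!) vs ` set d = (!) vs ` set e"
      then have "set d = set e"
        using inj_on_image_eq_iff[OF inj, of "set d" "set e"] es(1) by auto
      then show "d = e" using es(2) de by (auto simp: distinct_map inj_on_def)
    qed
    also have "\<dots> \<le> card {e \<in> snd G. vs ! u \<in> e}"
      using G by (intro card_mono) auto
    also have "\<dots> \<le> D"
      using D True vs(2) by (auto simp: bounded_degree_hypergraphs_def vertex_degree_def)
    finally show ?thesis .
  next
    case False
    then have "deg u (init_edges es) = 0"
      using es(1) by (auto simp: deg_def init_edges_def filter_empty_conv)
    then show ?thesis by simp
  qed
  show "wf_graph {..<?n} D (init_edges es)" using wf deg by (simp add: wf_graph_def)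
  show "zero_flagged (init_edges es)" by (auto simp: zero_flagged_def init_edges_def)
  have "length (filter (\<lambda>us. us \<noteq> []) es) \<le> (\<Sum>u<?n. deg u (init_edges es))"
    using length_le_sum_deg[OF wf] by (simp add: init_edges_def filter_map comp_def)
  also have "\<dots> \<le> D * ?n" using sum_bounded_above[of "{..<?n}" "\<lambda>u. deg u (init_edges es)" D] deg by (simp add: mult.commute)
  finally have "length (filter (\<lambda>us. us \<noteq> []) es) \<le> D * ?n" .
  moreover have "length (filter (\<lambda>us. \<not> us \<noteq> []) es) \<le> 1"
  proof -
    have "length (filter (\<lambda>us. \<not> us \<noteq> []) es) = card (set (filter (\<lambda>us. \<not> us \<noteq> []) es))"
      using des by (simp add: distinct_card del: set_filter)
    also have "\<dots> \<le> card {[] :: nat list}" by (intro card_mono) auto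
    finally show ?thesis by simp
  qed
  ultimately show "length es \<le> D * ?n + 1"
    using sum_length_filter_compl[of "\<lambda>us. us \<noteq> []" es] by linarith
qed

section \<open>Costs of evaluation\<close>

text \<open>
  In contrast to \<open>rat_size\<close>, this need not refer to the reduced fraction, so it is additive under
  the field operations.
\<close>

definition hb :: "rat \<Rightarrow> nat \<Rightarrow> bool" where
  "hb q h \<longleftrightarrow> (\<exists>a b. q = of_int a / of_int b \<and> 0 < b \<and> \<bar>a\<bar> \<le> 2 ^ h \<and> b \<le> 2 ^ h)"

lemma hb_mono:
  assumes "hb q h" "h \<le> h'"
  shows "hb q h'"
proof -
  have "(2::int) ^ h \<le> 2 ^ h'" using assms by (simp add: power_increasing)
  moreover obtain a b where "q = of_int a / of_int b" "0 < b" "\<bar>a\<bar> \<le> 2 ^ h" "b \<le> 2 ^ h"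
    using assms(1) by (auto simp: hb_def)
  ultimately show ?thesis unfolding hb_def
    by - (rule exI[of _ a], rule exI[of _ b], intro conjI; linarith)
qed

lemma hb_int: "\<bar>z\<bar> \<le> 2 ^ h \<Longrightarrow> hb (of_int z) h"
  unfolding hb_def by (intro exI[of _ z] exI[of _ 1]) auto

lemma hb_0 [simp]: "hb 0 h" and hb_1 [simp]: "hb 1 h"
  using hb_int[of 0 h] hb_int[of 1 h] by auto

lemma hb_of_bool [simp]: "hb (of_bool c) h"
  by (cases c) auto

lemma hb_mult:
  assumes "hb p h" "hb q h'"
  shows "hb (p * q) (h + h')"
proof -
  obtain a b where p: "p = of_int a / of_int b" "0 < b" "\<bar>a\<bar> \<le> 2 ^ h" "b \<le> 2 ^ h"
    using assms(1) by (auto simp: hb_def)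
  obtain c d where q: "q = of_int c / of_int d" "0 < d" "\<bar>c\<bar> \<le> 2 ^ h'" "d \<le> 2 ^ h'"
    using assms(2) by (auto simp: hb_def)
  have "\<bar>a * c\<bar> \<le> 2 ^ (h + h')" unfolding abs_mult power_add using p q by (intro mult_mono) auto
  moreover have "b * d \<le> 2 ^ (h + h')" unfolding power_add using p q by (intro mult_mono) auto
  ultimately show ?thesis unfolding hb_def using p q
    by (intro exI[of _ "a * c"] exI[of _ "b * d"]) auto
qed

lemma hb_add:
  assumes "hb p h" "hb q h'"
  shows "hb (p + q) (h + h' + 1)"
proof -
  obtain a b where p: "p = of_int a / of_int b" "0 < b" "\<bar>a\<bar> \<le> 2 ^ h" "b \<le> 2 ^ h"
    using assms(1) by (auto simp: hb_def)
  obtain c d where q: "q = of_int c / of_int d" "0 < d" "\<bar>c\<bar> \<le> 2 ^ h'" "d \<le> 2 ^ h'"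
    using assms(2) by (auto simp: hb_def)
  have "\<bar>a * d\<bar> \<le> 2 ^ h * 2 ^ h'" "\<bar>c * b\<bar> \<le> 2 ^ h' * 2 ^ h"
    unfolding abs_mult using p q by (auto intro!: mult_mono)
  then have "\<bar>a * d + c * b\<bar> \<le> 2 ^ (h + h' + 1)"
    using abs_triangle_ineq[of "a * d" "c * b"] by (simp add: power_add mult.commute)
  moreover have "b * d \<le> 2 ^ (h + h' + 1)"
  proof -
    have "b * d \<le> 2 ^ h * 2 ^ h'" using p q by (intro mult_mono) auto
    also have "\<dots> \<le> 2 ^ (h + h' + 1)" by (simp add: power_add)
    finally show ?thesis .
  qed
  moreover have "p + q = of_int (a * d + c * b) / of_int (b * d)" using p q by (simp add: field_simps)
  ultimately show ?thesis unfolding hb_def using p q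
    by (intro exI[of _ "a * d + c * b"] exI[of _ "b * d"]) auto
qed

lemma hb_uminus: "hb q h \<Longrightarrow> hb (- q) h"
  unfolding hb_def by (metis abs_minus_cancel minus_divide_left of_int_minus)

lemma hb_diff: "hb p h \<Longrightarrow> hb q h' \<Longrightarrow> hb (p - q) (h + h' + 1)"
  using hb_add[of p h "- q" h'] hb_uminus by simp

lemma hb_inverse:
  assumes "hb q h"
  shows "hb (inverse q) h"
proof -
  obtain a b where q: "q = of_int a / of_int b" "0 < b" "\<bar>a\<bar> \<le> 2 ^ h" "b \<le> 2 ^ h"
    using assms by (auto simp: hb_def)
  consider "a = 0" | "a > 0" | "a < 0" by linarith
  then show ?thesis
  proof cases
    case 1 then show ?thesis using q by simp
  next
    case 2 then show ?thesis unfolding hb_def using q by (intro exI[of _ b] exI[of _ a]) auto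
  next
    case 3 then show ?thesis unfolding hb_def using q by (intro exI[of _ "- b"] exI[of _ "- a"]) auto
  qed
qed

lemma hb_divide: "hb p h \<Longrightarrow> hb q h' \<Longrightarrow> hb (p / q) (h + h')"
  using hb_mult[of p h "inverse q" h'] hb_inverse by (simp add: divide_inverse)

lemma floorlog_le: "x \<le> 2 ^ h \<Longrightarrow> floorlog 2 x \<le> Suc h"
  by (rule floorlog_leI) (auto intro: le_less_trans[of _ "2 ^ h"])

text \<open>Numerator and denominator of the reduced fraction divide those of any other
  representation, so each has at most \<open>h + 1\<close> bits.\<close>

lemma rat_size_le:
  assumes "hb q h"
  shows "rat_size q \<le> 2 * h + 2"
proof -
  obtain a b where q: "q = of_int a / of_int b" "0 < b" "\<bar>a\<bar> \<le> 2 ^ h" "b \<le> 2 ^ h"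
    using assms by (auto simp: hb_def)
  obtain a' b' where qo: "quotient_of q = (a', b')" by (cases "quotient_of q")
  have cop: "coprime a' b'" "0 < b'" "q = of_int a' / of_int b'"
    using quotient_of_coprime[OF qo] quotient_of_denom_pos[OF qo] quotient_of_div[OF qo] by auto
  have "(of_int (a * b') :: rat) = of_int (a' * b)"
    using q cop by (simp add: field_simps)
  then have eq: "a * b' = a' * b" by (simp only: of_int_eq_iff)
  have "b' dvd b" using cop eq by (metis coprime_commute coprime_dvd_mult_right_iff dvd_triv_right)
  then have b': "b' \<le> 2 ^ h" using q zdvd_imp_le[of b' b] by linarith
  have "a' dvd a" using cop eq by (metis coprime_dvd_mult_left_iff dvd_triv_left)
  then have a': "\<bar>a'\<bar> \<le> 2 ^ h"
    using q dvd_imp_le_int[of a a'] eq by (cases "a = 0") auto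
  have "nat \<bar>a'\<bar> \<le> 2 ^ h" "nat b' \<le> 2 ^ h"
    using a' b' by (simp_all add: nat_le_iff)
  then show ?thesis unfolding rat_size_def qo
    using floorlog_le[of "nat \<bar>a'\<bar>" h] floorlog_le[of "nat b'" h] by simp
qed

text \<open>
  If all numbers that occur have size at most \<open>s\<close>, every evaluation step costs at most \<open>1 + 2 s\<close>.
  Hence it suffices to count steps.
\<close>

definition eval_in :: "(nat \<Rightarrow> nat \<Rightarrow> int) \<Rightarrow> prog \<Rightarrow> nat \<Rightarrow> val list \<Rightarrow> expr \<Rightarrow> val \<Rightarrow> nat \<Rightarrow> bool" where
  "eval_in a P s env e v n \<longleftrightarrow> (\<exists>t. eval a P env e v t \<and> t \<le> n * (1 + 2 * s))"

definition calls :: "(nat \<Rightarrow> nat \<Rightarrow> int) \<Rightarrow> prog \<Rightarrow> nat \<Rightarrow> nat \<Rightarrow> val list \<Rightarrow> (val \<Rightarrow> nat \<Rightarrow> bool) \<Rightarrow> bool" where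
  "calls a P s i vs K \<longleftrightarrow> i < length P \<and> (\<exists>r n. eval_in a P s vs (P ! i) r n \<and> K r n)"

text \<open>
  A weakest precondition: \<open>c\<close> is the number of steps already spent, and the continuation \<open>K\<close>
  receives the value together with the new number of steps. Function calls are left to
  \<open>calls\<close>, so that they can be discharged by induction hypotheses.
\<close>

fun wp :: "(nat \<Rightarrow> nat \<Rightarrow> int) \<Rightarrow> prog \<Rightarrow> nat \<Rightarrow> expr \<Rightarrow> val list \<Rightarrow> nat \<Rightarrow> (val \<Rightarrow> nat \<Rightarrow> bool) \<Rightarrow> bool"
  and wps :: "(nat \<Rightarrow> nat \<Rightarrow> int) \<Rightarrow> prog \<Rightarrow> nat \<Rightarrow> expr list \<Rightarrow> val list \<Rightarrow> nat \<Rightarrow> (val list \<Rightarrow> nat \<Rightarrow> bool) \<Rightarrow> bool"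
where
  "wp a P s (Var i) env c K = (i < length env \<and> K (env ! i) (Suc c))"
| "wp a P s (Lit q) env c K = (rat_size q \<le> s \<and> K (NumV q) (Suc c))"
| "wp a P s (Op f e1 e2) env c K =
     wp a P s e1 env c (\<lambda>v1 c1. wp a P s e2 env c1 (\<lambda>v2 c2.
       case v1 of PairV _ _ \<Rightarrow> False | NumV p \<Rightarrow>
         (case v2 of PairV _ _ \<Rightarrow> False | NumV q \<Rightarrow>
           rat_size p \<le> s \<and> rat_size q \<le> s \<and> K (NumV (apply_binop f p q)) (Suc c2))))"
| "wp a P s (Floor e) env c K = False"
| "wp a P s (Approx i e) env c K =
     wp a P s e env c (\<lambda>v c1. case v of PairV _ _ \<Rightarrow> False | NumV q \<Rightarrow>
       (\<exists>k. q = of_nat k \<and> k \<le> s \<and> K (NumV (of_int (a i k) / 2 ^ k)) (Suc c1)))"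
| "wp a P s (MkPair e1 e2) env c K =
     wp a P s e1 env c (\<lambda>v1 c1. wp a P s e2 env c1 (\<lambda>v2 c2. K (PairV v1 v2) (Suc c2)))"
| "wp a P s (Fst e) env c K =
     wp a P s e env c (\<lambda>v c1. case v of PairV x y \<Rightarrow> K x (Suc c1) | NumV _ \<Rightarrow> False)"
| "wp a P s (Snd e) env c K =
     wp a P s e env c (\<lambda>v c1. case v of PairV x y \<Rightarrow> K y (Suc c1) | NumV _ \<Rightarrow> False)"
| "wp a P s (LetIn e1 e2) env c K =
     wp a P s e1 env c (\<lambda>v c1. wp a P s e2 (v # env) (Suc c1) K)"
| "wp a P s (IfLess e1 e2 e3 e4) env c K =
     wp a P s e1 env c (\<lambda>v1 c1. wp a P s e2 env c1 (\<lambda>v2 c2.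
       case v1 of PairV _ _ \<Rightarrow> False | NumV p \<Rightarrow>
         (case v2 of PairV _ _ \<Rightarrow> False | NumV q \<Rightarrow>
           rat_size p \<le> s \<and> rat_size q \<le> s \<and>
           (if p < q then wp a P s e3 env (Suc c2) K else wp a P s e4 env (Suc c2) K))))"
| "wp a P s (IfPair e1 e2 e3) env c K =
     wp a P s e1 env c (\<lambda>v c1. case v of PairV _ _ \<Rightarrow> wp a P s e2 env (Suc c1) K
       | NumV _ \<Rightarrow> wp a P s e3 env (Suc c1) K)"
| "wp a P s (Call i es) env c K =
     wps a P s es env c (\<lambda>vs c1. calls a P s i vs (\<lambda>r n. K r (Suc (c1 + n))))"
| "wps a P s [] env c K = K [] c"
| "wps a P s (e # es) env c K =
     wp a P s e env c (\<lambda>v c1. wps a P s es env c1 (\<lambda>vs c2. K (v # vs) (Suc c2)))"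

definition sound :: "(nat \<Rightarrow> nat \<Rightarrow> int) \<Rightarrow> prog \<Rightarrow> nat \<Rightarrow> expr \<Rightarrow> bool" where
  "sound a P s e \<longleftrightarrow> (\<forall>env c K. wp a P s e env c K \<longrightarrow>
     (\<exists>v t n. eval a P env e v t \<and> t \<le> n * (1 + 2 * s) \<and> K v (c + n)))"

lemma soundI:
  "(\<And>env c K. wp a P s e env c K \<Longrightarrow> \<exists>v t n. eval a P env e v t \<and> t \<le> n * (1 + 2 * s) \<and> K v (c + n))
   \<Longrightarrow> sound a P s e"
  by (simp add: sound_def)

lemma soundD:
  assumes "sound a P s e" "wp a P s e env c K"
  obtains v t n where "eval a P env e v t" "t \<le> n * (1 + 2 * s)" "K v (c + n)"
  using assms unfolding sound_def by blast

lemma wps_sound: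
  "(\<And>e. e \<in> set es \<Longrightarrow> sound a P s e) \<Longrightarrow> wps a P s es env c L \<Longrightarrow>
   \<exists>vs t n. evals a P env es vs t \<and> t \<le> n * (1 + 2 * s) \<and> L vs (c + n)"
proof (induction es arbitrary: c L)
  case Nil
  then show ?case
    by (intro exI[of _ "[]"] exI[of _ 0]) (auto intro: eval_evals.intros)
next
  case (Cons e es)
  from Cons.prems(2) have "wp a P s e env c (\<lambda>v c1. wps a P s es env c1 (\<lambda>vs c2. L (v # vs) (Suc c2)))"
    by simp
  then obtain v t n where v: "eval a P env e v t" "t \<le> n * (1 + 2 * s)"
    "wps a P s es env (c + n) (\<lambda>vs c2. L (v # vs) (Suc c2))"
    by (rule soundD[OF Cons.prems(1)[OF list.set_intros(1)]])
  obtain vs t' n' where vs: "evals a P env es vs t'" "t' \<le> n' * (1 + 2 * s)" "L (v # vs) (Suc (c + n + n'))"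
    using Cons.IH[OF _ v(3)] Cons.prems(1) by auto
  have "t + t' + 1 \<le> (n + n' + 1) * (1 + 2 * s)" using v vs by (simp add: algebra_simps)
  then show ?case using eval_evals.evals_Cons[OF v(1) vs(1)] vs(3)
    by (intro exI[of _ "v # vs"] exI[of _ "t + t' + 1"] exI[of _ "n + n' + 1"]) (simp add: add.assoc)
qed

text \<open>Structural induction on the expression suffices even for recursive programs: at a
  \<open>Call\<close>, \<open>calls\<close> already supplies the evaluation of the body. An
  operation touches at most two numbers of size at most \<open>s\<close>, so its own charge fits
  into \<open>1 + 2 * s\<close>.\<close>

lemma wp_sound: "sound a P s e"
proof (induction e)
  case (Var i)
  show ?case
  proof (rule soundI)
    fix env c K assume "wp a P s (Var i) env c K"
    then show "\<exists>v t n. eval a P env (Var i) v t \<and> t \<le> n * (1 + 2 * s) \<and> K v (c + n)"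
      using eval_Var[of i env a P] by (intro exI[of _ "env ! i"] exI[of _ 1]) simp
  qed
next
  case (Lit q)
  show ?case
  proof (rule soundI)
    fix env c K assume "wp a P s (Lit q) env c K"
    then show "\<exists>v t n. eval a P env (Lit q) v t \<and> t \<le> n * (1 + 2 * s) \<and> K v (c + n)"
      using eval_Lit[of a P env q]
      by (intro exI[of _ "NumV q"] exI[of _ "1 + rat_size q"] exI[of _ 1]) simp
  qed
next
  case (Op f e1 e2)
  show ?case
  proof (rule soundI)
    fix env c K assume "wp a P s (Op f e1 e2) env c K"
    then obtain v1 t1 n1 v2 t2 n2 where
      e1: "eval a P env e1 v1 t1" "t1 \<le> n1 * (1 + 2 * s)" and
      e2: "eval a P env e2 v2 t2" "t2 \<le> n2 * (1 + 2 * s)" and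
      K: "case v1 of PairV _ _ \<Rightarrow> False | NumV p \<Rightarrow> (case v2 of PairV _ _ \<Rightarrow> False | NumV q \<Rightarrow>
           rat_size p \<le> s \<and> rat_size q \<le> s \<and> K (NumV (apply_binop f p q)) (Suc (c + n1 + n2)))"
      unfolding wp.simps by (elim soundD[OF Op(1)] soundD[OF Op(2)])
    from K obtain p q where v: "v1 = NumV p" "v2 = NumV q" "rat_size p \<le> s" "rat_size q \<le> s"
      "K (NumV (apply_binop f p q)) (Suc (c + n1 + n2))" by (auto split: val.splits)
    have "t1 + t2 + 1 + rat_size p + rat_size q \<le> (n1 + n2 + 1) * (1 + 2 * s)"
      using e1 e2 v by (simp add: algebra_simps)
    then show "\<exists>v t n. eval a P env (Op f e1 e2) v t \<and> t \<le> n * (1 + 2 * s) \<and> K v (c + n)"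
      using eval_Op[of a P env e1 p t1 e2 q t2 f] e1 e2 v
      by (intro exI[of _ "NumV (apply_binop f p q)"] exI[of _ "t1 + t2 + 1 + rat_size p + rat_size q"]
          exI[of _ "n1 + n2 + 1"]) (simp add: add.assoc)
  qed
next
  case (Floor e)
  show ?case by (rule soundI) simp
next
  case (Approx i e)
  show ?case
  proof (rule soundI)
    fix env c K assume "wp a P s (Approx i e) env c K"
    then obtain v t n where e: "eval a P env e v t" "t \<le> n * (1 + 2 * s)" and
      K: "case v of PairV _ _ \<Rightarrow> False | NumV q \<Rightarrow>
       (\<exists>k. q = of_nat k \<and> k \<le> s \<and> K (NumV (of_int (a i k) / 2 ^ k)) (Suc (c + n)))"
      unfolding wp.simps by (elim soundD[OF Approx])
    from K obtain k where v: "v = NumV (of_nat k)" "k \<le> s" "K (NumV (of_int (a i k) / 2 ^ k)) (Suc (c + n))"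
      by (auto split: val.splits)
    have "t + 1 + k \<le> (n + 1) * (1 + 2 * s)" using e v by (simp add: algebra_simps)
    then show "\<exists>v t n. eval a P env (Approx i e) v t \<and> t \<le> n * (1 + 2 * s) \<and> K v (c + n)"
      using eval_Approx[of a P env e k t i] e v
      by (intro exI[of _ "NumV (of_int (a i k) / 2 ^ k)"] exI[of _ "t + 1 + k"] exI[of _ "n + 1"])
         (simp add: add.assoc)
  qed
next
  case (MkPair e1 e2)
  show ?case
  proof (rule soundI)
    fix env c K assume "wp a P s (MkPair e1 e2) env c K"
    then obtain v1 t1 n1 v2 t2 n2 where
      e1: "eval a P env e1 v1 t1" "t1 \<le> n1 * (1 + 2 * s)" and
      e2: "eval a P env e2 v2 t2" "t2 \<le> n2 * (1 + 2 * s)" and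
      K: "K (PairV v1 v2) (Suc (c + n1 + n2))"
      unfolding wp.simps by (elim soundD[OF MkPair(1)] soundD[OF MkPair(2)])
    have "t1 + t2 + 1 \<le> (n1 + n2 + 1) * (1 + 2 * s)" using e1 e2 by (simp add: algebra_simps)
    then show "\<exists>v t n. eval a P env (MkPair e1 e2) v t \<and> t \<le> n * (1 + 2 * s) \<and> K v (c + n)"
      using eval_MkPair[OF e1(1) e2(1)] K
      by (intro exI[of _ "PairV v1 v2"] exI[of _ "t1 + t2 + 1"] exI[of _ "n1 + n2 + 1"]) (simp add: add.assoc)
  qed
next
  case (Fst e)
  show ?case
  proof (rule soundI)
    fix env c K assume "wp a P s (Fst e) env c K"
    then obtain v t n where e: "eval a P env e v t" "t \<le> n * (1 + 2 * s)" and
      K: "case v of PairV x y \<Rightarrow> K x (Suc (c + n)) | NumV _ \<Rightarrow> False"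
      unfolding wp.simps by (elim soundD[OF Fst])
    from K obtain x y where v: "v = PairV x y" "K x (Suc (c + n))" by (auto split: val.splits)
    have "t + 1 \<le> (n + 1) * (1 + 2 * s)" using e by (simp add: algebra_simps)
    then show "\<exists>v t n. eval a P env (Fst e) v t \<and> t \<le> n * (1 + 2 * s) \<and> K v (c + n)"
      using eval_Fst[of a P env e x y t] e v
      by (intro exI[of _ x] exI[of _ "t + 1"] exI[of _ "n + 1"]) (simp add: add.assoc)
  qed
next
  case (Snd e)
  show ?case
  proof (rule soundI)
    fix env c K assume "wp a P s (Snd e) env c K"
    then obtain v t n where e: "eval a P env e v t" "t \<le> n * (1 + 2 * s)" and
      K: "case v of PairV x y \<Rightarrow> K y (Suc (c + n)) | NumV _ \<Rightarrow> False"
      unfolding wp.simps by (elim soundD[OF Snd])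
    from K obtain x y where v: "v = PairV x y" "K y (Suc (c + n))" by (auto split: val.splits)
    have "t + 1 \<le> (n + 1) * (1 + 2 * s)" using e by (simp add: algebra_simps)
    then show "\<exists>v t n. eval a P env (Snd e) v t \<and> t \<le> n * (1 + 2 * s) \<and> K v (c + n)"
      using eval_Snd[of a P env e x y t] e v
      by (intro exI[of _ y] exI[of _ "t + 1"] exI[of _ "n + 1"]) (simp add: add.assoc)
  qed
next
  case (LetIn e1 e2)
  show ?case
  proof (rule soundI)
    fix env c K assume "wp a P s (LetIn e1 e2) env c K"
    then obtain v1 t1 n1 v2 t2 n2 where
      e1: "eval a P env e1 v1 t1" "t1 \<le> n1 * (1 + 2 * s)" and
      e2: "eval a P (v1 # env) e2 v2 t2" "t2 \<le> n2 * (1 + 2 * s)" and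
      K: "K v2 (Suc (c + n1) + n2)"
      unfolding wp.simps by (elim soundD[OF LetIn(1)] soundD[OF LetIn(2)])
    have "t1 + t2 + 1 \<le> (n1 + n2 + 1) * (1 + 2 * s)" using e1 e2 by (simp add: algebra_simps)
    then show "\<exists>v t n. eval a P env (LetIn e1 e2) v t \<and> t \<le> n * (1 + 2 * s) \<and> K v (c + n)"
      using eval_LetIn[OF e1(1) e2(1)] K
      by (intro exI[of _ v2] exI[of _ "t1 + t2 + 1"] exI[of _ "n1 + n2 + 1"]) (simp add: add.assoc)
  qed
next
  case (IfLess e1 e2 e3 e4)
  show ?case
  proof (rule soundI)
    fix env c K assume "wp a P s (IfLess e1 e2 e3 e4) env c K"
    then obtain v1 t1 n1 v2 t2 n2 where
      e1: "eval a P env e1 v1 t1" "t1 \<le> n1 * (1 + 2 * s)" and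
      e2: "eval a P env e2 v2 t2" "t2 \<le> n2 * (1 + 2 * s)" and
      K: "case v1 of PairV _ _ \<Rightarrow> False | NumV p \<Rightarrow> (case v2 of PairV _ _ \<Rightarrow> False | NumV q \<Rightarrow>
           rat_size p \<le> s \<and> rat_size q \<le> s \<and>
           (if p < q then wp a P s e3 env (Suc (c + n1 + n2)) K else wp a P s e4 env (Suc (c + n1 + n2)) K))"
      unfolding wp.simps by (elim soundD[OF IfLess(1)] soundD[OF IfLess(2)])
    from K obtain p q where v: "v1 = NumV p" "v2 = NumV q" "rat_size p \<le> s" "rat_size q \<le> s"
      "wp a P s (if p < q then e3 else e4) env (Suc (c + n1 + n2)) K"
      by (auto split: val.splits if_splits)
    have "sound a P s (if p < q then e3 else e4)" using IfLess by simp
    then obtain v t n where e3: "eval a P env (if p < q then e3 else e4) v t" "t \<le> n * (1 + 2 * s)"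
      "K v (Suc (c + n1 + n2) + n)" by (rule soundD[OF _ v(5)])
    have "t1 + t2 + t + 1 + rat_size p + rat_size q \<le> (n1 + n2 + n + 1) * (1 + 2 * s)"
      using e1 e2 e3 v by (simp add: algebra_simps)
    then show "\<exists>v t n. eval a P env (IfLess e1 e2 e3 e4) v t \<and> t \<le> n * (1 + 2 * s) \<and> K v (c + n)"
      using eval_IfLess[of a P env e1 p t1 e2 q t2 e3 e4 v t] e1 e2 e3 v
      by (intro exI[of _ v] exI[of _ "t1 + t2 + t + 1 + rat_size p + rat_size q"]
          exI[of _ "n1 + n2 + n + 1"]) (simp add: add.assoc)
  qed
next
  case (IfPair e1 e2 e3)
  show ?case
  proof (rule soundI)
    fix env c K assume "wp a P s (IfPair e1 e2 e3) env c K"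
    then obtain u t1 n1 where e1: "eval a P env e1 u t1" "t1 \<le> n1 * (1 + 2 * s)" and
      K: "case u of PairV _ _ \<Rightarrow> wp a P s e2 env (Suc (c + n1)) K | NumV _ \<Rightarrow> wp a P s e3 env (Suc (c + n1)) K"
      unfolding wp.simps by (elim soundD[OF IfPair(1)])
    let ?e = "case u of PairV _ _ \<Rightarrow> e2 | NumV _ \<Rightarrow> e3"
    have "sound a P s ?e" "wp a P s ?e env (Suc (c + n1)) K" using K IfPair by (auto split: val.splits)
    then obtain v t n where e: "eval a P env ?e v t" "t \<le> n * (1 + 2 * s)" "K v (Suc (c + n1) + n)"
      by (rule soundD)
    have "t1 + t + 1 \<le> (n1 + n + 1) * (1 + 2 * s)" using e1 e by (simp add: algebra_simps)
    then show "\<exists>v t n. eval a P env (IfPair e1 e2 e3) v t \<and> t \<le> n * (1 + 2 * s) \<and> K v (c + n)"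
      using eval_IfPair[OF e1(1) e(1)] e(3)
      by (intro exI[of _ v] exI[of _ "t1 + t + 1"] exI[of _ "n1 + n + 1"]) (simp add: add.assoc)
  qed
next
  case (Call i es)
  show ?case
  proof (rule soundI)
    fix env c K assume "wp a P s (Call i es) env c K"
    then obtain vs t1 n1 where vs: "evals a P env es vs t1" "t1 \<le> n1 * (1 + 2 * s)"
      "calls a P s i vs (\<lambda>r n. K r (Suc (c + n1 + n)))"
      using wps_sound[OF Call] unfolding wp.simps by blast
    then obtain r n t where r: "i < length P" "eval a P vs (P ! i) r t" "t \<le> n * (1 + 2 * s)"
      "K r (Suc (c + n1 + n))"
      by (auto simp: calls_def eval_in_def)
    have "t1 + t + 1 \<le> (n1 + n + 1) * (1 + 2 * s)" using vs r by (simp add: algebra_simps)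
    then show "\<exists>v t n. eval a P env (Call i es) v t \<and> t \<le> n * (1 + 2 * s) \<and> K v (c + n)"
      using eval_Call[OF vs(1) r(1,2)] r(4)
      by (intro exI[of _ r] exI[of _ "t1 + t + 1"] exI[of _ "n1 + n + 1"]) (simp add: add.assoc)
  qed
qed

lemma eval_in_mono: "eval_in a P s env e r n \<Longrightarrow> n \<le> n' \<Longrightarrow> eval_in a P s env e r n'"
  unfolding eval_in_def by (meson mult_le_mono1 order_trans)

lemma eval_inI:
  assumes "wp a P s e env 0 (\<lambda>v c. v = r \<and> c \<le> n)"
  shows "eval_in a P s env e r n"
proof -
  obtain v t n' where *: "eval a P env e v t" "t \<le> n' * (1 + 2 * s)" "v = r \<and> 0 + n' \<le> n"
    by (rule soundD[OF wp_sound assms])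
  then have "eval_in a P s env e r n'" unfolding eval_in_def by blast
  then show ?thesis by (rule eval_in_mono) (use * in simp)
qed

lemma callsI: "eval_in a P s vs (P ! i) r n \<Longrightarrow> i < length P \<Longrightarrow> K r n \<Longrightarrow> calls a P s i vs K"
  unfolding calls_def by blast

section \<open>The program\<close>

text \<open>
  Equality of numbers is tested by comparing the square of their difference with 0.
\<close>

definition mem_body :: expr where
  "mem_body = IfPair (Var 1)
     (IfLess (Lit 0) (Op Times (Op Minus (Var 0) (Fst (Var 1))) (Op Minus (Var 0) (Fst (Var 1))))
       (Call 3 [Var 0, Snd (Var 1)]) (Lit 1))
     (Lit 0)"

definition rem_body :: expr where
  "rem_body = IfPair (Var 1)
     (IfLess (Lit 0) (Op Times (Op Minus (Var 0) (Fst (Var 1))) (Op Minus (Var 0) (Fst (Var 1))))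
       (MkPair (Fst (Var 1)) (Call 4 [Var 0, Snd (Var 1)])) (Call 4 [Var 0, Snd (Var 1)]))
     (Lit 0)"

definition len_body :: expr where
  "len_body = IfPair (Var 0) (Op Plus (Lit 1) (Call 5 [Snd (Var 0)])) (Lit 0)"

text \<open>Flags and pinned values are the numbers 0 and 1, so conjunction is a product and
  negation is \<open>1 - x\<close>.\<close>

definition pin1_body :: expr where
  "pin1_body = IfLess (Lit 0) (Call 3 [Var 0, Snd (Snd (Var 2))])
     (MkPair (Op Times (Fst (Var 2)) (Op Minus (Lit 1) (Var 1)))
       (MkPair (Op Times (Fst (Snd (Var 2))) (Var 1)) (Call 4 [Var 0, Snd (Snd (Var 2))])))
     (Var 2)"

definition pin_body :: expr where
  "pin_body = IfPair (Var 2)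
     (Call 7 [Var 0, Var 1, Snd (Var 2), MkPair (Call 6 [Var 0, Var 1, Fst (Var 2)]) (Var 3)])
     (Var 3)"

definition ratio_body :: expr where
  "ratio_body = IfPair (Var 5)
     (IfLess (Lit 0) (Call 3 [Var 2, Snd (Snd (Fst (Var 5)))])
       (LetIn (Call 4 [Var 2, Snd (Snd (Fst (Var 5)))])
         (Op Times
           (Call 9 [Var 1, Var 2, Var 4, Fst (Fst (Var 6)), Fst (Snd (Fst (Var 6))), Var 0,
             Call 7 [Var 3, Lit 1, Snd (Var 6), Var 5]])
           (Call 8 [Var 1, Var 2, Var 3, Var 4,
             MkPair (MkPair (Fst (Fst (Var 6))) (MkPair (Lit 0) (Var 0))) (Var 5), Snd (Var 6)])))
       (Call 8 [Var 0, Var 1, Var 2, Var 3, MkPair (Fst (Var 5)) (Var 4), Snd (Var 5)]))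
     (Var 1)"

definition fac_body :: expr where
  "fac_body = LetIn (Call 5 [Var 5])
     (IfLess (Var 3) (Var 0) (Lit 1)
       (Op Divide
         (Op Minus (Lit 1) (Op Times (Op Times (Var 1) (Var 5))
           (Call 10 [Var 1, Var 2, Lit 1, Var 6, Op Minus (Var 3) (Var 0), Var 7])))
         (Op Minus (Lit 1) (Op Times (Op Times (Var 1) (Var 4))
           (Call 10 [Var 1, Var 2, Lit 0, Var 6, Op Minus (Var 3) (Var 0), Var 7])))))"

definition allp_body :: expr where
  "allp_body = IfPair (Var 3)
     (LetIn (Call 8 [Var 0, Var 1, Fst (Var 3), Var 4, Lit 0, Var 5])
       (Op Times
         (Op Divide (IfLess (Lit 0) (Var 3) (Var 0) (Lit 1)) (Op Plus (Lit 1) (Var 0)))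
         (Call 10 [Var 1, Var 2, Var 3, Snd (Var 4), Var 5,
           Call 7 [Fst (Var 4), Var 3, Var 6, Lit 0]])))
     (Lit 1)"

definition loop_body :: expr where
  "loop_body = IfLess (Lit 0) (Var 3)
     (LetIn (Op Minus (Var 3) (Lit 1))
       (Op Times (Op Plus (Lit 1) (Call 8 [Var 1, Var 2, Var 0, Var 3, Lit 0, Var 5]))
         (Call 11 [Var 1, Var 2, Var 3, Var 0, Call 7 [Var 0, Lit 0, Var 5, Lit 0]])))
     (Call 12 [Var 0, Var 4])"

definition power_body :: expr where
  "power_body = IfPair (Var 1)
     (Op Times (Op Minus (Lit 1) (Var 0)) (Call 12 [Var 0, Snd (Var 1)])) (Lit 1)"

definition init_body :: expr where
  "init_body = IfPair (Var 0)
     (MkPair (MkPair (Lit 1) (MkPair (Lit 1) (Fst (Var 0)))) (Call 2 [Snd (Var 0)])) (Lit 0)"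

text \<open>
  Finds the least \<open>k\<close> for which the approximation of \<open>\<epsilon>\<close> guarantees \<open>(n + 1) / 2\<^sup>k < \<epsilon>\<close>; the
  third variable is \<open>2\<^sup>-\<^sup>k\<close>.
\<close>

definition search_body :: expr where
  "search_body = IfLess (Op Times (Op Plus (Var 0) (Lit 2)) (Var 2)) (Approx 0 (Var 1))
     (Var 1)
     (Call 1 [Var 0, Op Plus (Var 1) (Lit 1), Op Divide (Var 2) (Lit 2)])"

text \<open>From the search result \<open>K\<close>, logarithmic in \<open>n / \<epsilon>\<close>,
  come the depth budget \<open>cL * K + c0\<close> and the precision \<open>K + cP\<close> to which
  \<beta> and \<open>lam\<close> are requested.\<close>

definition main_body :: "nat \<Rightarrow> nat \<Rightarrow> nat \<Rightarrow> expr" where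
  "main_body c0 cL cP = LetIn (Call 1 [Fst (Var 0), Lit 0, Lit 1])
     (Call 11 [Op Minus (Lit 1) (Approx 1 (Op Plus (Var 0) (Lit (of_nat cP)))),
        Approx 2 (Op Plus (Var 0) (Lit (of_nat cP))),
        Op Plus (Op Times (Lit (of_nat cL)) (Var 0)) (Lit (of_nat c0)),
        Fst (Var 1), Call 2 [Snd (Var 1)]])"

definition ising_prog :: "nat \<Rightarrow> nat \<Rightarrow> nat \<Rightarrow> prog" where
  "ising_prog c0 cL cP = [main_body c0 cL cP, search_body, init_body, mem_body, rem_body, len_body,
     pin1_body, pin_body, ratio_body, fac_body, allp_body, loop_body, power_body]"

lemma ising_prog_simps [simp]:
  "length (ising_prog c0 cL cP) = 13"
  "ising_prog c0 cL cP ! 0 = main_body c0 cL cP"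
  "ising_prog c0 cL cP ! Suc 0 = search_body"
  "ising_prog c0 cL cP ! 2 = init_body"
  "ising_prog c0 cL cP ! 3 = mem_body"
  "ising_prog c0 cL cP ! 4 = rem_body"
  "ising_prog c0 cL cP ! 5 = len_body"
  "ising_prog c0 cL cP ! 6 = pin1_body"
  "ising_prog c0 cL cP ! 7 = pin_body"
  "ising_prog c0 cL cP ! 8 = ratio_body"
  "ising_prog c0 cL cP ! 9 = fac_body"
  "ising_prog c0 cL cP ! 10 = allp_body"
  "ising_prog c0 cL cP ! 11 = loop_body"
  "ising_prog c0 cL cP ! 12 = power_body"
  by (simp_all add: ising_prog_def)

section \<open>Encoded data and the list routines\<close>

definition enc_list :: "nat list \<Rightarrow> val" where
  "enc_list us = list_val (map nat_val us)"

definition enc_edge :: "edge \<Rightarrow> val" where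
  "enc_edge e = (case e of (f0, f1, us) \<Rightarrow> PairV (NumV (of_bool f0)) (PairV (NumV (of_bool f1)) (enc_list us)))"

definition enc_edges :: "edge list \<Rightarrow> val" where
  "enc_edges g = list_val (map enc_edge g)"

lemma enc_list_simps [simp]: "enc_list [] = NumV 0" "enc_list (u # us) = PairV (NumV (of_nat u)) (enc_list us)"
  by (simp_all add: enc_list_def nat_val_def)

lemma enc_edges_simps [simp]:
  "enc_edges [] = NumV 0"
  "enc_edges ((f0, f1, us) # g) = PairV (PairV (NumV (of_bool f0)) (PairV (NumV (of_bool f1)) (enc_list us))) (enc_edges g)"
  by (simp_all add: enc_edges_def enc_edge_def)

text \<open>\<open>H\<close> bounds heights of numbers, and \<open>2 * H + 2\<close> is the size
  that \<open>rat_size_le\<close> derives from it. The square of \<open>n\<close> is there because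
  the equality test squares a difference of vertex numbers; the \<open>+ 2\<close> leaves room for
  the small numbers of the search.\<close>

locale machine =
  fixes a :: "nat \<Rightarrow> nat \<Rightarrow> int" and n H s c0 cL cP :: nat
  assumes H: "n * n + 2 \<le> 2 ^ H" and s: "2 * H + 2 \<le> s"
begin

abbreviation "P \<equiv> ising_prog c0 cL cP"
abbreviation "ok \<equiv> eval_in a P s"

lemma sz: "hb q H \<Longrightarrow> rat_size q \<le> s"
  using rat_size_le[of q H] s by simp

lemma hb_small_int: "\<bar>z\<bar> \<le> int n * int n + 2 \<Longrightarrow> hb (of_int z) H"
proof -
  assume *: "\<bar>z\<bar> \<le> int n * int n + 2"
  have "int (n * n + 2) \<le> int (2 ^ H)" using H by linarith
  then show ?thesis using * by (intro hb_int) simp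
qed

lemma n_le_sq: "v \<le> n \<Longrightarrow> int v \<le> int n * int n"
  by (metis int_ops(7) le_square le_trans of_nat_mono)

lemma sz_nat [simp]: "v \<le> n \<Longrightarrow> rat_size (of_nat v) \<le> s"
  using sz[OF hb_small_int[of "int v"]] n_le_sq[of v] by simp

lemma sz_diff [simp]:
  assumes "v \<le> n" "u \<le> n"
  shows "rat_size (of_nat v - of_nat u) \<le> s"
proof -
  have "rat_size (of_int (int v - int u)) \<le> s"
    using assms n_le_sq[of u] n_le_sq[of v] by (intro sz hb_small_int) linarith
  then show ?thesis by simp
qed

lemma sz_sq [simp]:
  assumes "v \<le> n" "u \<le> n"
  shows "rat_size ((of_nat v - of_nat u) * (of_nat v - of_nat u)) \<le> s"
proof -
  have "\<bar>(int v - int u) * (int v - int u)\<bar> \<le> int n * int n"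
    unfolding abs_mult using assms by (intro mult_mono) auto
  then have "rat_size (of_int ((int v - int u) * (int v - int u))) \<le> s"
    by (intro sz hb_small_int) linarith
  then show ?thesis by simp
qed

lemma sz_0 [simp]: "rat_size 0 \<le> s" and sz_1 [simp]: "rat_size 1 \<le> s"
  and sz_bool [simp]: "rat_size (of_bool c) \<le> s"
  by (rule sz, simp)+

lemma sq_pos: "(0 < (of_nat v - of_nat u) * (of_nat v - of_nat u :: rat)) \<longleftrightarrow> u \<noteq> v"
  using linorder_neq_iff[of u v] by (auto simp: zero_less_mult_iff)

text \<open>One round takes a fixed number of steps, and 30 is a generous bound for it; the
  numerical constants of the later routines are of the same kind.\<close>

lemma mem_ok:
  "v < n \<Longrightarrow> set us \<subseteq> {..<n} \<Longrightarrow>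
    ok [NumV (of_nat v), enc_list us] mem_body (NumV (of_bool (v \<in> set us))) (30 * (length us + 1))"
proof (induction us)
  case Nil
  show ?case by (rule eval_inI) (simp add: mem_body_def)
next
  case (Cons u us)
  then have IH: "ok [NumV (of_nat v), enc_list us] (P ! 3) (NumV (of_bool (v \<in> set us))) (30 * (length us + 1))"
    by simp
  show ?case
    by (rule eval_inI) (use Cons.prems in \<open>auto simp: mem_body_def sq_pos intro!: callsI[OF IH]\<close>)
qed

lemma rem_ok:
  "v < n \<Longrightarrow> set us \<subseteq> {..<n} \<Longrightarrow>
    ok [NumV (of_nat v), enc_list us] rem_body (enc_list (removeAll v us)) (30 * (length us + 1))"
proof (induction us)
  case Nil
  show ?case by (rule eval_inI) (simp add: rem_body_def)
next
  case (Cons u us)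
  then have IH: "ok [NumV (of_nat v), enc_list us] (P ! 4) (enc_list (removeAll v us)) (30 * (length us + 1))"
    by simp
  show ?case
    by (rule eval_inI) (use Cons.prems in \<open>auto simp: rem_body_def sq_pos intro!: callsI[OF IH]\<close>)
qed

lemma len_ok:
  "length us \<le> n \<Longrightarrow> ok [enc_list us] len_body (NumV (of_nat (length us))) (30 * (length us + 1))"
proof (induction us)
  case Nil
  show ?case by (rule eval_inI) (simp add: len_body_def)
next
  case (Cons u us)
  then have IH: "ok [enc_list us] (P ! 5) (NumV (of_nat (length us))) (30 * (length us + 1))"
    by simp
  show ?case
    by (rule eval_inI) (use Cons.prems in \<open>auto simp: len_body_def intro!: callsI[OF IH]\<close>)
qed

lemma wf_length:
  assumes "distinct us" "set us \<subseteq> {..<n}"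
  shows "length us \<le> n"
  using card_mono[OF _ assms(2)] distinct_card[OF assms(1)] by simp

lemma pin1_ok:
  assumes "v < n" "distinct us" "set us \<subseteq> {..<n}"
  shows "ok [NumV (of_nat v), NumV (of_bool c), enc_edge (f0, f1, us)] pin1_body
    (enc_edge (pin1 v c (f0, f1, us))) (100 * (n + 1))"
proof -
  note len = wf_length[OF assms(2,3)]
  have MEM: "ok [NumV (of_nat v), enc_list us] (P ! 3) (NumV (of_bool (v \<in> set us))) (30 * (n + 1))"
    using mem_ok[OF assms(1,3)] len by (auto intro: eval_in_mono)
  have REM: "ok [NumV (of_nat v), enc_list us] (P ! 4) (enc_list (removeAll v us)) (30 * (n + 1))"
    using rem_ok[OF assms(1,3)] len by (auto intro: eval_in_mono)
  show ?thesis
    by (rule eval_inI)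
       (cases c; use assms in \<open>auto simp: pin1_body_def enc_edge_def pin1_def intro!: callsI[OF MEM] callsI[OF REM]\<close>)
qed

lemma pin_ok:
  "v < n \<Longrightarrow> wf_edges {..<n} es \<Longrightarrow>
    ok [NumV (of_nat v), NumV (of_bool c), enc_edges es, enc_edges acc] pin_body
      (enc_edges (pin v c es acc)) (130 * (length es + 1) * (n + 1))"
proof (induction es arbitrary: acc)
  case Nil
  show ?case by (rule eval_inI) (simp add: pin_body_def)
next
  case (Cons e es)
  obtain f0 f1 us where e: "e = (f0, f1, us)" by (cases e)
  have IH: "ok [NumV (of_nat v), NumV (of_bool c), enc_edges es, PairV (enc_edge (pin1 v c e)) (enc_edges acc)] (P ! 7)
      (enc_edges (pin v c (e # es) acc)) (130 * (length es + 1) * (n + 1))"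
    using Cons.IH[of "pin1 v c e # acc"] Cons.prems by (simp add: e enc_edges_def)
  have PIN1: "ok [NumV (of_nat v), NumV (of_bool c), enc_edge e] (P ! 6) (enc_edge (pin1 v c e)) (100 * (n + 1))"
    using pin1_ok[of v us c f0 f1] Cons.prems by (simp add: e)
  have enc_edges: "enc_edges (e # es) = PairV (enc_edge e) (enc_edges es)" by (simp add: enc_edges_def)
  show ?case unfolding enc_edges
    by (rule eval_inI, simp add: pin_body_def del: pin.simps split del: split_of_bool,
      rule callsI[OF PIN1], simp, simp del: pin.simps split del: split_of_bool,
      rule callsI[OF IH], simp_all add: algebra_simps)
qed

end

section \<open>Bit lengths of the intermediate rationals\<close>

lemma length_pin [simp]: "length (pin v c es acc) = length es + length acc"
  by (induction es arbitrary: acc) auto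

text \<open>Since \<open>k \<le> 2 ^ (k - 1) \<le> M ^ (k - 1)\<close>, the \<open>k\<close>
  marginals of an edge, evaluated at budget \<open>L - k\<close>, weigh no more than a single one at
  budget \<open>L - 1\<close>. This makes the call tree exponential in the budget only, whatever the
  edge sizes.\<close>

lemma mult_power_diff_le:
  fixes M :: nat
  assumes "2 \<le> M" "1 \<le> k" "k \<le> L"
  shows "k * M ^ (L - k) \<le> M ^ (L - 1)"
proof -
  obtain j where j: "k = Suc j" using assms by (cases k) auto
  have "k \<le> 2 ^ j" unfolding j by (induction j) auto
  also have "\<dots> \<le> M ^ j" using assms by (intro power_mono) auto
  finally have "k * M ^ (L - k) \<le> M ^ j * M ^ (L - k)" by simp
  also have "\<dots> = M ^ (L - 1)" using assms by (simp add: j flip: power_add)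
  finally show ?thesis .
qed

text \<open>\<open>M\<close> is the growth per unit of budget. A marginal built from odds of height
  \<open>x\<close> has height \<open>2 * x + 1 \<le> 3 * x\<close>, and a factor contains two
  products of them, which gives 6 for each of at most \<open>D\<close> factors. The final 2 covers
  the contribution independent of the budget, which \<open>X\<close> collects, and ensures
  \<open>2 \<le> M\<close> even for \<open>D = 0\<close>.\<close>

locale heights =
  fixes b lam :: rat and h0 D X M :: nat
  assumes hb_b: "hb b h0" and hb_lam: "hb lam h0"
    and X: "D * (2 * h0 + 2) + h0 + 1 \<le> X" and M: "M = 6 * D + 2"
begin

definition fac_height :: "nat \<Rightarrow> nat" where
  "fac_height L = 2 * h0 + 2 + (if L = 0 then 0 else 6 * X * M ^ (L - 1))"

lemma fac_height_sum: "h0 + D * fac_height L \<le> X * M ^ L"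
proof (cases L)
  case 0
  then show ?thesis using X by (simp add: fac_height_def)
next
  case (Suc l)
  have "1 \<le> M ^ l" by (simp add: M)
  have "h0 + D * fac_height L = D * (2 * h0 + 2) + h0 + 6 * D * X * M ^ l"
    using Suc by (simp add: fac_height_def algebra_simps)
  also have "\<dots> \<le> X * M ^ l + 6 * D * X * M ^ l"
    using X mult_le_mono2[OF \<open>1 \<le> M ^ l\<close>, of X] by linarith
  also have "\<dots> \<le> (6 * D + 2) * X * M ^ l" by (simp add: algebra_simps)
  also have "\<dots> = X * M ^ L" unfolding M[symmetric] by (simp add: Suc)
  finally show ?thesis .
qed

definition ratio_hb :: "nat \<Rightarrow> bool" where
  "ratio_hb L \<longleftrightarrow> (\<forall>v dn todo. (\<forall>u. deg u dn + deg u todo \<le> D) \<longrightarrow>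
     hb (ratio b lam v L dn todo) (h0 + deg v todo * fac_height L))"

lemma ratio_hb_graph:
  assumes "ratio_hb L" "\<forall>u. deg u g \<le> D"
  shows "hb (ratio b lam v L [] g) (X * M ^ L)"
proof -
  have "hb (ratio b lam v L [] g) (h0 + deg v g * fac_height L)"
    using assms by (simp add: ratio_hb_def)
  moreover have "deg v g * fac_height L \<le> D * fac_height L" using assms by simp
  ultimately show ?thesis using fac_height_sum[of L] by (elim hb_mono) linarith
qed

lemma hb_one_plus: "hb q h \<Longrightarrow> hb (1 + q) (h + 1)"
  using hb_add[of 1 0 q h] by simp

lemma hb_one_minus: "hb q h \<Longrightarrow> hb (1 - q) (h + 1)"
  using hb_diff[of 1 0 q h] by simp

lemma hb_prob:
  assumes "hb r h"
  shows "hb ((if c then r else 1) / (1 + r)) (2 * h + 1)"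
proof -
  have "hb (if c then r else 1) h" using assms by simp
  from hb_divide[OF this hb_one_plus[OF assms]] show ?thesis by (rule hb_mono) simp
qed

lemma deg_pin_le: "\<forall>u. deg u g \<le> D \<Longrightarrow> \<forall>u. deg u (pin v c g []) \<le> D"
  using deg_pin[of _ v c g "[]"] by (auto intro: order_trans)

lemma allp_hb:
  assumes "ratio_hb L"
  shows "\<forall>u. deg u g \<le> D \<Longrightarrow> hb (allp b lam c us L g) (length us * (2 * (X * M ^ L) + 1))"
proof (induction us arbitrary: g)
  case (Cons u us)
  have *: "length (u # us) * h = h + length us * h" for h by simp
  from hb_mult[OF hb_prob[OF ratio_hb_graph[OF assms Cons.prems]] Cons.IH[OF deg_pin_le[OF Cons.prems]]]
  show ?case unfolding allp.simps(2) * .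
qed (simp add: allp.simps)

lemma allp_hb':
  assumes "ratio_hb (L - length us)" "\<forall>u. deg u g \<le> D" "length us \<le> L"
  shows "2 * (h0 + length us * (2 * (X * M ^ (L - length us)) + 1) + 1) \<le> fac_height L"
proof (cases "us = []")
  case False
  let ?k = "length us"
  have k: "1 \<le> ?k" "?k \<le> L" using False assms by (auto simp: Suc_le_eq)
  have "1 \<le> X" using X by simp
  then have 1: "1 \<le> X * M ^ (L - ?k)" by (simp add: M)
  have "?k * (2 * (X * M ^ (L - ?k)) + 1) \<le> ?k * (3 * (X * M ^ (L - ?k)))"
    using 1 by (intro mult_le_mono2) linarith
  also have "\<dots> = 3 * X * (?k * M ^ (L - ?k))" by simp
  also have "\<dots> \<le> 3 * X * M ^ (L - 1)"
    using mult_power_diff_le[of M ?k L] k by (intro mult_le_mono2) (auto simp: M)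
  finally show ?thesis using k by (simp add: fac_height_def)
qed (simp add: fac_height_def)

lemma fac_parts_hb:
  assumes "ratio_hb L" "\<forall>u. deg u g \<le> D"
  shows "hb (1 - b * of_bool f * allp b lam c us L g) (h0 + length us * (2 * (X * M ^ L) + 1) + 1)"
  using hb_one_minus[OF hb_mult[OF hb_mult[OF hb_b hb_of_bool[of f 0]] allp_hb[OF assms]]] by simp

lemma fac_hb:
  assumes "\<And>L'. L' < L \<Longrightarrow> ratio_hb L'" "\<forall>u. deg u g \<le> D"
  shows "hb (fac b lam L f0 f1 us g) (fac_height L)"
proof (cases "L < length us \<or> us = []")
  case True
  then consider "L < length us" | "us = []" by blast
  then show ?thesis
  proof cases
    case 1 then show ?thesis by (simp add: fac.simps)
  next
    case 2
    have "hb (1 - b * of_bool f) (h0 + 1)" for f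
      using hb_one_minus[OF hb_mult[OF hb_b hb_of_bool[of f 0]]] by simp
    from hb_divide[OF this this] have "hb ((1 - b * of_bool f1) / (1 - b * of_bool f0)) (2 * h0 + 2)"
      by (simp add: mult_2)
    moreover have "fac b lam L f0 f1 us g = (1 - b * of_bool f1) / (1 - b * of_bool f0)"
      using 2 by (simp add: fac.simps allp.simps)
    ultimately show ?thesis by (simp only:) (erule hb_mono, simp add: fac_height_def)
  qed
next
  case False
  let ?L = "L - length us"
  have "0 < length us" "length us \<le> L" using False by auto
  then have r: "ratio_hb ?L" by (intro assms) linarith
  have "hb ((1 - b * of_bool f1 * allp b lam True us ?L g) / (1 - b * of_bool f0 * allp b lam False us ?L g))
    (2 * (h0 + length us * (2 * (X * M ^ ?L) + 1) + 1))"
    by (rule hb_mono[OF hb_divide[OF fac_parts_hb[OF r assms(2)] fac_parts_hb[OF r assms(2)]]]) simp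
  then show ?thesis using False allp_hb'[OF r assms(2)] by (auto simp: fac.simps elim: hb_mono)
qed

lemma ratio_hb: "ratio_hb L"
proof (induction L rule: less_induct)
  case (less L)
  have "hb (ratio b lam v L dn todo) (h0 + deg v todo * fac_height L)"
    if "\<forall>u. deg u dn + deg u todo \<le> D" for v dn todo
    using that
  proof (induction todo arbitrary: dn)
    case Nil
    show ?case using hb_lam by (simp add: ratio.simps)
  next
    case (Cons e es)
    obtain f0 f1 us where e: "e = (f0, f1, us)" by (cases e)
    show ?case
    proof (cases "v \<in> set us")
      case False
      have "\<forall>u. deg u (e # dn) + deg u es \<le> D"
        using Cons.prems by (auto simp: e split: if_splits)
      then show ?thesis using Cons.IH[of "e # dn"] False by (simp add: e ratio.simps)
    next
      case True
      let ?ws = "removeAll v us"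
      let ?g = "pin v True es dn" and ?dn = "(f0, False, ?ws) # dn"
      have dn: "deg u ?dn + deg u es \<le> D" for u
        using Cons.prems by (auto simp: e dest!: spec[of _ u] split: if_splits)
      have "deg u ?g \<le> D" for u
        using deg_pin[of u v True es dn] dn[of u] by (auto split: if_splits)
      then have "hb (fac b lam L f0 f1 ?ws ?g) (fac_height L)" using fac_hb less by blast
      moreover have "hb (ratio b lam v L ?dn es) (h0 + deg v es * fac_height L)"
        using Cons.IH[of ?dn] dn by blast
      ultimately show ?thesis
        using hb_mult True by (fastforce simp: e ratio.simps algebra_simps)
    qed
  qed
  then show ?case unfolding ratio_hb_def by blast
qed

lemma ratio_hb_le:
  assumes "\<forall>u. deg u dn + deg u todo \<le> D"
  shows "hb (ratio b lam v L dn todo) (X * M ^ L)"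
proof -
  have "deg v todo * fac_height L \<le> D * fac_height L"
    using assms by (intro mult_right_mono) (auto dest: spec[of _ v])
  then show ?thesis
    using assms ratio_hb[of L] fac_height_sum[of L] unfolding ratio_hb_def
    by (meson add_le_cancel_left hb_mono order_trans)
qed

end

section \<open>Step counts of the recursion\<close>

locale ratio_machine = machine a n H s c0 cL cP + heights b lam h0 D X M
  for a n H s c0 cL cP b lam h0 D X M +
  fixes m Lmax w W Y :: nat
  assumes H_heights: "h0 + (n + 1) * (2 * (X * M ^ Lmax) + 1) + 1 \<le> H"
    and Lmax: "Lmax \<le> 2 ^ H"
    and w: "130 * (m + 1) * (n + 1) \<le> w" and W: "3 * w + 200 \<le> W"
    and Y: "(m + 1) * W + D * (5 * W) + 2 * W \<le> Y"
begin

lemma X_pow_mono: "L \<le> Lmax \<Longrightarrow> X * M ^ L \<le> X * M ^ Lmax"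
  by (simp add: M power_increasing)

lemma allp_height:
  assumes "length us \<le> n" "L \<le> Lmax"
  shows "h0 + length us * (2 * (X * M ^ L) + 1) + 1 \<le> H"
proof -
  have "length us * (2 * (X * M ^ L) + 1) \<le> (n + 1) * (2 * (X * M ^ Lmax) + 1)"
    using X_pow_mono[OF assms(2)] assms(1) by (intro mult_le_mono) auto
  then show ?thesis using H_heights by linarith
qed

lemma ratio_height:
  assumes "L \<le> Lmax"
  shows "2 * (X * M ^ L) + 1 \<le> H"
proof -
  have "1 * (2 * (X * M ^ L) + 1) \<le> (n + 1) * (2 * (X * M ^ Lmax) + 1)"
    using X_pow_mono[OF assms] by (intro mult_le_mono) auto
  then have "2 * (X * M ^ L) + 1 \<le> (n + 1) * (2 * (X * M ^ Lmax) + 1)" by (simp only: mult_1)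
  then show ?thesis using H_heights by linarith
qed

text \<open>The recurrence of \<open>fac_height\<close> with steps in place of bits, where
  \<open>5 * W\<close> covers the list work. The 4 stands for two calls of \<open>allp\<close>, each
  with its overhead absorbed by doubling since \<open>2 * W \<le> Y\<close>; the growth rate
  \<open>M\<close> is large enough for this as well.\<close>

definition fac_cost :: "nat \<Rightarrow> nat" where
  "fac_cost L = 5 * W + (if L = 0 then 0 else 4 * Y * M ^ (L - 1))"

lemma fac_cost_sum: "(m + 1) * W + D * fac_cost L \<le> Y * M ^ L"
proof (cases L)
  case 0
  then show ?thesis using Y by (simp add: fac_cost_def)
next
  case (Suc l)
  have "1 \<le> M ^ l" by (simp add: M)
  have "(m + 1) * W + D * fac_cost L = (m + 1) * W + D * (5 * W) + 4 * D * Y * M ^ l"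
    using Suc by (simp add: fac_cost_def algebra_simps)
  also have "\<dots> \<le> Y * M ^ l + 4 * D * Y * M ^ l"
    using Y mult_le_mono2[OF \<open>1 \<le> M ^ l\<close>, of Y] by linarith
  also have "\<dots> \<le> (6 * D + 2) * Y * M ^ l" by (simp add: algebra_simps)
  also have "\<dots> = Y * M ^ L" unfolding M[symmetric] by (simp add: Suc)
  finally show ?thesis .
qed

lemma sz_L [simp]: "L \<le> Lmax \<Longrightarrow> rat_size (of_nat L) \<le> s"
proof -
  assume "L \<le> Lmax"
  then have "int L \<le> int (2 ^ H)" using Lmax by linarith
  then have "hb (of_int (int L)) H" by (intro hb_int) simp
  then show ?thesis using sz by simp
qed

definition ratio_cost :: "nat \<Rightarrow> bool" where
  "ratio_cost L \<longleftrightarrow> (\<forall>v dn todo. v < n \<longrightarrow> wf_edges {..<n} dn \<longrightarrow> wf_edges {..<n} todo \<longrightarrow>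
     (\<forall>u. deg u dn + deg u todo \<le> D) \<longrightarrow> length dn + length todo \<le> m \<longrightarrow>
     ok [NumV b, NumV lam, NumV (of_nat v), NumV (of_nat L), enc_edges dn, enc_edges todo] (P ! 8)
       (NumV (ratio b lam v L dn todo)) ((length todo + 1) * W + deg v todo * fac_cost L))"

lemma ratio_cost_graph:
  assumes "ratio_cost L" "v < n" "wf_graph {..<n} D g" "length g \<le> m"
  shows "ok [NumV b, NumV lam, NumV (of_nat v), NumV (of_nat L), NumV 0, enc_edges g] (P ! 8)
       (NumV (ratio b lam v L [] g)) (Y * M ^ L)"
proof -
  have "ok [NumV b, NumV lam, NumV (of_nat v), NumV (of_nat L), enc_edges [], enc_edges g] (P ! 8)
       (NumV (ratio b lam v L [] g)) ((length g + 1) * W + deg v g * fac_cost L)"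
    using assms(1)[unfolded ratio_cost_def] assms(2-4) by (auto simp: wf_graph_def simp del: enc_edges_simps)
  moreover have "(length g + 1) * W + deg v g * fac_cost L \<le> (m + 1) * W + D * fac_cost L"
    using assms by (intro add_mono mult_right_mono) (auto simp: wf_graph_def)
  ultimately show ?thesis using fac_cost_sum[of L] by (auto elim: eval_in_mono)
qed

lemma pin_cost:
  assumes "v < n" "wf_edges {..<n} es" "length es \<le> m"
  shows "ok [NumV (of_nat v), NumV (of_bool c), enc_edges es, enc_edges acc] (P ! 7) (enc_edges (pin v c es acc)) w"
proof -
  have "130 * (length es + 1) * (n + 1) \<le> w"
    by (rule order_trans[OF _ w]) (intro mult_le_mono add_mono, use assms in auto)
  then show ?thesis unfolding ising_prog_simps by (rule eval_in_mono[OF pin_ok[OF assms(1,2)]])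
qed

lemma list_cost: "k \<le> n \<Longrightarrow> 30 * (k + 1) \<le> w"
proof -
  assume "k \<le> n"
  then have "30 * (k + 1) \<le> 130 * 1 * (n + 1)" by simp
  also have "\<dots> \<le> 130 * (m + 1) * (n + 1)" by (intro mult_le_mono) auto
  finally show ?thesis using w by linarith
qed

lemma sz_hb: "hb q h \<Longrightarrow> h \<le> H \<Longrightarrow> rat_size q \<le> s"
  using sz hb_mono by blast

lemma sz_ratio:
  assumes "\<forall>u. deg u dn + deg u todo \<le> D" "L \<le> Lmax"
  shows "rat_size (ratio b lam v L dn todo) \<le> s" "rat_size (1 + ratio b lam v L dn todo) \<le> s"
    "rat_size ((if c then ratio b lam v L dn todo else 1) / (1 + ratio b lam v L dn todo)) \<le> s"
proof -
  note * = ratio_hb_le[OF assms(1), of v L]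
  have "2 * (X * M ^ L) + 1 \<le> H" by (rule ratio_height) fact
  then show "rat_size (ratio b lam v L dn todo) \<le> s" "rat_size (1 + ratio b lam v L dn todo) \<le> s"
    "rat_size ((if c then ratio b lam v L dn todo else 1) / (1 + ratio b lam v L dn todo)) \<le> s"
    by (intro sz_hb[OF *] sz_hb[OF hb_one_plus[OF *]] sz_hb[OF hb_prob[OF *]]; linarith)+
qed

lemma sz_if: "rat_size q \<le> s \<Longrightarrow> rat_size (if c then q else 1) \<le> s"
  by simp

text \<open>Both branches take one step, so the test of the flag becomes a conditional value and the
  symbolic run need not split on it.\<close>

lemma wp_if_one:
  "(if c then wp a P s (Var 0) (NumV r # env) k K else wp a P s (Lit 1) (NumV r # env) k K)
     \<longleftrightarrow> K (NumV (if c then r else 1)) (Suc k)"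
  by simp

lemma allp_ok:
  assumes L: "L \<le> Lmax" "ratio_cost L"
  shows "distinct us \<Longrightarrow> set us \<subseteq> {..<n} \<Longrightarrow> wf_graph {..<n} D g \<Longrightarrow> length g \<le> m \<Longrightarrow>
    ok [NumV b, NumV lam, NumV (of_bool c), enc_list us, NumV (of_nat L), enc_edges g] (P ! 10)
      (NumV (allp b lam c us L g)) ((length us + 1) * W + length us * (Y * M ^ L))"
proof (induction us arbitrary: g)
  case Nil
  show ?case unfolding ising_prog_simps
    by (rule eval_inI) (use W in \<open>simp add: allp_body_def allp.simps split del: split_of_bool\<close>)
next
  case (Cons u us)
  have u: "u < n" using Cons.prems by simp
  have deg: "\<forall>u. deg u [] + deg u g \<le> D" "\<forall>u. deg u (pin u' c g []) \<le> D" for u'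
    using Cons.prems(3) wf_graph_pin[OF Cons.prems(3)] by (auto simp: wf_graph_def)
  note RATIO = ratio_cost_graph[OF L(2) u Cons.prems(3,4)]
  have PIN: "ok [NumV (of_nat u), NumV (of_bool c), enc_edges g, NumV 0] (P ! 7) (enc_edges (pin u c g [])) w"
    using pin_cost[OF u _ Cons.prems(4), of c "[]"] Cons.prems(3) by (simp add: wf_graph_def)
  have ALLP: "ok [NumV b, NumV lam, NumV (of_bool c), enc_list us, NumV (of_nat L), enc_edges (pin u c g [])] (P ! 10)
      (NumV (allp b lam c us L (pin u c g []))) ((length us + 1) * W + length us * (Y * M ^ L))"
    using Cons.prems by (intro Cons.IH) (auto simp: wf_graph_pin)
  have len: "length us \<le> n" using wf_length[of us] Cons.prems by simp
  have sza: "rat_size (allp b lam c us L (pin u c g [])) \<le> s"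
    using allp_height[OF len L(1)] by (intro sz_hb[OF allp_hb[OF ratio_hb deg(2)]]) linarith
  note szs = sza sz_ratio[OF deg(1) L(1)] sz_if wp_if_one
  \<comment> \<open>The condition is phrased as the program tests it, so that the result of the
    symbolic run matches syntactically.\<close>
  have val: "allp b lam c (u # us) L g = (if 0 < (of_bool c :: rat) then ratio b lam u L [] g else 1)
      / (1 + ratio b lam u L [] g) * allp b lam c us L (pin u c g [])"
    by (simp add: allp.simps)
  show ?case unfolding val ising_prog_simps
    apply (rule eval_inI)
    apply (simp add: allp_body_def split del: split_of_bool if_split)
    apply (rule callsI[OF RATIO])
    apply simp
    apply (simp add: szs split del: split_of_bool if_split)
    apply (rule callsI[OF PIN])
    apply simp
    apply (rule callsI[OF ALLP])
     apply simp
    apply (simp add: szs split del: split_of_bool if_split)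
    using W apply simp
    done
qed

lemma allp_cost_le:
  assumes "1 \<le> k" "k \<le> L"
  shows "w + 60 + 2 * ((k + 1) * W + k * (Y * M ^ (L - k))) \<le> fac_cost L"
proof -
  have "1 \<le> M ^ (L - k)" by (simp add: M)
  then have "Y \<le> Y * M ^ (L - k)" by simp
  then have "2 * W \<le> Y * M ^ (L - k)" using Y by linarith
  have "(k + 1) * W \<le> k * (2 * W)" using assms by (simp add: algebra_simps)
  also have "\<dots> \<le> k * (Y * M ^ (L - k))" using \<open>2 * W \<le> _\<close> by (rule mult_le_mono2)
  finally have "(k + 1) * W \<le> k * (Y * M ^ (L - k))" .
  moreover have "4 * Y * (k * M ^ (L - k)) = 4 * (k * (Y * M ^ (L - k)))" by simp
  moreover have "2 * (x + y) \<le> z" if "x \<le> y" "z = 4 * y" for x y z :: nat using that by simp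
  ultimately have "2 * ((k + 1) * W + k * (Y * M ^ (L - k))) \<le> 4 * Y * (k * M ^ (L - k))" by blast
  also have "\<dots> \<le> 4 * Y * M ^ (L - 1)"
    using mult_power_diff_le[of M k L] assms by (intro mult_le_mono2) (auto simp: M)
  finally show ?thesis using assms W by (simp add: fac_cost_def)
qed

lemma fac_ok:
  assumes IH: "\<And>L'. L' < L \<Longrightarrow> ratio_cost L'" and L: "L \<le> Lmax"
    and us: "distinct us" "set us \<subseteq> {..<n}" and g: "wf_graph {..<n} D g" "length g \<le> m"
  shows "ok [NumV b, NumV lam, NumV (of_nat L), NumV (of_bool f0), NumV (of_bool f1), enc_list us, enc_edges g] (P ! 9)
      (NumV (fac b lam L f0 f1 us g)) (fac_cost L)"
proof -
  let ?k = "length us"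
  have k: "?k \<le> n" by (rule wf_length[OF us])
  have LEN: "ok [enc_list us] (P ! 5) (NumV (of_nat ?k)) w"
    using len_ok[OF k] list_cost[OF k] by (auto intro: eval_in_mono)
  have "5 * W \<le> fac_cost L" by (simp add: fac_cost_def)
  then have c0: "w + 60 \<le> fac_cost L" "2 * W + w + 60 \<le> fac_cost L" using W by linarith+
  show ?thesis
  proof (cases "L < ?k")
    case True
    then show ?thesis unfolding ising_prog_simps
      apply (intro eval_inI)
      apply (simp add: fac_body_def split del: split_of_bool)
      apply (rule callsI[OF LEN])
      apply simp
      using L k c0 apply (simp add: fac.simps split del: split_of_bool)
      done
  next
    case False
    let ?L = "L - ?k"
    have lt: "us \<noteq> [] \<Longrightarrow> ?L < L"
      using False by (metis diff_less length_greater_0_conv less_le_trans not_less)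
    have ALLP: "ok [NumV b, NumV lam, NumV (of_bool c), enc_list us, NumV (of_nat ?L), enc_edges g] (P ! 10)
      (NumV (allp b lam c us ?L g)) ((?k + 1) * W + ?k * (Y * M ^ ?L))" for c
    \<comment> \<open>An empty remainder leaves the budget at \<open>L\<close>, where no hypothesis
      is available, but then \<open>allp\<close> returns at once.\<close>
    proof (cases "us = []")
      case True
      show ?thesis unfolding ising_prog_simps True
        by (rule eval_inI) (use W in \<open>simp add: allp_body_def allp.simps split del: split_of_bool\<close>)
    next
      case False
      then show ?thesis using L us g IH[OF lt] by (intro allp_ok) auto
    qed
    have cost: "w + 60 + 2 * ((?k + 1) * W + ?k * (Y * M ^ ?L)) \<le> fac_cost L"
      using allp_cost_le[of ?k L] False c0 by (cases "us = []") (auto simp: Suc_le_eq not_less)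
    have deg: "\<forall>u. deg u g \<le> D" using g by (simp add: wf_graph_def)
    have Lk: "(of_nat L - of_nat ?k :: rat) = of_nat ?L" using False by (simp add: of_nat_diff)
    have h: "h0 + ?k * (2 * (X * M ^ ?L) + 1) + 1 \<le> H" using k L by (intro allp_height) auto
    have sz1: "rat_size (1 - b * of_bool f * allp b lam c us ?L g) \<le> s" for f c
      by (rule sz_hb[OF fac_parts_hb[OF ratio_hb deg] h])
    have sz2: "rat_size (b * of_bool f * allp b lam c us ?L g) \<le> s" for f c
      by (rule sz_hb[OF hb_mult[OF hb_mult[OF hb_b hb_of_bool[of f 0]] allp_hb[OF ratio_hb deg]]])
        (use h in linarith)
    have sz3: "rat_size (allp b lam c us ?L g) \<le> s" for c
      by (rule sz_hb[OF allp_hb[OF ratio_hb deg]]) (use h in linarith)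
    have sz4: "rat_size b \<le> s" "rat_size (b * of_bool f) \<le> s" for f
      by (rule sz_hb[OF hb_b], use h in linarith)
        (rule sz_hb[OF hb_mult[OF hb_b hb_of_bool[of f 0]]], use h in linarith)
    have val: "fac b lam L f0 f1 us g = (1 - b * of_bool f1 * allp b lam True us ?L g)
        / (1 - b * of_bool f0 * allp b lam False us ?L g)"
      using False by (simp add: fac.simps)
    note A1 = ALLP[of True, unfolded of_bool_eq Lk[symmetric]]
      and A0 = ALLP[of False, unfolded of_bool_eq Lk[symmetric]]
    show ?thesis unfolding ising_prog_simps val
      apply (rule eval_inI)
      apply (simp add: fac_body_def split del: split_of_bool)
      apply (rule callsI[OF LEN])
      apply simp
      using False L k apply (simp add: sz4 split del: split_of_bool)
      apply (rule callsI[OF A1])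
      apply simp
      apply (simp add: sz1 sz2 sz3 sz4 split del: split_of_bool)
      apply (rule callsI[OF A0])
      apply simp
      using cost apply (simp add: sz1 sz2 sz3 sz4 split del: split_of_bool)
      done
  qed
qed

end

context ratio_machine
begin

lemma mem_cost:
  assumes "v < n" "distinct us" "set us \<subseteq> {..<n}"
  shows "ok [NumV (of_nat v), enc_list us] (P ! 3) (NumV (of_bool (v \<in> set us))) w"
    "ok [NumV (of_nat v), enc_list us] (P ! 4) (enc_list (removeAll v us)) w"
  unfolding ising_prog_simps
  using eval_in_mono[OF mem_ok[OF assms(1,3)] list_cost[OF wf_length[OF assms(2,3)]]]
    eval_in_mono[OF rem_ok[OF assms(1,3)] list_cost[OF wf_length[OF assms(2,3)]]] by - assumption+

lemma fac_height_le: "L \<le> Lmax \<Longrightarrow> 1 \<le> D \<Longrightarrow> fac_height L \<le> H"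
proof -
  assume "L \<le> Lmax" "1 \<le> D"
  have "fac_height L \<le> D * fac_height L" using \<open>1 \<le> D\<close> by simp
  then show ?thesis using fac_height_sum[of L] ratio_height[OF \<open>L \<le> Lmax\<close>] by linarith
qed

lemma ratio_cost: "L \<le> Lmax \<Longrightarrow> ratio_cost L"
proof (induction L rule: less_induct)
  case (less L)
  have "ok [NumV b, NumV lam, NumV (of_nat v), NumV (of_nat L), enc_edges dn, enc_edges todo] (P ! 8)
       (NumV (ratio b lam v L dn todo)) ((length todo + 1) * W + deg v todo * fac_cost L)"
    if "v < n" "wf_edges {..<n} dn" "wf_edges {..<n} todo"
     "\<forall>u. deg u dn + deg u todo \<le> D" "length dn + length todo \<le> m" for v dn todo
    using that
  proof (induction todo arbitrary: dn)
    case Nil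
    show ?case unfolding ising_prog_simps
      by (rule eval_inI) (use W in \<open>simp add: ratio_body_def ratio.simps\<close>)
  next
    case (Cons e es)
    obtain f0 f1 us where e: "e = (f0, f1, us)" by (cases e)
    have us: "distinct us" "set us \<subseteq> {..<n}" using Cons.prems by (auto simp: e)
    note MEM = mem_cost(1)[OF Cons.prems(1) us]
    show ?case
    proof (cases "v \<in> set us")
      case False
      have "\<forall>u. deg u (e # dn) + deg u es \<le> D"
        using Cons.prems(4) by (auto simp: e split: if_splits)
      then have RATIO: "ok [NumV b, NumV lam, NumV (of_nat v), NumV (of_nat L), enc_edges (e # dn), enc_edges es] (P ! 8)
        (NumV (ratio b lam v L (e # dn) es)) ((length es + 1) * W + deg v es * fac_cost L)"
        using Cons.prems by (intro Cons.IH) (auto simp: e)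
      have MEM': "ok [NumV (of_nat v), enc_list us] (P ! 3) (NumV 0) w" using MEM False by simp
      have val: "ratio b lam v L dn (e # es) = ratio b lam v L (e # dn) es"
        using False by (simp add: e ratio.simps)
      show ?thesis unfolding ising_prog_simps val
        apply (rule eval_inI)
        apply (simp add: ratio_body_def e False split del: split_of_bool)
        apply (rule callsI[OF MEM'])
        apply simp
        apply (simp split del: split_of_bool)
        apply (rule callsI[OF RATIO[unfolded e enc_edges_simps]])
        apply simp
        using W False apply simp
        done
    next
      case True
      let ?ws = "removeAll v us"
      let ?g = "pin v True es dn" and ?dn = "(f0, False, ?ws) # dn"
      have dn: "deg u ?dn + deg u es \<le> D" for u
        using Cons.prems(4) by (auto simp: e dest!: spec[of _ u] split: if_splits)
      \<comment> \<open>Needed to pass from the bound on \<open>D * fac_height L\<close> to one on a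
        single factor.\<close>
      have D1: "1 \<le> D" using spec[OF Cons.prems(4), of v] True by (simp add: e)
      have "deg u ?g \<le> D" for u
        using deg_pin[of u v True es dn] dn[of u] by (auto split: if_splits)
      then have g: "wf_graph {..<n} D ?g"
        using Cons.prems by (simp add: wf_graph_def e wf_edges_pin)
      have ws: "distinct ?ws" "set ?ws \<subseteq> {..<n}" using us by (auto simp: distinct_removeAll)
      have FAC: "ok [NumV b, NumV lam, NumV (of_nat L), NumV (of_bool f0), NumV (of_bool f1), enc_list ?ws, enc_edges ?g] (P ! 9)
          (NumV (fac b lam L f0 f1 ?ws ?g)) (fac_cost L)"
        using less Cons.prems by (intro fac_ok ws g) auto
      have RATIO: "ok [NumV b, NumV lam, NumV (of_nat v), NumV (of_nat L), enc_edges ?dn, enc_edges es] (P ! 8)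
        (NumV (ratio b lam v L ?dn es)) ((length es + 1) * W + deg v es * fac_cost L)"
        using Cons.prems ws dn by (intro Cons.IH) (auto simp: e)
      have PIN: "ok [NumV (of_nat v), NumV 1, enc_edges es, enc_edges dn] (P ! 7) (enc_edges ?g) w"
        using pin_cost[of v es True dn] Cons.prems by (simp add: e)
      have MEM': "ok [NumV (of_nat v), enc_list us] (P ! 3) (NumV 1) w" using MEM True by simp
      note REM = mem_cost(2)[OF Cons.prems(1) us]
      have sz1: "rat_size (fac b lam L f0 f1 ?ws ?g) \<le> s"
        using g by (intro sz_hb[OF fac_hb[OF ratio_hb] fac_height_le[OF less.prems D1]])
          (simp add: wf_graph_def)
      have sz2: "rat_size (ratio b lam v L ?dn es) \<le> s"
        using sz_ratio(1)[OF _ less.prems] dn by blast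
      have val: "ratio b lam v L dn (e # es) = fac b lam L f0 f1 ?ws ?g * ratio b lam v L ?dn es"
        using True by (simp add: e ratio.simps)
      show ?thesis unfolding ising_prog_simps val
        apply (rule eval_inI)
        apply (simp add: ratio_body_def e True split del: split_of_bool)
        apply (rule callsI[OF MEM'])
        apply simp
        apply (simp split del: split_of_bool)
        apply (rule callsI[OF REM])
        apply simp
        apply (rule callsI[OF PIN])
        apply simp
        apply (rule callsI[OF FAC])
        apply simp
        apply (rule callsI[OF RATIO[unfolded enc_edges_simps of_bool_eq]])
        apply simp
        using W True apply (simp add: sz1 sz2)
        done
    qed
  qed
  then show ?case unfolding ratio_cost_def by blast
qed

end

section \<open>The outer product, the search for the precision, and the main routine\<close>

locale loop_machine = ratio_machine +
  assumes H_loop: "m * (h0 + 1) + n * (X * M ^ Lmax + 1) + 1 \<le> H"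
begin

lemma hb_power: "hb q h \<Longrightarrow> hb (q ^ k) (k * h)"
  by (induction k) (auto dest: hb_mult)

lemma power_ok:
  "length g \<le> m \<Longrightarrow> ok [NumV b, enc_edges g] (P ! 12) (NumV ((1 - b) ^ length g)) (30 * (length g + 1))"
proof (induction g)
  case Nil
  show ?case unfolding ising_prog_simps by (rule eval_inI) (simp add: power_body_def)
next
  case (Cons e g)
  obtain f0 f1 us where e: "e = (f0, f1, us)" by (cases e)
  have IH: "ok [NumV b, enc_edges g] (P ! 12) (NumV ((1 - b) ^ length g)) (30 * (length g + 1))"
    using Cons by simp
  have b: "hb (1 - b) (h0 + 1)" by (rule hb_one_minus[OF hb_b])
  have "1 * (h0 + 1) \<le> m * (h0 + 1)" using Cons.prems by (intro mult_le_mono) auto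
  then have "h0 + 1 \<le> H" using H_loop by simp
  then have 1: "rat_size b \<le> s" "rat_size (1 - b) \<le> s"
    using sz_hb[OF hb_b] sz_hb[OF b] by auto
  have "length g * (h0 + 1) \<le> m * (h0 + 1)" using Cons.prems by (intro mult_le_mono) auto
  then have 2: "rat_size ((1 - b) ^ length g) \<le> s"
    using H_loop by (intro sz_hb[OF hb_power[OF b]]) simp
  show ?case unfolding ising_prog_simps
    apply (rule eval_inI)
    apply (simp add: power_body_def e 1 split del: split_of_bool)
    apply (rule callsI[OF IH])
    apply (simp_all add: 1 2)
    done
qed

lemma zloop_hb:
  "i \<le> n \<Longrightarrow> \<forall>u. deg u g \<le> D \<Longrightarrow> hb (zloop b lam Lmax i g) (length g * (h0 + 1) + i * (X * M ^ Lmax + 1))"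
proof (induction i arbitrary: g)
  case 0
  then show ?case using hb_power[OF hb_one_minus[OF hb_b]] by simp
next
  case (Suc i)
  have "\<forall>u. deg u [] + deg u g \<le> D" using Suc.prems by simp
  from hb_mult[OF hb_one_plus[OF ratio_hb_le[OF this, of i Lmax]] Suc.IH[OF _ deg_pin_le[OF Suc.prems(2), of i False]]]
  show ?case using Suc.prems by (simp add: add.commute add.left_commute)
qed

lemma loop_ok:
  "i \<le> n \<Longrightarrow> wf_graph {..<n} D g \<Longrightarrow> length g \<le> m \<Longrightarrow>
    ok [NumV b, NumV lam, NumV (of_nat Lmax), NumV (of_nat i), enc_edges g] (P ! 11)
      (NumV (zloop b lam Lmax i g)) ((i + 1) * (W + Y * M ^ Lmax))"
proof (induction i arbitrary: g)
  case 0
  have "30 * (length g + 1) \<le> 130 * (m + 1) * (n + 1)"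
    using 0 mult_le_mono[of "130 * (m + 1)" "130 * (m + 1)" 1 "n + 1"] by simp
  then have POW: "ok [NumV b, enc_edges g] (P ! 12) (NumV ((1 - b) ^ length g)) w"
    using w by (intro eval_in_mono[OF power_ok[OF 0(3)]]) simp
  show ?case unfolding ising_prog_simps
    apply (rule eval_inI)
    apply (simp add: loop_body_def)
    apply (rule callsI[OF POW])
    apply simp
    using W apply simp
    done
next
  case (Suc i)
  have i: "i < n" using Suc.prems by simp
  have deg: "\<forall>u. deg u [] + deg u g \<le> D" "\<forall>u. deg u (pin i False g []) \<le> D"
    using Suc.prems(2) wf_graph_pin[OF Suc.prems(2)] by (auto simp: wf_graph_def)
  note RATIO = ratio_cost_graph[OF ratio_cost[OF order_refl] i Suc.prems(2,3)]
  have PIN: "ok [NumV (of_nat i), NumV 0, enc_edges g, NumV 0] (P ! 7) (enc_edges (pin i False g [])) w"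
    using pin_cost[OF i _ Suc.prems(3), of False "[]"] Suc.prems(2) by (simp add: wf_graph_def)
  have LOOP: "ok [NumV b, NumV lam, NumV (of_nat Lmax), NumV (of_nat i), enc_edges (pin i False g [])] (P ! 11)
      (NumV (zloop b lam Lmax i (pin i False g []))) ((i + 1) * (W + Y * M ^ Lmax))"
    using Suc.prems by (intro Suc.IH) (auto simp: wf_graph_pin)
  have "length g * (h0 + 1) + i * (X * M ^ Lmax + 1) \<le> m * (h0 + 1) + n * (X * M ^ Lmax + 1)"
    using Suc.prems by (intro add_mono mult_le_mono) auto
  then have sz1: "rat_size (zloop b lam Lmax i (pin i False g [])) \<le> s"
    using H_loop i by (intro sz_hb[OF zloop_hb[OF _ deg(2)]]) auto
  note szs = sz1 sz_ratio[OF deg(1) order_refl]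
  have "rat_size (of_nat (Suc i)) \<le> s" by (rule sz_nat) (use i in simp)
  then have szi: "rat_size (1 + of_nat i) \<le> s" by simp
  show ?case unfolding ising_prog_simps
    apply (rule eval_inI)
    apply (simp add: loop_body_def szi split del: split_of_bool if_split)
    apply (rule callsI[OF RATIO])
    apply simp
    apply (simp add: szs split del: split_of_bool if_split)
    apply (rule callsI[OF PIN])
    apply simp
    apply (rule callsI[OF LOOP])
    apply simp
    using W apply (simp add: szs)
    done
qed

lemma init_ok:
  "ok [list_val (map enc_list es)] (P ! 2) (enc_edges (init_edges es)) (30 * (length es + 1))"
proof (induction es)
  case Nil
  show ?case unfolding ising_prog_simps by (rule eval_inI) (simp add: init_body_def init_edges_def)
next
  case (Cons us es)
  show ?case unfolding ising_prog_simps
    apply (rule eval_inI)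
    apply (simp add: init_body_def init_edges_def split del: split_of_bool)
    apply (rule callsI[OF Cons])
    apply (simp_all add: init_edges_def)
    done
qed

end

text \<open>The approximation of \<open>\<epsilon>\<close> is off by at most
  \<open>1 / 2 ^ k\<close>; testing with \<open>n + 2\<close> therefore certifies the bound with
  \<open>n + 1\<close>.\<close>

definition found :: "(nat \<Rightarrow> nat \<Rightarrow> int) \<Rightarrow> nat \<Rightarrow> nat \<Rightarrow> bool" where
  "found a n k \<longleftrightarrow> (of_nat n + 2) * (1 / 2 ^ k) < (of_int (a 0 k) / 2 ^ k :: rat)"

context machine
begin

lemma search_ok:
  assumes K: "found a n K" "\<And>j. j < K \<Longrightarrow> \<not> found a n j" "K \<le> H"
    and A: "\<And>j. j \<le> K \<Longrightarrow> hb (of_int (a 0 j) / 2 ^ j) H"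
  shows "k \<le> K \<Longrightarrow> ok [NumV (of_nat n), NumV (of_nat k), NumV (1 / 2 ^ k)] (P ! 1) (NumV (of_nat K)) (40 * (K - k + 1))"
proof (induction "K - k" arbitrary: k rule: less_induct)
  case less
  have kH: "k \<le> H" using less.prems K(3) by simp
  have k2: "(2::int) ^ k \<le> 2 ^ H" using kH by (simp add: power_increasing)
  have "n + 2 \<le> 2 ^ H" using H le_square[of n] by linarith
  then have "int (n + 2) \<le> int (2 ^ H)" by (simp only: of_nat_le_iff)
  then have "int n + 2 \<le> 2 ^ H" by simp
  have sz1: "rat_size (of_nat n + 2) \<le> s"
  proof -
    have "rat_size (of_int (int n + 2)) \<le> s"
      using \<open>int n + 2 \<le> 2 ^ H\<close> by (intro sz hb_int) simp
    then show ?thesis by simp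
  qed
  have "rat_size ((of_nat n + 2) / 2 ^ k) \<le> s"
  proof (rule sz)
    show "hb ((of_nat n + 2) / 2 ^ k) H"
      unfolding hb_def using \<open>int n + 2 \<le> 2 ^ H\<close> k2
      by (intro exI[of _ "int n + 2"] exI[of _ "2 ^ k"]) auto
  qed
  moreover have "rat_size (1 / 2 ^ k) \<le> s"
  proof (rule sz)
    show "hb (1 / 2 ^ k) H"
      unfolding hb_def using k2 by (intro exI[of _ 1] exI[of _ "2 ^ k"]) auto
  qed
  moreover have "hb 2 H"
    using hb_int[of 2 H] H by (cases H) auto
  then have "rat_size 2 \<le> s" by (rule sz)
  moreover have "rat_size (of_int (a 0 k) / 2 ^ k) \<le> s" using A[OF less.prems] by (rule sz)
  moreover have "rat_size (of_nat k) \<le> s"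
  proof -
    have "k \<le> 2 ^ H" using less_exp[of k] power_increasing[OF kH, of "2::nat"] by linarith
    then have "rat_size (of_int (int k)) \<le> s" by (intro sz hb_int) simp
    then show ?thesis by simp
  qed
  moreover have "k \<le> s" using kH s by simp
  ultimately have szs: "rat_size ((of_nat n + 2) / 2 ^ k) \<le> s" "rat_size (1 / 2 ^ k) \<le> s" "rat_size 2 \<le> s"
    "rat_size (of_int (a 0 k) / 2 ^ k) \<le> s" "rat_size (of_nat k) \<le> s" "k \<le> s" by blast+
  show ?case
  proof (cases "found a n k")
    case True
    then have "k = K" using K(2)[of k] less.prems by (cases "k = K") auto
    show ?thesis unfolding ising_prog_simps One_nat_def
      apply (rule eval_inI)
      using True apply (simp add: search_body_def szs[unfolded \<open>k = K\<close>] sz1 found_def \<open>k = K\<close>)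
      done
  next
    case False
    then have "k < K" using K(1) less.prems by (cases "k = K") auto
    have "ok [NumV (of_nat n), NumV (of_nat (Suc k)), NumV (1 / 2 ^ Suc k)] (P ! 1) (NumV (of_nat K))
        (40 * (K - Suc k + 1))"
      using \<open>k < K\<close> by (intro less.hyps) auto
    moreover have "K - Suc k + 1 = K - k" using \<open>k < K\<close> by simp
    ultimately have IH: "ok [NumV (of_nat n), NumV (of_nat k + 1), NumV (1 / (2 ^ k * 2))] (P ! Suc 0) (NumV (of_nat K))
        (40 * (K - k))"
      by (simp only: of_nat_Suc power_Suc2 add.commute One_nat_def)
    show ?thesis unfolding ising_prog_simps One_nat_def
      apply (rule eval_inI)
      using False apply (simp add: search_body_def szs sz1 found_def)
      apply (rule callsI[OF IH])
      apply simp_all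
      done
  qed
qed

end

context loop_machine
begin

lemma main_ok:
  assumes K: "found a n K" "\<And>j. j < K \<Longrightarrow> \<not> found a n j" "K \<le> H" "K + cP \<le> H"
    and A: "\<And>j. j \<le> K \<Longrightarrow> hb (of_int (a 0 j) / 2 ^ j) H"
    and b: "b = 1 - of_int (a 1 (K + cP)) / 2 ^ (K + cP)" "hb (of_int (a 1 (K + cP)) / 2 ^ (K + cP)) H"
    and lam: "lam = of_int (a 2 (K + cP)) / 2 ^ (K + cP)"
    and L: "Lmax = cL * K + c0" "cL \<le> 2 ^ H"
    and g: "length es \<le> m" "wf_graph {..<n} D (init_edges es)"
  shows "ok [PairV (NumV (of_nat n)) (list_val (map enc_list es))] (P ! 0)
    (NumV (zloop b lam Lmax n (init_edges es)))
    (40 * (K + 1) + 30 * (m + 1) + (n + 1) * (W + Y * M ^ Lmax) + 100)"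
proof -
  have sz_le: "rat_size (of_nat k) \<le> s" if "k \<le> 2 ^ H" for k
  proof -
    have "int k \<le> int (2 ^ H)" using that by (simp only: of_nat_le_iff)
    then have "int k \<le> 2 ^ H" by simp
    then have "rat_size (of_int (int k)) \<le> s" by (intro sz hb_int) simp
    then show ?thesis by simp
  qed
  have pow: "k \<le> 2 ^ H" if "k \<le> H" for k :: nat
    using that by (meson less_exp less_imp_le order_trans)
  have SEARCH: "ok [NumV (of_nat n), NumV 0, NumV 1] (P ! Suc 0) (NumV (of_nat K)) (40 * (K + 1))"
    using search_ok[OF K(1-3) A, of 0] by (simp del: ising_prog_simps)
  have INIT: "ok [list_val (map enc_list es)] (P ! 2) (enc_edges (init_edges es)) (30 * (m + 1))"
    by (rule eval_in_mono[OF init_ok]) (use g in simp)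
  have LOOP: "ok [NumV (1 - of_int (a (Suc 0) (K + cP)) / 2 ^ (K + cP)), NumV (of_int (a 2 (K + cP)) / 2 ^ (K + cP)),
     NumV (of_nat cL * of_nat K + of_nat c0), NumV (of_nat n), enc_edges (init_edges es)] (P ! 11)
      (NumV (zloop b lam Lmax n (init_edges es))) ((n + 1) * (W + Y * M ^ Lmax))"
    using loop_ok[OF order_refl g(2)] g(1) unfolding b(1) lam L(1) by (simp add: init_edges_def del: ising_prog_simps)
  have "rat_size (of_nat (cL * K)) \<le> s" using Lmax L by (intro sz_le) simp
  then have sz1: "rat_size (of_nat cL * of_nat K) \<le> s" by simp
  have szs: "rat_size (of_nat K) \<le> s" "rat_size (of_nat cP) \<le> s" "rat_size (of_nat cL) \<le> s" "rat_size (of_nat c0) \<le> s"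
    using K(4) Lmax L by (auto intro!: sz_le pow)
  have sza: "rat_size (of_int (a (Suc 0) (K + cP)) / 2 ^ (K + cP)) \<le> s" using b(2) by (simp add: sz)
  have Ks: "K + cP \<le> s" using K(4) s by simp
  \<comment> \<open>The rule for \<open>Approx\<close> asks for a natural precision; injectivity of
    \<open>of_nat\<close> determines it.\<close>
  have ex: "(\<exists>k. (of_nat K + of_nat cP :: rat) = of_nat k \<and> Q k) \<longleftrightarrow> Q (K + cP)" for Q
    by (metis of_nat_add of_nat_eq_iff)
  show ?thesis unfolding ising_prog_simps
    apply (rule eval_inI)
    apply (simp add: main_body_def)
    apply (rule callsI[OF SEARCH])
    apply simp
    apply (simp add: ex szs sz1 sza Ks)
    apply (rule callsI[OF INIT])
    apply simp
    apply (rule callsI[OF LOOP])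
    apply simp_all
    done
qed

end

section \<open>Polynomial running time\<close>

text \<open>One height for both parameters: \<open>hl\<close> accounts for the integer part of
  \<open>lam\<close>, and the 2 for the range of the approximation of \<beta> and its subtraction
  from 1.\<close>

definition b_height :: "nat \<Rightarrow> nat \<Rightarrow> nat \<Rightarrow> nat" where
  "b_height cP hl K = K + cP + hl + 2"

definition X_bound :: "nat \<Rightarrow> nat \<Rightarrow> nat \<Rightarrow> nat \<Rightarrow> nat" where
  "X_bound D cP hl K = D * (2 * b_height cP hl K + 2) + b_height cP hl K + 1"

definition W_bound :: "nat \<Rightarrow> nat \<Rightarrow> nat" where
  "W_bound D n = 3 * (130 * (D * n + 2) * (n + 1)) + 200"

definition Y_bound :: "nat \<Rightarrow> nat \<Rightarrow> nat" where
  "Y_bound D n = (D * n + 2) * W_bound D n + D * (5 * W_bound D n) + 2 * W_bound D n"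

text \<open>A sum of everything that must fit into \<open>H\<close>, rather than a maximum, so that
  it dominates each summand and is visibly polynomially bounded.\<close>

definition height_bound :: "nat \<Rightarrow> nat \<Rightarrow> nat \<Rightarrow> nat \<Rightarrow> nat \<Rightarrow> nat \<Rightarrow> nat \<Rightarrow> nat" where
  "height_bound D c0 cL cP hl n K =
     n * n + 2 + (cL * K + c0) + cL + (K + cP + 2)
     + (b_height cP hl K + (n + 1) * (2 * (X_bound D cP hl K * (6 * D + 2) ^ (cL * K + c0)) + 1) + 1)
     + ((D * n + 1) * (b_height cP hl K + 1) + n * (X_bound D cP hl K * (6 * D + 2) ^ (cL * K + c0) + 1) + 1)"

text \<open>The number of steps times the charge \<open>1 + 2 * s\<close> with
  \<open>s = 2 * H + 2\<close>; the 3 is the entry call of \<open>runs\<close>.\<close>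

definition time_bound :: "nat \<Rightarrow> nat \<Rightarrow> nat \<Rightarrow> nat \<Rightarrow> nat \<Rightarrow> nat \<Rightarrow> nat \<Rightarrow> nat" where
  "time_bound D c0 cL cP hl n K =
     (40 * (K + 1) + 30 * (D * n + 2) + (n + 1) * (W_bound D n + Y_bound D n * (6 * D + 2) ^ (cL * K + c0)) + 100)
     * (1 + 2 * (2 * height_bound D c0 cL cP hl n K + 2)) + 3"

text \<open>Measured in \<open>2 ^ K\<close> because the search stops with
  \<open>2 ^ K \<le> 2 * (n + 3) / \<epsilon>\<close>.\<close>

definition poly_bounded :: "(nat \<Rightarrow> nat \<Rightarrow> nat) \<Rightarrow> bool" where
  "poly_bounded f \<longleftrightarrow> (\<exists>C d. \<forall>n K. f n K \<le> C * (n + 2 ^ K) ^ d)"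

named_theorems poly_intros

lemma poly_boundedI: "(\<And>n K. f n K \<le> C * (n + 2 ^ K) ^ d) \<Longrightarrow> poly_bounded f"
  unfolding poly_bounded_def by blast

lemma poly_const [poly_intros]: "poly_bounded (\<lambda>n K. c)"
  by (rule poly_boundedI[of _ c 0]) simp

lemma poly_n [poly_intros]: "poly_bounded (\<lambda>n K. n)"
  by (rule poly_boundedI[of _ 1 1]) simp

lemma poly_K [poly_intros]: "poly_bounded (\<lambda>n K. K)"
  by (rule poly_boundedI[of _ 1 1]) (simp add: less_imp_le trans_le_add2)

lemma poly_add [poly_intros]:
  assumes "poly_bounded f" "poly_bounded g"
  shows "poly_bounded (\<lambda>n K. f n K + g n K)"
proof -
  obtain C d C' d' where *: "\<And>n K. f n K \<le> C * (n + 2 ^ K) ^ d" "\<And>n K. g n K \<le> C' * (n + 2 ^ K) ^ d'"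
    using assms unfolding poly_bounded_def by blast
  show ?thesis
  proof (rule poly_boundedI)
    fix n K :: nat
    have 1: "1 \<le> n + 2 ^ K" by (simp add: trans_le_add2)
    have "C * (n + 2 ^ K) ^ d \<le> C * (n + 2 ^ K) ^ (d + d')" "C' * (n + 2 ^ K) ^ d' \<le> C' * (n + 2 ^ K) ^ (d + d')"
      using 1 by (intro mult_le_mono2 power_increasing; simp)+
    then show "f n K + g n K \<le> (C + C') * (n + 2 ^ K) ^ (d + d')"
      using *[of n K] unfolding add_mult_distrib by linarith
  qed
qed

lemma poly_mult [poly_intros]:
  assumes "poly_bounded f" "poly_bounded g"
  shows "poly_bounded (\<lambda>n K. f n K * g n K)"
proof -
  obtain C d C' d' where *: "\<And>n K. f n K \<le> C * (n + 2 ^ K) ^ d" "\<And>n K. g n K \<le> C' * (n + 2 ^ K) ^ d'"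
    using assms unfolding poly_bounded_def by blast
  show ?thesis
  proof (rule poly_boundedI)
    fix n K
    show "f n K * g n K \<le> (C * C') * (n + 2 ^ K) ^ (d + d')"
      using mult_le_mono[OF *(1)[of n K] *(2)[of n K]] by (simp add: power_add algebra_simps)
  qed
qed

text \<open>As \<open>M \<le> 2 ^ M\<close>, a power with exponent \<open>cL * K\<close> is at most
  a fixed power of \<open>2 ^ K\<close>: a logarithmic budget makes the exponential call tree
  polynomial.\<close>

lemma poly_power [poly_intros]: "poly_bounded (\<lambda>n K. M ^ (cL * K + c0))"
proof (rule poly_boundedI)
  fix n K :: nat
  have "M ^ (cL * K) \<le> (2 ^ M) ^ (cL * K)" by (intro power_mono) auto
  also have "\<dots> = (2 ^ K) ^ (M * cL)" by (simp flip: power_mult add: mult.commute mult.left_commute)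
  also have "\<dots> \<le> (n + 2 ^ K) ^ (M * cL)" by (intro power_mono) auto
  finally show "M ^ (cL * K + c0) \<le> M ^ c0 * (n + 2 ^ K) ^ (M * cL)"
    by (simp add: power_add mult.commute)
qed

lemma poly_time_bound: "poly_bounded (time_bound D c0 cL cP hl)"
  unfolding time_bound_def height_bound_def W_bound_def Y_bound_def X_bound_def b_height_def
  by (intro poly_intros)

lemma abs_le_hb: "\<bar>z\<bar> \<le> 2 ^ h \<Longrightarrow> k \<le> h \<Longrightarrow> hb (of_int z / 2 ^ k) h"
  unfolding hb_def by (rule exI[of _ z], rule exI[of _ "2 ^ k"]) (simp add: power_increasing)

lemma dyadic_abs_le:
  fixes x :: real
  assumes "\<bar>of_int z / 2 ^ k - x\<bar> \<le> 1 / 2 ^ k" "\<bar>x\<bar> + 1 \<le> 2 ^ h"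
  shows "\<bar>z\<bar> \<le> 2 ^ (k + h)"
proof -
  have "(1::real) / 2 ^ k \<le> 1" by simp
  then have "\<bar>of_int z / 2 ^ k\<bar> \<le> (2 ^ h :: real)" using assms by linarith
  then have "\<bar>of_int z :: real\<bar> \<le> 2 ^ h * 2 ^ k" by (simp add: field_simps)
  then have "of_int \<bar>z\<bar> \<le> (of_int (2 ^ (k + h)) :: real)" by (simp add: power_add mult.commute)
  then show ?thesis by (simp only: of_int_le_iff)
qed

lemma run_ok:
  fixes \<beta> lam \<epsilon> :: real
  assumes K: "found a n K" "\<And>j. j < K \<Longrightarrow> \<not> found a n j"
    and a: "\<And>j. \<bar>of_int (a 0 j) / 2 ^ j - \<epsilon>\<bar> \<le> 1 / 2 ^ j" "\<And>j. \<bar>of_int (a 1 j) / 2 ^ j - \<beta>\<bar> \<le> 1 / 2 ^ j"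
      "\<And>j. \<bar>of_int (a 2 j) / 2 ^ j - lam\<bar> \<le> 1 / 2 ^ j"
    and \<epsilon>: "0 < \<epsilon>" "\<epsilon> < 1" and \<beta>: "0 < \<beta>" "\<beta> < 1" and lam: "0 < lam" "lam + 1 \<le> 2 ^ hl"
    and g: "length es \<le> D * n + 1" "wf_graph {..<n} D (init_edges es)"
  shows "\<exists>t. runs a (ising_prog c0 cL cP) (PairV (NumV (of_nat n)) (list_val (map enc_list es)))
      (NumV (zloop (1 - of_int (a 1 (K + cP)) / 2 ^ (K + cP)) (of_int (a 2 (K + cP)) / 2 ^ (K + cP))
         (cL * K + c0) n (init_edges es))) t
      \<and> t \<le> time_bound D c0 cL cP hl n K"
proof -
  let ?H = "height_bound D c0 cL cP hl n K" and ?h0 = "b_height cP hl K"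
  let ?b = "1 - of_int (a 1 (K + cP)) / 2 ^ (K + cP) :: rat"
  let ?lam = "of_int (a 2 (K + cP)) / 2 ^ (K + cP) :: rat"
  have "\<bar>\<beta>\<bar> + 1 \<le> 2 ^ 1" using \<beta> by simp
  from dyadic_abs_le[OF a(2) this] have a1: "\<bar>a 1 (K + cP)\<bar> \<le> 2 ^ (K + cP + 1)" .
  have "\<bar>\<epsilon>\<bar> + 1 \<le> 2 ^ 1" using \<epsilon> by simp
  from dyadic_abs_le[OF a(1) this] have a0: "\<bar>a 0 j\<bar> \<le> 2 ^ (j + 1)" for j .
  have "\<bar>lam\<bar> + 1 \<le> 2 ^ hl" using lam by simp
  from dyadic_abs_le[OF a(3) this] have a2: "\<bar>a 2 (K + cP)\<bar> \<le> 2 ^ (K + cP + hl)" .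
  have pow: "x \<le> 2 ^ ?H" if "x \<le> ?H" for x :: nat
    using that less_exp[of ?H] by linarith
  have hb1: "hb (of_int (a 1 (K + cP)) / 2 ^ (K + cP)) (K + cP + 1)"
    by (rule abs_le_hb[OF a1]) simp
  interpret loop_machine a n ?H "2 * ?H + 2" c0 cL cP ?b ?lam ?h0 D "X_bound D cP hl K" "6 * D + 2"
    "D * n + 1" "cL * K + c0" "130 * (D * n + 2) * (n + 1)" "W_bound D n" "Y_bound D n"
  proof unfold_locales
    show "n * n + 2 \<le> 2 ^ ?H" by (rule pow) (simp add: height_bound_def)
    show "cL * K + c0 \<le> 2 ^ ?H" by (rule pow) (simp add: height_bound_def)
    show "hb ?b ?h0"
      by (rule hb_mono[OF hb_diff[OF hb_1[of 0] hb1]]) (simp add: b_height_def)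
    show "hb ?lam ?h0"
      by (rule hb_mono[OF abs_le_hb[OF a2]]) (simp_all add: b_height_def)
    show "D * (2 * ?h0 + 2) + ?h0 + 1 \<le> X_bound D cP hl K" by (simp add: X_bound_def)
    show "?h0 + (n + 1) * (2 * (X_bound D cP hl K * (6 * D + 2) ^ (cL * K + c0)) + 1) + 1 \<le> ?H"
      unfolding height_bound_def by linarith
    show "(D * n + 1) * (?h0 + 1) + n * (X_bound D cP hl K * (6 * D + 2) ^ (cL * K + c0) + 1) + 1 \<le> ?H"
      unfolding height_bound_def by linarith
    show "3 * (130 * (D * n + 2) * (n + 1)) + 200 \<le> W_bound D n" by (simp add: W_bound_def)
    show "(D * n + 1 + 1) * W_bound D n + D * (5 * W_bound D n) + 2 * W_bound D n \<le> Y_bound D n"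
      by (simp add: Y_bound_def)
  qed simp_all
  have KH: "K + cP + 2 \<le> ?H" by (simp add: height_bound_def)
  have "ok [PairV (NumV (of_nat n)) (list_val (map enc_list es))] (P ! 0)
    (NumV (zloop ?b ?lam (cL * K + c0) n (init_edges es)))
    (40 * (K + 1) + 30 * (D * n + 1 + 1) + (n + 1) * (W_bound D n + Y_bound D n * (6 * D + 2) ^ (cL * K + c0)) + 100)"
  proof (rule main_ok[OF K])
    show "hb (of_int (a 0 j) / 2 ^ j) ?H" if "j \<le> K" for j
      by (rule hb_mono[OF abs_le_hb[OF a0]]) (use that KH in auto)
    show "hb (of_int (a 1 (K + cP)) / 2 ^ (K + cP)) ?H"
      by (rule hb_mono[OF hb1]) (use KH in simp)
    show "cL \<le> 2 ^ ?H" by (rule pow) (simp add: height_bound_def)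
  qed (use KH g in auto)
  then obtain t where t: "eval a P [PairV (NumV (of_nat n)) (list_val (map enc_list es))] (P ! 0)
      (NumV (zloop ?b ?lam (cL * K + c0) n (init_edges es))) t"
    "t \<le> (40 * (K + 1) + 30 * (D * n + 1 + 1) + (n + 1) * (W_bound D n + Y_bound D n * (6 * D + 2) ^ (cL * K + c0)) + 100)
      * (1 + 2 * (2 * ?H + 2))"
    unfolding eval_in_def by blast
  let ?x = "PairV (NumV (of_nat n)) (list_val (map enc_list es))"
  have "evals a P [?x] [Var 0] [?x] (1 + 0 + 1)"
    using evals_Cons[OF eval_Var[of 0 "[?x]" a P] evals_Nil] by simp
  then have "runs a P ?x (NumV (zloop ?b ?lam (cL * K + c0) n (init_edges es))) (1 + 0 + 1 + t + 1)"
    unfolding runs_def using t(1) by (intro eval_Call) auto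
  then show ?thesis using t(2) unfolding time_bound_def by (intro exI conjI) auto
qed

section \<open>Accuracy\<close>

text \<open>On the interval from \<open>x / 2\<close> upwards the slope of \<open>ln\<close> is at
  most \<open>2 / x\<close>.\<close>

lemma ln_diff_le:
  fixes x y :: real
  assumes "0 < x" "\<bar>y - x\<bar> \<le> \<delta>" "\<delta> \<le> x / 2"
  shows "\<bar>ln y - ln x\<bar> \<le> 2 / x * \<delta>"
proof -
  have y: "x / 2 \<le> y" "0 < y" using assms by linarith+
  have "ln y - ln x \<le> (y - x) / x" "ln x - ln y \<le> (x - y) / y"
    using ln_diff_le assms y by auto
  moreover have "(y - x) / x \<le> 2 / x * \<delta>"
  proof -
    have "y - x \<le> 2 * \<delta>" using assms by linarith
    then show ?thesis using assms by (simp add: divide_right_mono)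
  qed
  moreover have "(x - y) / y \<le> \<delta> / (x / 2)" using assms y by (intro frac_le) auto
  ultimately show ?thesis by (simp add: mult.commute)
qed

lemma power_two_dominates:
  fixes x :: real
  shows "\<exists>c. x \<le> 2 ^ c"
  using real_arch_pow[of 2 x] by (auto intro: less_imp_le)

lemma accuracy:
  fixes \<beta> lam :: real
  assumes \<beta>: "0 < \<beta>" "\<beta> < 1" and lam: "0 < lam"
    and thr: "\<beta> \<ge> 1 - 2 / (2 * exp (- 1 / 2) * real D + 3)"
  shows "\<exists>c0 cL cP. \<forall>n g K \<epsilon> b' lam'. wf_graph {..<n} D g \<longrightarrow> zero_flagged g \<longrightarrow> length g \<le> D * n + 1 \<longrightarrow>
     \<bar>b' - (1 - \<beta>)\<bar> \<le> 1 / 2 ^ (K + cP) \<longrightarrow> \<bar>lam' - lam\<bar> \<le> 1 / 2 ^ (K + cP) \<longrightarrow>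
     (real n + 1) / 2 ^ K < \<epsilon> \<longrightarrow>
     0 < zloop b' lam' (cL * K + c0) n g \<and>
     \<bar>ln (zloop b' lam' (cL * K + c0) n g) - ln (Zg (1 - \<beta>) lam {..<n} g)\<bar> \<le> \<epsilon>"
proof -
  let ?e = "exp (- 1 / 2) :: real"
  \<comment> \<open>The hypothesis gives \<open>1 - \<beta> \<le> 1 / (?e * D + 3 / 2)\<close>,
    whereas contraction would fail only from \<open>1 / (?e * D + 1)\<close> on. \<open>b1\<close>
    lies strictly between, and \<open>C\<close> equals \<open>b1 / (1 - b1)\<close>.\<close>
  define C where "C = 1 / (?e * real D + 1 / 4)"
  define b1 where "b1 = 1 / (?e * real D + 5 / 4)"
  have den: "0 < ?e * real D + 1 / 4" by (simp add: add_nonneg_pos)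
  have C01: "0 \<le> C" "real D * C * ?e < 1" using den by (auto simp: C_def field_simps)
  have "1 - \<beta> \<le> 2 / (2 * ?e * real D + 3)" using thr by linarith
  also have "\<dots> = 1 / (?e * real D + 3 / 2)" using den by (simp add: field_simps)
  also have "\<dots> < b1" unfolding b1_def using den by (intro divide_strict_left_mono mult_pos_pos) auto
  finally have bb1: "1 - \<beta> < b1" .
  have b1: "0 < b1" "b1 < 1" using den by (auto simp: b1_def)
  have frac: "b / (1 - b) \<le> C" if "0 < b" "b \<le> b1" for b
  proof -
    have "b / (1 - b) \<le> b1 / (1 - b1)" using that b1 by (intro frac_le) auto
    also have "b1 / (1 - b1) = C"
    proof -
      have "?e * real D + 5 / 4 \<noteq> 0" using den by linarith
      then have "1 - b1 = (?e * real D + 1 / 4) * b1" by (simp add: b1_def field_simps)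
      then show ?thesis using b1 by (simp add: C_def)
    qed
    finally show ?thesis .
  qed
  \<comment> \<open>The term \<open>ln 2\<close> allows for approximations of \<open>lam\<close>
    between \<open>lam / 2\<close> and \<open>2 * lam\<close>.\<close>
  define B where "B = \<bar>ln lam\<bar> + ln 2 + real D * (- ln (1 - b1))"
  obtain \<rho> where \<rho>: "0 < \<rho>" "\<rho> < 1" "logistic B \<le> \<rho>" and
    rate: "\<And>k g. g \<le> ?e \<Longrightarrow> g \<le> 2 * real k * logistic B ^ k \<Longrightarrow> real D * C * g \<le> \<rho> ^ k"
    using exists_decay_rate[of "real D * C" "logistic B"] C01 logistic_pos logistic_less_1 by auto
  \<comment> \<open>Spending \<open>cL\<close> units of budget halves the error, matching one unit
    of \<open>K\<close>; \<open>c0\<close> pays for the constant \<open>2 * D * C\<close> and makes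
    the truncation error at most \<open>\<epsilon> / 2\<close>.\<close>
  obtain cL where cL: "\<rho> ^ cL < 1 / 2" using real_arch_pow_inv[of "1 / 2" \<rho>] \<rho> by auto
  obtain c0 where c0: "\<rho> ^ c0 < 1 / (4 * (real D * C + 1))"
    using real_arch_pow_inv[of "1 / (4 * (real D * C + 1))" \<rho>] \<rho> C01 by (auto simp: add_nonneg_pos)
  define Q where "Q = 2 / \<beta> + 2 / lam"
  \<comment> \<open>The reciprocals of all tolerances: \<open>b' \<le> b1\<close>,
    \<open>0 < b'\<close>, errors of at most half of \<beta> and of \<open>lam\<close>, and a change
    of \<open>ln Z\<close> by at most \<open>\<epsilon> / 2\<close>.\<close>
  define T where "T = 1 / (b1 - (1 - \<beta>)) + 1 / ((1 - \<beta>) / 2) + 1 / (\<beta> / 2) + 1 / (lam / 2) + 2 * (real D + 2) * Q"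
  obtain cP where cP: "T \<le> 2 ^ cP" using power_two_dominates by blast
  have Q0: "0 < Q" using \<beta> lam by (simp add: Q_def add_pos_pos)
  have Tpos: "0 < 1 / (b1 - (1 - \<beta>))" "0 < 1 / ((1 - \<beta>) / 2)" "0 < 1 / (\<beta> / 2)" "0 < 1 / (lam / 2)"
     "0 < 2 * (real D + 2) * Q" using bb1 \<beta> lam Q0 by simp_all
  have tol: "1 / 2 ^ cP \<le> y" if "0 < y" "1 / y \<le> T" for y :: real
  proof -
    have "1 / y \<le> 2 ^ cP" using that cP by linarith
    then show ?thesis using that by (simp add: field_simps)
  qed
  have Tge: "1 / (b1 - (1 - \<beta>)) \<le> T" "1 / ((1 - \<beta>) / 2) \<le> T" "1 / (\<beta> / 2) \<le> T" "1 / (lam / 2) \<le> T"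
    using Tpos unfolding T_def by linarith+
  have tols: "1 / 2 ^ cP \<le> b1 - (1 - \<beta>)" "1 / 2 ^ cP \<le> (1 - \<beta>) / 2" "1 / 2 ^ cP \<le> \<beta> / 2" "1 / 2 ^ cP \<le> lam / 2"
    using bb1 \<beta> lam tol[OF _ Tge(1)] tol[OF _ Tge(2)] tol[OF _ Tge(3)] tol[OF _ Tge(4)] by auto
  have tolQ: "(real D + 2) * Q * (1 / 2 ^ cP) \<le> 1 / 2"
  proof -
    have "2 * (real D + 2) * Q \<le> 2 ^ cP" using cP Tpos unfolding T_def by linarith
    then show ?thesis by (simp add: field_simps)
  qed
  have main: "0 < zloop b' lam' (cL * K + c0) n g \<and>
     \<bar>ln (zloop b' lam' (cL * K + c0) n g) - ln (Zg (1 - \<beta>) lam {..<n} g)\<bar> \<le> \<epsilon>"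
    if g: "wf_graph {..<n} D g" "zero_flagged g" "length g \<le> D * n + 1"
      and b': "\<bar>b' - (1 - \<beta>)\<bar> \<le> 1 / 2 ^ (K + cP)" and lam': "\<bar>lam' - lam\<bar> \<le> 1 / 2 ^ (K + cP)"
      and K: "(real n + 1) / 2 ^ K < \<epsilon>" for n g K \<epsilon> b' lam'
  proof -
    let ?\<delta> = "1 / 2 ^ (K + cP) :: real" and ?L = "cL * K + c0"
    have "?\<delta> = (1 / 2 ^ K) * (1 / 2 ^ cP)" by (simp add: power_add)
    also have "\<dots> \<le> 1 * (1 / 2 ^ cP)" by (intro mult_right_mono) auto
    finally have \<delta>: "?\<delta> \<le> 1 / 2 ^ cP" by simp
    have \<delta>s: "?\<delta> \<le> b1 - (1 - \<beta>)" "?\<delta> \<le> (1 - \<beta>) / 2" "?\<delta> \<le> \<beta> / 2" "?\<delta> \<le> lam / 2"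
      by (rule order_trans[OF \<delta> tols(1)] order_trans[OF \<delta> tols(2)]
        order_trans[OF \<delta> tols(3)] order_trans[OF \<delta> tols(4)])+
    have "(1 - \<beta>) / 2 = 1 / 2 - \<beta> / 2" by (simp add: diff_divide_distrib)
    then have b'1: "0 < b'" "b' \<le> b1" "b' < 1"
      using order_trans[OF b' \<delta>s(1)] order_trans[OF b' \<delta>s(2)] b1 \<beta> by linarith+
    have lam'1: "lam / 2 \<le> lam'" "lam' \<le> 2 * lam" "0 < lam'"
      using order_trans[OF lam' \<delta>s(4)] lam by linarith+
    have lnlam: "\<bar>ln lam' - ln lam\<bar> \<le> 2 / lam * ?\<delta>"
      by (rule ln_diff_le[OF lam lam' \<delta>s(4)])
    have ln\<beta>: "\<bar>ln (1 - b') - ln \<beta>\<bar> \<le> 2 / \<beta> * ?\<delta>"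
      by (rule ln_diff_le[OF \<beta>(1) _ \<delta>s(3)]) (use b' in \<open>simp add: abs_minus_commute\<close>)
    have "ln lam' \<le> ln (2 * lam)" "ln (lam / 2) \<le> ln lam'" using lam lam'1 by simp_all
    then have absln: "\<bar>ln lam'\<bar> \<le> \<bar>ln lam\<bar> + ln 2" using lam by (simp add: ln_mult_pos ln_divide_pos)
    have "- ln (1 - b') \<le> - ln (1 - b1)" using b'1 b1 by simp
    then have "real D * (- ln (1 - b')) \<le> real D * (- ln (1 - b1))" by (intro mult_left_mono) auto
    then interpret decay b' lam' "{..<n}" D B C \<rho>
      using b'1 lam'1 absln frac[of b'] \<rho> rate by unfold_locales (auto simp: B_def)
    have z: "0 < zloop b' lam' ?L n g"
      "\<bar>ln (zloop b' lam' ?L n g) - ln (Zg b' lam' {..<n} g)\<bar> \<le> real n * (real D * (2 * C * \<rho> ^ ?L))"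
      using zloop_approx[OF refl order_refl g(1,2), of ?L] by auto
    have "real D * (2 * C * \<rho> ^ ?L) \<le> 1 / 2 * (1 / 2 ^ K)"
    proof -
      have regroup: "(2 * x) * (p * (1 / (4 * y))) = 1 / 2 * p * (x / y)" for x y p :: real by simp
      have "\<rho> ^ (cL * K) \<le> (1 / 2) ^ K"
        unfolding power_mult using cL \<rho> by (intro power_mono) auto
      then have "\<rho> ^ ?L \<le> 1 / 2 ^ K * (1 / (4 * (real D * C + 1)))"
        unfolding power_add using c0 \<rho> by (intro mult_mono) (auto simp: power_one_over)
      then have "(2 * (real D * C)) * \<rho> ^ ?L \<le> (2 * (real D * C)) * (1 / 2 ^ K * (1 / (4 * (real D * C + 1))))"
        using C01 by (intro mult_left_mono) auto
      also have "\<dots> = 1 / 2 * (1 / 2 ^ K) * (real D * C / (real D * C + 1))"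
        by (rule regroup)
      also have "\<dots> \<le> 1 / 2 * (1 / 2 ^ K) * 1"
        using C01 by (intro mult_left_mono) (auto simp: divide_le_eq_1 add_nonneg_pos)
      finally show ?thesis by (simp add: mult.assoc mult.left_commute)
    qed
    then have "real n * (real D * (2 * C * \<rho> ^ ?L)) \<le> real n * (1 / 2 * (1 / 2 ^ K))"
      by (intro mult_left_mono) auto
    also have "\<dots> \<le> 1 / 2 * ((real n + 1) / 2 ^ K)" by (simp add: field_simps)
    finally have e1: "\<bar>ln (zloop b' lam' ?L n g) - ln (Zg b' lam' {..<n} g)\<bar> \<le> \<epsilon> / 2"
      using z(2) K by linarith
    have "\<bar>ln (1 - (1 - \<beta>)) - ln (1 - b')\<bar> \<le> 2 / \<beta> * ?\<delta>" "\<bar>ln lam - ln lam'\<bar> \<le> 2 / lam * ?\<delta>"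
      using ln\<beta> lnlam by (simp_all add: abs_minus_commute)
    then have "\<bar>ln (Zg (1 - \<beta>) lam {..<n} g) - ln (Zg b' lam' {..<n} g)\<bar>
        \<le> length g * (2 / \<beta> * ?\<delta>) + card {..<n} * (2 / lam * ?\<delta>)"
      using b'1 lam'1 assms(1-3) by (intro Zg_perturb) auto
    also have "\<dots> \<le> ((real D + 2) * (real n + 1)) * (2 / \<beta> * ?\<delta>) + ((real D + 2) * (real n + 1)) * (2 / lam * ?\<delta>)"
    proof -
      have "real (length g) \<le> real (D * n + 1)" using g(3) by (simp only: of_nat_le_iff)
      also have "\<dots> \<le> (real D + 2) * (real n + 1)" by (simp add: algebra_simps)
      finally have "real (length g) \<le> (real D + 2) * (real n + 1)" .
      moreover have "real (card {..<n}) \<le> (real D + 2) * (real n + 1)" by (simp add: algebra_simps)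
      ultimately show ?thesis using assms(1,3) by (intro add_mono mult_right_mono) auto
    qed
    also have "\<dots> = ((real D + 2) * Q * (1 / 2 ^ cP)) * ((real n + 1) / 2 ^ K)"
      unfolding Q_def power_add by (simp add: algebra_simps add_divide_distrib)
    also have "\<dots> \<le> 1 / 2 * ((real n + 1) / 2 ^ K)"
      using tolQ by (intro mult_right_mono) auto
    finally have e2: "\<bar>ln (Zg (1 - \<beta>) lam {..<n} g) - ln (Zg b' lam' {..<n} g)\<bar> \<le> \<epsilon> / 2"
      using K by linarith
    show ?thesis using z(1) e1 e2 by (intro conjI; linarith)
  qed
  show ?thesis by (intro exI[of _ c0] exI[of _ cL] exI[of _ cP] allI impI) (rule main)
qed

lemma list_val_enc_list: "list_val (map (\<lambda>e. list_val (map nat_val e)) es) = list_val (map enc_list es)"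
  by (simp add: enc_list_def[abs_def])

text \<open>Success is certain once \<open>(n + 3) / 2 ^ k < \<epsilon>\<close>, so the least
  successful \<open>k\<close> overshoots by a factor of at most 2; this bounds the running
  time.\<close>

lemma search_result:
  fixes \<epsilon> :: real
  assumes a: "\<And>j. \<bar>of_int (a 0 j) / 2 ^ j - \<epsilon>\<bar> \<le> 1 / 2 ^ j" and \<epsilon>: "0 < \<epsilon>" "\<epsilon> < 1"
  obtains K where "found a n K" "\<And>j. j < K \<Longrightarrow> \<not> found a n j"
    "(real n + 1) / 2 ^ K < \<epsilon>" "2 ^ K \<le> 2 * (real n + 3) / \<epsilon>"
proof -
  have found: "found a n k \<longleftrightarrow> (real n + 2) / 2 ^ k < of_int (a 0 k) / 2 ^ k" for k
  proof -
    have "found a n k \<longleftrightarrow> real_of_rat ((of_nat n + 2) * (1 / 2 ^ k)) < real_of_rat (of_int (a 0 k) / 2 ^ k)"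
      unfolding found_def of_rat_less ..
    then show ?thesis by (simp add: of_rat_divide of_rat_mult of_rat_add of_rat_power)
  qed
  have yes: "found a n k" if "(real n + 3) / \<epsilon> < 2 ^ k" for k
  proof -
    have "(real n + 3) / 2 ^ k < \<epsilon>" using that \<epsilon> by (simp add: field_simps)
    moreover have "(real n + 3) / 2 ^ k = (real n + 2) / 2 ^ k + 1 / 2 ^ k" by (simp add: add_divide_distrib[symmetric])
    ultimately show ?thesis unfolding found using a[of k] by linarith
  qed
  obtain k where "(real n + 3) / \<epsilon> < 2 ^ k" using real_arch_pow[of 2 "(real n + 3) / \<epsilon>"] by auto
  then have ex: "\<exists>k. found a n k" using yes by blast
  define K where "K = (LEAST k. found a n k)"
  have K: "found a n K" "\<And>j. j < K \<Longrightarrow> \<not> found a n j"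
    unfolding K_def using ex by (auto intro: LeastI_ex dest: not_less_Least)
  have "(real n + 2) / 2 ^ K = (real n + 1) / 2 ^ K + 1 / 2 ^ K" by (simp add: add_divide_distrib[symmetric])
  then have "(real n + 1) / 2 ^ K < \<epsilon>" using K(1)[unfolded found] a[of K] by linarith
  moreover have "2 ^ K \<le> 2 * (real n + 3) / \<epsilon>"
  proof (cases K)
    case 0
    then show ?thesis using \<epsilon> by (simp add: field_simps)
  next
    case (Suc j)
    then have "\<not> (real n + 3) / \<epsilon> < 2 ^ j" using K(2)[of j] yes by auto
    then show ?thesis using Suc \<epsilon> by (simp add: field_simps)
  qed
  ultimately show ?thesis using K that by blast
qed

text \<open>With \<open>y = n + 1 / \<epsilon>\<close> one has
  \<open>n + 2 ^ K \<le> 9 * y ^ 2\<close>, as both \<open>n\<close> and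
  \<open>1 / \<epsilon>\<close> are at most \<open>y\<close> and \<open>1 \<le> y\<close>; a
  polynomial in the former is one in \<open>y\<close>.\<close>

lemma poly_in_size:
  assumes "poly_bounded f"
  shows "\<exists>(C::real) d. \<forall>n K \<epsilon>. 0 < \<epsilon> \<longrightarrow> \<epsilon> < 1 \<longrightarrow> 2 ^ K \<le> 2 * (real n + 3) / \<epsilon> \<longrightarrow>
     real (f n K) \<le> C * (real n + 1 / \<epsilon>) ^ d"
proof -
  obtain C d where f: "\<And>n K. f n K \<le> C * (n + 2 ^ K) ^ d" using assms unfolding poly_bounded_def by blast
  have "real (f n K) \<le> (real C * 9 ^ d) * (real n + 1 / \<epsilon>) ^ (2 * d)"
    if \<epsilon>: "0 < \<epsilon>" "\<epsilon> < 1" and K: "2 ^ K \<le> 2 * (real n + 3) / \<epsilon>" for n K \<epsilon>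
  proof -
    let ?y = "real n + 1 / \<epsilon>"
    have i: "1 < 1 / \<epsilon>" using \<epsilon> by simp
    have y: "1 \<le> ?y" "real n \<le> ?y" "1 / \<epsilon> \<le> ?y" using i by linarith+
    have "2 * (real n + 3) / \<epsilon> = 2 * (real n + 3) * (1 / \<epsilon>)" by simp
    also have "\<dots> \<le> (8 * ?y) * ?y" 
    proof (rule mult_mono)
      show "2 * (real n + 3) \<le> 8 * ?y" unfolding distrib_left using i by simp
    qed (use y \<epsilon> in auto)
    also have "(8 * ?y) * ?y = 8 * ?y ^ 2" by (simp only: power2_eq_square mult.assoc)
    finally have "2 ^ K \<le> 8 * ?y ^ 2" using K by linarith
    moreover have "real n \<le> ?y ^ 2"
      using mult_mono[of "real n" ?y 1 ?y] y by (simp add: power2_eq_square)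
    ultimately have N: "real (n + 2 ^ K) \<le> 9 * ?y ^ 2" by simp
    have "real (f n K) \<le> real (C * (n + 2 ^ K) ^ d)" using f by (simp only: of_nat_le_iff)
    also have "\<dots> = real C * real (n + 2 ^ K) ^ d" by (simp only: of_nat_mult of_nat_power)
    also have "\<dots> \<le> real C * (9 * ?y ^ 2) ^ d" using N by (intro mult_left_mono power_mono) auto
    also have "\<dots> = (real C * 9 ^ d) * ?y ^ (2 * d)" by (simp add: power_mult_distrib power_mult)
    finally show ?thesis .
  qed
  then show ?thesis by blast
qed

theorem theorem2:
  fixes \<Delta> :: nat and \<beta> lam :: real
  assumes "0 < \<beta>" and "\<beta> < 1" and "0 < lam"
    and "\<beta> \<ge> 1 - 2 / (2 * exp (- 1 / 2) * real \<Delta> + 3)"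
  shows "\<exists>P. is_FPTAS P [\<beta>, lam]
               (bounded_degree_hypergraphs \<Delta> :: nat hypergraph set)
               encodes_hypergraph num_vertices (partition_function \<beta> lam)"
proof -
  obtain c0 cL cP where acc: "\<And>n g K \<epsilon> b' lam'. wf_graph {..<n} \<Delta> g \<Longrightarrow> zero_flagged g \<Longrightarrow> length g \<le> \<Delta> * n + 1 \<Longrightarrow>
     \<bar>b' - (1 - \<beta>)\<bar> \<le> 1 / 2 ^ (K + cP) \<Longrightarrow> \<bar>lam' - lam\<bar> \<le> 1 / 2 ^ (K + cP) \<Longrightarrow>
     (real n + 1) / 2 ^ K < \<epsilon> \<Longrightarrow>
     0 < zloop b' lam' (cL * K + c0) n g \<and>
     \<bar>ln (zloop b' lam' (cL * K + c0) n g) - ln (Zg (1 - \<beta>) lam {..<n} g)\<bar> \<le> \<epsilon>"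
    using accuracy[OF assms] by blast
  obtain hl where hl: "lam + 1 \<le> 2 ^ hl" using power_two_dominates by blast
  obtain C d where time: "\<And>n K \<epsilon>. 0 < \<epsilon> \<Longrightarrow> \<epsilon> < 1 \<Longrightarrow> 2 ^ K \<le> 2 * (real n + 3) / \<epsilon> \<Longrightarrow>
     real (time_bound \<Delta> c0 cL cP hl n K) \<le> C * (real n + 1 / \<epsilon>) ^ d"
    using poly_in_size[OF poly_time_bound] by blast
  have "is_FPTAS (ising_prog c0 cL cP) [\<beta>, lam] (bounded_degree_hypergraphs \<Delta> :: nat hypergraph set)
               encodes_hypergraph num_vertices (partition_function \<beta> lam)"
    unfolding is_FPTAS_def
  proof (intro exI[of _ C] exI[of _ d] ballI allI impI, elim conjE)
    fix G :: "nat hypergraph" and x \<epsilon> a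
    assume G: "G \<in> bounded_degree_hypergraphs \<Delta>" and enc: "encodes_hypergraph G x"
      and \<epsilon>: "0 < \<epsilon>" "\<epsilon> < 1" and "approximates a (\<epsilon> # [\<beta>, lam])"
    then have a: "\<bar>of_int (a 0 j) / 2 ^ j - \<epsilon>\<bar> \<le> 1 / 2 ^ j" "\<bar>of_int (a 1 j) / 2 ^ j - \<beta>\<bar> \<le> 1 / 2 ^ j"
      "\<bar>of_int (a 2 j) / 2 ^ j - lam\<bar> \<le> 1 / 2 ^ j" for j
      by (auto simp: approximates_def numeral_2_eq_2 less_Suc_eq)
    obtain vs es where vs: "distinct vs" "set vs = fst G"
      and es: "\<forall>e\<in>set es. distinct e \<and> set e \<subseteq> {..<length vs}" "distinct (map set es)"
      and EG: "snd G = (\<lambda>e. (!) vs ` set e) ` set es"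
      and x: "x = PairV (nat_val (length vs)) (list_val (map (\<lambda>e. list_val (map nat_val e)) es))"
      using enc unfolding encodes_hypergraph_def by blast
    let ?n = "length vs" and ?g = "init_edges es"
    have n: "num_vertices G = ?n" using vs by (simp add: num_vertices_def distinct_card flip: vs(2))
    note wf = encoded_graph[OF vs es EG G]
    obtain K where K: "found a ?n K" "\<And>j. j < K \<Longrightarrow> \<not> found a ?n j"
      "(real ?n + 1) / 2 ^ K < \<epsilon>" "2 ^ K \<le> 2 * (real ?n + 3) / \<epsilon>"
      using search_result[of a, OF a(1) \<epsilon>] by blast
    let ?b = "1 - of_int (a 1 (K + cP)) / 2 ^ (K + cP) :: rat"
    let ?lam = "of_int (a 2 (K + cP)) / 2 ^ (K + cP) :: rat"
    let ?z = "zloop ?b ?lam (cL * K + c0) ?n ?g"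
    have "\<exists>t. runs a (ising_prog c0 cL cP) x (NumV ?z) t \<and> t \<le> time_bound \<Delta> c0 cL cP hl ?n K"
      unfolding x list_val_enc_list nat_val_def
      by (rule run_ok[OF K(1) _ a \<epsilon> assms(1,2,3) hl wf(3,1)]) (rule K(2))
    then obtain t where t: "runs a (ising_prog c0 cL cP) x (NumV ?z) t" "t \<le> time_bound \<Delta> c0 cL cP hl ?n K"
      by blast
    have rb: "real_of_rat ?b = 1 - of_int (a 1 (K + cP)) / 2 ^ (K + cP)"
      "real_of_rat ?lam = of_int (a 2 (K + cP)) / 2 ^ (K + cP)"
      by (simp_all add: of_rat_diff of_rat_divide of_rat_power)
    have z: "0 < real_of_rat ?z" "\<bar>ln (real_of_rat ?z) - ln (Zg (1 - \<beta>) lam {..<?n} ?g)\<bar> \<le> \<epsilon>"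
      unfolding of_rat_zloop rb
      using acc[OF wf(1,2) _ _ _ K(3), of "1 - of_int (a 1 (K + cP)) / 2 ^ (K + cP)"
          "of_int (a 2 (K + cP)) / 2 ^ (K + cP)"] a(2,3)[of "K + cP"] wf(3)
      by (auto simp: init_edges_def abs_minus_commute)
    have Z: "partition_function \<beta> lam G = Zg (1 - \<beta>) lam {..<?n} ?g"
      by (rule partition_function_eq_Zg[OF vs es EG])
    have "0 < Zg (1 - \<beta>) lam {..<?n} ?g" using assms by (intro Zg_pos) auto
    \<comment> \<open>In exponential form, both accuracy requirements become the bound on the
      difference of logarithms.\<close>
    then have q: "partition_function \<beta> lam G / real_of_rat ?z
        = exp (ln (Zg (1 - \<beta>) lam {..<?n} ?g) - ln (real_of_rat ?z))"
      using z(1) by (simp add: Z exp_diff)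
    have bounds: "exp (- \<epsilon>) \<le> partition_function \<beta> lam G / real_of_rat ?z"
      "partition_function \<beta> lam G / real_of_rat ?z \<le> exp \<epsilon>"
      unfolding q exp_le_cancel_iff using z(2) by linarith+
    have "real t \<le> C * (real ?n + 1 / \<epsilon>) ^ d"
      using t(2) time[OF \<epsilon> K(4)] by (meson of_nat_le_iff order_trans)
    then show "\<exists>z t. runs a (ising_prog c0 cL cP) x (NumV z) t \<and>
        exp (- \<epsilon>) \<le> partition_function \<beta> lam G / real_of_rat z \<and>
        partition_function \<beta> lam G / real_of_rat z \<le> exp \<epsilon> \<and>
        real t \<le> C * (real (num_vertices G) + 1 / \<epsilon>) ^ d"
      using t(1) bounds unfolding n by blast
  qed
  then show ?thesis by blast
qed

end
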